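(* Let $\mu_1,\mu_2$ be sigma-finite positive measures on $(X,\mathcal F)$, let $W^{(\mu_1)},W^{(\mu_2)}$ be the associated Brownian motions on the universal probability space $(\Omega,\mathcal C,\mathbb P)$, with It\^o isometries $V_{\mu_1},V_{\mu_2}$. For $B\in\mathcal F^{\rm fin}(\mu_2)$ and $A\in\mathcal F^{\rm fin}(\mu_1)$ set $$P(x,B)=\frac{{\rm d}\,\mathbb E(W^{(\mu_1)}_\cdot W_B^{(\mu_2)})}{{\rm d}\mu_1}(x),\qquad Q(y,A)=\frac{{\rm d}\,\mathbb E(W^{(\mu_2)}_\cdot W_A^{(\mu_1)})}{{\rm d}\mu_2}(y).$$ Then $$\left(V_{\mu_1}^*V_{\mu_2}f_2\right)(x)=\int_XP(x,dy)f_2(y),\quad f_2\in\mathbf L^2(X,\mathcal F,\mu_2),$$ $$\left(V_{\mu_2}^*V_{\mu_1}f_1\right)(y)=\int_XQ(y,dx)f_1(x),\quad f_1\in\mathbf L^2(X,\mathcal F,\mu_1),$$ as equalities in $\mathbf L^2(X,\mathcal F,\mu_1)$ and $\mathbf L^2(X,\mathcal F,\mu_2)$ respectively. Here $f_2\mapsto\int_XP(\cdot,dy)f_2(y)$ denotes the continuous linear map $\mathbf L^2(X,\mathcal F,\mu_2)\to\mathbf L^2(X,\mathcal F,\mu_1)$ determined by $1_B\mapsto P(\cdot,B)$, $B\in\mathcal F^{\rm fin}(\mu_2)$, and $f_1\mapsto\int_XQ(\cdot,dx)f_1(x)$ denotes the continuous linear map $\mathbf L^2(X,\mathcal F,\mu_1)\to\mathbf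 L^2(X,\mathcal F,\mu_2)$ determined by $1_A\mapsto Q(\cdot,A)$, $A\in\mathcal F^{\rm fin}(\mu_1)$.
   Context: For a sigma-finite positive measure $\mu$ on $(X,\mathcal F)$, $\mathcal F^{\rm fin}(\mu)=\{A\in\mathcal F:\mu(A)<\infty\}$. $\mathfrak H(\mu)$ is the reproducing kernel Hilbert space of complex functions on $\mathcal F^{\rm fin}(\mu)$ with kernel $\mu(A\cap B)$; it is known to consist exactly of the functions $M(A)=\int_A h\,d\mu$ with $h\in\mathbf L^2(X,\mathcal F,\mu)$, and $\|M\|=\|h\|_2$. The Krein-Feller derivative $\nabla_\mu:\mathfrak H(\mu)\to\mathbf L^2(X,\mathcal F,\mu)$ sends $M$ to this (unique) $h$; $\nabla_\mu M$ is also written $\frac{{\rm d}M}{{\rm d}\mu}$. Thus $\frac{{\rm d}\,\mathbb E(W^{(\mu_1)}_\cdot W_B^{(\mu_2)})}{{\rm d}\mu_1}$ is $\nabla_{\mu_1}$ applied to $D\mapsto\mathbb E(W^{(\mu_1)}_DW^{(\mu_2)}_B)$, $D\in\mathcal F^{\rm fin}(\mu_1)$, and similarly with the indices exchanged. Universal Hilbert space $\mathfrak H_{(X,\mathcal F)}$: consider pairs $(f,\mu)$ with $\mu$ a sigma-finite positive measure on $(X,\mathcal F)$ and $f\in\mathbf L^2(X,\mathcal F,\mu)$; $(f_1,\mu_1)\sim(f_2,\mu_2)$ if there is a sigma-finite positive measure $\nu$ with $\mu_1\ll\nu$, $\mu_2\ll\nu$ and $f_1\sqrt{d\mu_1/d\nu}=f_2\sqrt{d\mu_2/d\nu}$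 $\nu$-a.e. This is an equivalence relation; the class of $(f,\mu)$ is written $f\sqrt\mu$. With $\nu$ any common dominating measure, the linear structure is given by $\alpha f_1\sqrt{\mu_1}+\beta f_2\sqrt{\mu_2}=\big(\alpha f_1\sqrt{d\mu_1/d\nu}+\beta f_2\sqrt{d\mu_2/d\nu}\big)\sqrt\nu$ and the inner product by $\langle f_1\sqrt{\mu_1},f_2\sqrt{\mu_2}\rangle=\int_X f_1\overline{f_2}\sqrt{d\mu_1/d\nu}\sqrt{d\mu_2/d\nu}\,d\nu$, so that $\|f\sqrt\mu\|^2=\int_X|f|^2d\mu$; this is a Hilbert space. Universal probability space: fix an orthonormal basis $(e_i)_{i\in I}$ of $\mathfrak H_{(X,\mathcal F)}$ consisting of classes of real-valued functions, let $\Omega=\prod_{i\in I}\mathbb R$ with the cylinder sigma-algebra $\mathcal C$ and $\mathbb P$ the product of standard Gaussian measures, with coordinate functions $Z_i$. For $k\in\mathfrak H_{(X,\mathcal F)}$ put $W(k)=\sum_{i\in I}\langle k,e_i\rangle Z_i\in\mathbf L^2(\Omega,\mathcal C,\mathbb P)$. The $\mu$-Brownian motion is $W^{(\mu)}_A=W(1_A\sqrt\mu)$, $A\in\mathcal F^{\rm fin}(\mu)$ (a real centered Gaussian family with $\mathbb E(W^{(\mu)}_AW^{(\mu)}_B)=\mu(A\cap B)$). The It\^o isometry $V_\mu:\mathbf L^2(X,\mathcal F,\mu)\to\mathbf L^2(\Omega,\mathcal C,\mathbb P)$, $V_\mu f=\int_X f(x)\,dW^{(\mu)}_x$, is the unique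 continuous linear map with $V_\mu 1_A=W^{(\mu)}_A$ for $A\in\mathcal F^{\rm fin}(\mu)$; $V_\mu^*$ is its Hilbert space adjoint. *)

theory Defs
  imports "HOL-Probability.Probability"
begin

section \<open>Complex inner product spaces on explicit carriers\<close>

record 'v cips =
  vecs :: "'v set"
  lincomb :: "complex \<Rightarrow> 'v \<Rightarrow> complex \<Rightarrow> 'v \<Rightarrow> 'v"  (* lincomb a u b v is a u + b v *)
  ip :: "'v \<Rightarrow> 'v \<Rightarrow> complex"  (* linear in the first argument *)

definition hnorm :: "('v, 'z) cips_scheme \<Rightarrow> 'v \<Rightarrow> real" where
  "hnorm H u = sqrt (Re (ip H u u))"

definition hdist :: "('v, 'z) cips_scheme \<Rightarrow> 'v \<Rightarrow> 'v \<Rightarrow> real" where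
  "hdist H u v = hnorm H (lincomb H 1 u (-1) v)"

definition linear_subspace :: "('v, 'z) cips_scheme \<Rightarrow> 'v set \<Rightarrow> bool" where
  "linear_subspace H U \<longleftrightarrow> U \<subseteq> vecs H \<and> U \<noteq> {} \<and>
     (\<forall>u\<in>U. \<forall>v\<in>U. \<forall>a b. lincomb H a u b v \<in> U)"

definition hspan :: "('v, 'z) cips_scheme \<Rightarrow> 'v set \<Rightarrow> 'v set" where
  "hspan H B = \<Inter>{U. linear_subspace H U \<and> B \<subseteq> U}"

definition orthonormal_basis :: "('v, 'z) cips_scheme \<Rightarrow> 'i set \<Rightarrow> ('i \<Rightarrow> 'v) \<Rightarrow> bool" where
  "orthonormal_basis H I e \<longleftrightarrow>
     (\<forall>i\<in>I. e i \<in> vecs H) \<and>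
     (\<forall>i\<in>I. \<forall>j\<in>I. ip H (e i) (e j) = (if i = j then 1 else 0)) \<and>
     (\<forall>k\<in>vecs H. \<forall>\<epsilon>>0. \<exists>u\<in>hspan H (e ` I). hdist H k u < \<epsilon>)"

text \<open>Maps are extensional (undefined off the carrier), so that a map is determined
  by its values on the carrier and can be described by its properties.\<close>

definition continuous_linear_maps ::
    "('v, 'y) cips_scheme \<Rightarrow> ('w, 'z) cips_scheme \<Rightarrow> ('v \<Rightarrow> 'w) set" where
  "continuous_linear_maps H K = {T \<in> vecs H \<rightarrow>\<^sub>E vecs K.
     (\<forall>u\<in>vecs H. \<forall>v\<in>vecs H. \<forall>a b. T (lincomb H a u b v) = lincomb K a (T u) b (T v)) \<and>
     (\<forall>u\<in>vecs H. \<forall>\<epsilon>>0. \<exists>\<delta>>0. \<forall>v\<in>vecs H. hdist H u v < \<delta> \<longrightarrow> hdist K (T u) (T v) < \<epsilon>)}"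

definition hilbert_adjoint ::
    "('v, 'y) cips_scheme \<Rightarrow> ('w, 'z) cips_scheme \<Rightarrow> ('v \<Rightarrow> 'w) \<Rightarrow> 'w \<Rightarrow> 'v" where
  "hilbert_adjoint H K T = (\<lambda>w\<in>vecs K. THE u. u \<in> vecs H \<and>
     (\<forall>v\<in>vecs H. ip K (T v) w = ip H v u))"


section \<open>The space L2\<close>

definition L2_funs :: "'a measure \<Rightarrow> ('a \<Rightarrow> complex) set" where
  "L2_funs M = {f \<in> borel_measurable M. integrable M (\<lambda>x. (cmod (f x))\<^sup>2)}"

definition L2_rel :: "'a measure \<Rightarrow> (('a \<Rightarrow> complex) \<times> ('a \<Rightarrow> complex)) set" where
  "L2_rel M = {(f, g). f \<in> L2_funs M \<and> g \<in> L2_funs M \<and> (AE x in M. f x = g x)}"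

definition L2_class :: "'a measure \<Rightarrow> ('a \<Rightarrow> complex) \<Rightarrow> ('a \<Rightarrow> complex) set" where
  "L2_class M f = L2_rel M `` {f}"

text \<open>Operations on equivalence classes are computed on an arbitrary member of the class;
  none of the results depends on the choice.\<close>

definition rep :: "'c set \<Rightarrow> 'c" where
  "rep u = (SOME f. f \<in> u)"

definition L2 :: "'a measure \<Rightarrow> ('a \<Rightarrow> complex) set cips" where
  "L2 M = \<lparr> vecs = L2_funs M // L2_rel M,
     lincomb = (\<lambda>a u b v. L2_class M (\<lambda>x. a * rep u x + b * rep v x)),
     ip = (\<lambda>u v. \<integral>x. rep u x * cnj (rep v x) \<partial>M) \<rparr>"

definition is_L2_extension ::
    "'a measure \<Rightarrow> ('w, 'z) cips_scheme \<Rightarrow> ('a set \<Rightarrow> 'w) \<Rightarrow> (('a \<Rightarrow> complex) set \<Rightarrow> 'w) \<Rightarrow> bool" where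
  "is_L2_extension M K \<Phi> T \<longleftrightarrow> T \<in> continuous_linear_maps (L2 M) K \<and>
     (\<forall>A\<in>fmeasurable M. T (L2_class M (indicator A)) = \<Phi> A)"

text \<open>The continuous linear map on L2 determined by its values \<open>\<Phi> A\<close> on the indicators of the
  sets \<open>A\<close> of finite measure.\<close>

definition L2_extension ::
    "'a measure \<Rightarrow> ('w, 'z) cips_scheme \<Rightarrow> ('a set \<Rightarrow> 'w) \<Rightarrow> ('a \<Rightarrow> complex) set \<Rightarrow> 'w" where
  "L2_extension M K \<Phi> = (THE T. is_L2_extension M K \<Phi> T)"


section \<open>The reproducing kernel Hilbert space of a measure and the Krein-Feller derivative\<close>

text \<open>Functions on \<open>S\<close> are represented by extensional functions, and \<open>H\<close> is a linear space of such
  functions with the pointwise operations.\<close>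

definition is_rkhs :: "'s set \<Rightarrow> ('s \<Rightarrow> 's \<Rightarrow> complex) \<Rightarrow> ('s \<Rightarrow> complex) cips \<Rightarrow> bool" where
  "is_rkhs S k H \<longleftrightarrow>
     vecs H \<subseteq> extensional S \<and> linear_subspace H (vecs H) \<and>
     (\<forall>u\<in>vecs H. \<forall>v\<in>vecs H. \<forall>a b. lincomb H a u b v = (\<lambda>s\<in>S. a * u s + b * v s)) \<and>
     (\<forall>u\<in>vecs H. \<forall>v\<in>vecs H. \<forall>w\<in>vecs H. \<forall>a b.
        ip H (lincomb H a u b v) w = a * ip H u w + b * ip H v w) \<and>
     (\<forall>u\<in>vecs H. \<forall>v\<in>vecs H. ip H v u = cnj (ip H u v)) \<and>
     (\<forall>u\<in>vecs H. 0 \<le> Re (ip H u u) \<and> (ip H u u = 0 \<longrightarrow> u = (\<lambda>s\<in>S. 0))) \<and>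
     (\<forall>u. (\<forall>n::nat. u n \<in> vecs H) \<and>
          (\<forall>\<epsilon>>0. \<exists>N. \<forall>m\<ge>N. \<forall>n\<ge>N. hdist H (u m) (u n) < \<epsilon>) \<longrightarrow>
          (\<exists>v\<in>vecs H. (\<lambda>n. hdist H (u n) v) \<longlonglongrightarrow> 0)) \<and>
     (\<forall>t\<in>S. (\<lambda>s\<in>S. k s t) \<in> vecs H \<and> (\<forall>u\<in>vecs H. u t = ip H u (\<lambda>s\<in>S. k s t)))"

definition rkhs :: "'s set \<Rightarrow> ('s \<Rightarrow> 's \<Rightarrow> complex) \<Rightarrow> ('s \<Rightarrow> complex) set" where
  "rkhs S k = (THE V. \<exists>H. is_rkhs S k H \<and> vecs H = V)"

definition measure_rkhs :: "'a measure \<Rightarrow> ('a set \<Rightarrow> complex) set" where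
  "measure_rkhs \<mu> = rkhs (fmeasurable \<mu>) (\<lambda>A B. complex_of_real (measure \<mu> (A \<inter> B)))"

definition krein_feller :: "'a measure \<Rightarrow> ('a set \<Rightarrow> complex) \<Rightarrow> ('a \<Rightarrow> complex) set" where
  "krein_feller \<mu> = (\<lambda>m\<in>measure_rkhs \<mu>. THE h. h \<in> vecs (L2 \<mu>) \<and>
     (\<forall>A\<in>fmeasurable \<mu>. m A = (LINT x:A|\<mu>. rep h x)))"


section \<open>The universal Hilbert space of a measurable space\<close>

definition sigma_finite_on :: "'a set \<Rightarrow> 'a set set \<Rightarrow> 'a measure \<Rightarrow> bool" where
  "sigma_finite_on X F \<mu> \<longleftrightarrow> space \<mu> = X \<and> sets \<mu> = F \<and> sigma_finite_measure \<mu>"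

definition dominates :: "'a set \<Rightarrow> 'a set set \<Rightarrow> 'a measure \<Rightarrow> 'a measure \<Rightarrow> 'a measure \<Rightarrow> bool" where
  "dominates X F \<nu> \<mu>\<^sub>1 \<mu>\<^sub>2 \<longleftrightarrow> sigma_finite_on X F \<nu> \<and>
     absolutely_continuous \<nu> \<mu>\<^sub>1 \<and> absolutely_continuous \<nu> \<mu>\<^sub>2"
  (* absolutely_continuous \<nu> \<mu> means \<mu> << \<nu> *)

definition sqrt_deriv :: "'a measure \<Rightarrow> 'a measure \<Rightarrow> 'a \<Rightarrow> complex" where
  "sqrt_deriv \<nu> \<mu> x = complex_of_real (sqrt (enn2real (RN_deriv \<nu> \<mu> x)))"

definition uni_pairs :: "'a set \<Rightarrow> 'a set set \<Rightarrow> (('a \<Rightarrow> complex) \<times> 'a measure) set" where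
  "uni_pairs X F = {(f, \<mu>). sigma_finite_on X F \<mu> \<and> f \<in> L2_funs \<mu>}"

definition uni_rel :: "'a set \<Rightarrow> 'a set set \<Rightarrow>
    ((('a \<Rightarrow> complex) \<times> 'a measure) \<times> (('a \<Rightarrow> complex) \<times> 'a measure)) set" where
  "uni_rel X F = {((f\<^sub>1, \<mu>\<^sub>1), (f\<^sub>2, \<mu>\<^sub>2)).
     (f\<^sub>1, \<mu>\<^sub>1) \<in> uni_pairs X F \<and> (f\<^sub>2, \<mu>\<^sub>2) \<in> uni_pairs X F \<and>
     (\<exists>\<nu>. dominates X F \<nu> \<mu>\<^sub>1 \<mu>\<^sub>2 \<and>
        (AE x in \<nu>. f\<^sub>1 x * sqrt_deriv \<nu> \<mu>\<^sub>1 x = f\<^sub>2 x * sqrt_deriv \<nu> \<mu>\<^sub>2 x))}"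

type_synonym 'a uni_vec = "(('a \<Rightarrow> complex) \<times> 'a measure) set"

definition uni_class :: "'a set \<Rightarrow> 'a set set \<Rightarrow> ('a \<Rightarrow> complex) \<Rightarrow> 'a measure \<Rightarrow> 'a uni_vec" where
  "uni_class X F f \<mu> = uni_rel X F `` {(f, \<mu>)}"

definition common_dom :: "'a set \<Rightarrow> 'a set set \<Rightarrow> 'a measure \<Rightarrow> 'a measure \<Rightarrow> 'a measure" where
  "common_dom X F \<mu>\<^sub>1 \<mu>\<^sub>2 = (SOME \<nu>. dominates X F \<nu> \<mu>\<^sub>1 \<mu>\<^sub>2)"

text \<open>The results do not depend on the representatives or on the choice of the dominating
  measure.\<close>

definition universal_space :: "'a set \<Rightarrow> 'a set set \<Rightarrow> 'a uni_vec cips" where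
  "universal_space X F = \<lparr> vecs = uni_pairs X F // uni_rel X F,
     lincomb = (\<lambda>a p b q.
       case (rep p, rep q) of ((f\<^sub>1, \<mu>\<^sub>1), (f\<^sub>2, \<mu>\<^sub>2)) \<Rightarrow>
         let \<nu> = common_dom X F \<mu>\<^sub>1 \<mu>\<^sub>2 in
         uni_class X F (\<lambda>x. a * f\<^sub>1 x * sqrt_deriv \<nu> \<mu>\<^sub>1 x + b * f\<^sub>2 x * sqrt_deriv \<nu> \<mu>\<^sub>2 x) \<nu>),
     ip = (\<lambda>p q.
       case (rep p, rep q) of ((f\<^sub>1, \<mu>\<^sub>1), (f\<^sub>2, \<mu>\<^sub>2)) \<Rightarrow>
         let \<nu> = common_dom X F \<mu>\<^sub>1 \<mu>\<^sub>2 in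
         \<integral>x. f\<^sub>1 x * cnj (f\<^sub>2 x) * sqrt_deriv \<nu> \<mu>\<^sub>1 x * sqrt_deriv \<nu> \<mu>\<^sub>2 x \<partial>\<nu>) \<rparr>"

definition real_orthonormal_basis ::
    "'a set \<Rightarrow> 'a set set \<Rightarrow> 'i set \<Rightarrow> ('i \<Rightarrow> 'a uni_vec) \<Rightarrow> bool" where
  "real_orthonormal_basis X F I e \<longleftrightarrow> orthonormal_basis (universal_space X F) I e \<and>
     (\<forall>i\<in>I. \<exists>f \<mu>. (f, \<mu>) \<in> uni_pairs X F \<and> (\<forall>x\<in>X. f x \<in> \<real>) \<and> e i = uni_class X F f \<mu>)"


section \<open>The universal probability space, Brownian motions and the Ito isometry\<close>

definition gauss_space :: "'i set \<Rightarrow> ('i \<Rightarrow> real) measure" where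
  "gauss_space I = (\<Pi>\<^sub>M i\<in>I. density lborel std_normal_density)"

text \<open>The isonormal map \<open>W\<close>: the sum over \<open>I\<close> is the limit in L2 of the net of finite partial
  sums, and the coordinate function \<open>Z\<^sub>i\<close> is \<open>\<lambda>\<omega>. \<omega> i\<close>.\<close>

definition isonormal :: "'a set \<Rightarrow> 'a set set \<Rightarrow> 'i set \<Rightarrow> ('i \<Rightarrow> 'a uni_vec) \<Rightarrow>
    'a uni_vec \<Rightarrow> (('i \<Rightarrow> real) \<Rightarrow> complex) set" where
  "isonormal X F I e k = (THE w. w \<in> vecs (L2 (gauss_space I)) \<and>
     ((\<lambda>J. hdist (L2 (gauss_space I))
         (L2_class (gauss_space I)
            (\<lambda>\<omega>. \<Sum>i\<in>J. ip (universal_space X F) k (e i) * complex_of_real (\<omega> i))) w)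
       \<longlongrightarrow> 0) (finite_subsets_at_top I))"

definition brownian :: "'a set \<Rightarrow> 'a set set \<Rightarrow> 'i set \<Rightarrow> ('i \<Rightarrow> 'a uni_vec) \<Rightarrow>
    'a measure \<Rightarrow> 'a set \<Rightarrow> (('i \<Rightarrow> real) \<Rightarrow> complex) set" where
  "brownian X F I e \<mu> A = isonormal X F I e (uni_class X F (indicator A) \<mu>)"

definition ito :: "'a set \<Rightarrow> 'a set set \<Rightarrow> 'i set \<Rightarrow> ('i \<Rightarrow> 'a uni_vec) \<Rightarrow>
    'a measure \<Rightarrow> ('a \<Rightarrow> complex) set \<Rightarrow> (('i \<Rightarrow> real) \<Rightarrow> complex) set" where
  "ito X F I e \<mu> = L2_extension \<mu> (L2 (gauss_space I)) (brownian X F I e \<mu>)"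

definition ito_adjoint :: "'a set \<Rightarrow> 'a set set \<Rightarrow> 'i set \<Rightarrow> ('i \<Rightarrow> 'a uni_vec) \<Rightarrow>
    'a measure \<Rightarrow> (('i \<Rightarrow> real) \<Rightarrow> complex) set \<Rightarrow> ('a \<Rightarrow> complex) set" where
  "ito_adjoint X F I e \<mu> = hilbert_adjoint (L2 \<mu>) (L2 (gauss_space I)) (ito X F I e \<mu>)"

text \<open>The function \<open>D \<mapsto> E(W\<^sub>D\<^bsup>(\<mu>)\<^esup> W\<^sub>B\<^bsup>(\<nu>)\<^esup>)\<close> on the sets \<open>D\<close> of finite
  \<open>\<mu>\<close>-measure.\<close>

definition cross_covariance :: "'a set \<Rightarrow> 'a set set \<Rightarrow> 'i set \<Rightarrow> ('i \<Rightarrow> 'a uni_vec) \<Rightarrow>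
    'a measure \<Rightarrow> 'a measure \<Rightarrow> 'a set \<Rightarrow> 'a set \<Rightarrow> complex" where
  "cross_covariance X F I e \<mu> \<nu> B = (\<lambda>D\<in>fmeasurable \<mu>.
     \<integral>\<omega>. rep (brownian X F I e \<mu> D) \<omega> * rep (brownian X F I e \<nu> B) \<omega> \<partial>gauss_space I)"

text \<open>\<open>P(\<cdot>, B) = cross_deriv X F I e \<mu>\<^sub>1 \<mu>\<^sub>2 B\<close> and \<open>Q(\<cdot>, A) = cross_deriv X F I e \<mu>\<^sub>2 \<mu>\<^sub>1 A\<close>.\<close>

definition cross_deriv :: "'a set \<Rightarrow> 'a set set \<Rightarrow> 'i set \<Rightarrow> ('i \<Rightarrow> 'a uni_vec) \<Rightarrow>
    'a measure \<Rightarrow> 'a measure \<Rightarrow> 'a set \<Rightarrow> ('a \<Rightarrow> complex) set" where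
  "cross_deriv X F I e \<mu> \<nu> B = krein_feller \<mu> (cross_covariance X F I e \<mu> \<nu> B)"

end

theory Submission
  imports Defs
begin

text \<open>The map \<open>k \<mapsto> W k\<close> is an isometry of the universal Hilbert space into the \<open>L2\<close> space of the
  Gaussian product measure, by Parseval's identity and completeness of \<open>L2\<close>. Hence \<open>f \<mapsto> W (f sqrt \<mu>)\<close>
  is the Ito isometry of \<open>\<mu>\<close>, and the composite of one Ito isometry with the adjoint of another only
  depends on the inner product of \<open>v sqrt \<mu>\<close> with \<open>f sqrt \<rho>\<close>. With respect to a common dominating
  measure \<open>\<nu>\<close>, this composite is multiplication by \<open>sqrt (d\<rho>/d\<nu>) / sqrt (d\<mu>/d\<nu>)\<close>, so no representation
  theorem is needed for the adjoint. Since the Brownian motions are real, the cross covariance with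
  \<open>W B\<close> is the indefinite \<open>\<mu>\<close>-integral of the image of the indicator of \<open>B\<close>, which is therefore its
  Krein-Feller derivative; and a continuous linear map on \<open>L2\<close> is determined by its values on
  indicators.\<close>

section \<open>Semi-inner product spaces\<close>

text \<open>Nearly every object is given by a description or a choice: \<open>rep\<close>,
  \<open>common_dom\<close>, \<open>isonormal\<close>, \<open>rkhs\<close>,
  \<open>krein_feller\<close>, \<open>L2_extension\<close>, \<open>hilbert_adjoint\<close>. Most of
  the work is therefore existence, uniqueness and independence of choices. Three obstacles shape it.
  The measure hidden in a class \<open>f sqrt mu\<close> is unknown, so everything is moved to a
  measure dominating all those involved, where the operations become those of \<open>L2\<close>. The
  index set of the basis may be uncountable, so sums over it are limits of nets, and completeness
  for sequences has to be carried over to nets. The reproducing kernel space is described by its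
  kernel alone; its uniqueness is the Moore-Aronszajn argument, with the orthogonal projection built
  by hand for a subspace not known to be closed. The quotient of square roots does send
  \<open>L2 rho\<close> into \<open>L2 mu\<close>: the squared modulus of the image of
  \<open>f\<close>, times \<open>d mu/d nu\<close>, is at most \<open>|f|^2 d rho/d nu\<close>.
  Geometrically the image of \<open>f\<close> is the orthogonal projection of
  \<open>f sqrt rho\<close> onto the copy of \<open>L2 mu\<close> inside the universal
  space.\<close>

locale semi_inner_space =
  fixes H :: "('v, 'z) cips_scheme"
  assumes vecs_nonempty: "vecs H \<noteq> {}"
    and lincomb_closed [simp]: "u \<in> vecs H \<Longrightarrow> v \<in> vecs H \<Longrightarrow> lincomb H a u b v \<in> vecs H"
    and ip_lincomb_left: "u \<in> vecs H \<Longrightarrow> v \<in> vecs H \<Longrightarrow> w \<in> vecs H \<Longrightarrow>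
      ip H (lincomb H a u b v) w = a * ip H u w + b * ip H v w"
    and ip_commute: "u \<in> vecs H \<Longrightarrow> v \<in> vecs H \<Longrightarrow> ip H v u = cnj (ip H u v)"
    and ip_nonneg: "u \<in> vecs H \<Longrightarrow> 0 \<le> Re (ip H u u)"
begin

lemma ip_lincomb_right:
  assumes "u \<in> vecs H" "v \<in> vecs H" "w \<in> vecs H"
  shows "ip H w (lincomb H a u b v) = cnj a * ip H w u + cnj b * ip H w v"
  using assms ip_lincomb_left[of u v w a b] ip_commute[of "lincomb H a u b v" w]
    ip_commute[of u w] ip_commute[of v w]
  by simp

lemma hnorm_nonneg [simp]: "u \<in> vecs H \<Longrightarrow> 0 \<le> hnorm H u"
  by (simp add: hnorm_def ip_nonneg)

lemma hdist_nonneg [simp]: "u \<in> vecs H \<Longrightarrow> v \<in> vecs H \<Longrightarrow> 0 \<le> hdist H u v"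
  by (simp add: hdist_def)

lemma Re_ip_self: "u \<in> vecs H \<Longrightarrow> Re (ip H u u) = (hnorm H u)\<^sup>2"
  by (simp add: hnorm_def ip_nonneg)

lemma ip_self: "u \<in> vecs H \<Longrightarrow> ip H u u = of_real ((hnorm H u)\<^sup>2)"
  using ip_commute[of u u] Re_ip_self[of u] by (auto simp: complex_eq_iff)

lemma Re_ip_commute: "u \<in> vecs H \<Longrightarrow> v \<in> vecs H \<Longrightarrow> Re (ip H v u) = Re (ip H u v)"
  using ip_commute[of u v] by simp

lemma hnorm_lincomb_sq:
  assumes [simp]: "u \<in> vecs H" "v \<in> vecs H"
  shows "(hnorm H (lincomb H a u b v))\<^sup>2 =
    (cmod a)\<^sup>2 * (hnorm H u)\<^sup>2 + 2 * Re (a * cnj b * ip H u v) + (cmod b)\<^sup>2 * (hnorm H v)\<^sup>2"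
proof -
  have "ip H (lincomb H a u b v) (lincomb H a u b v) =
      (a * cnj a) * ip H u u + (a * cnj b * ip H u v + cnj (a * cnj b * ip H u v))
      + (b * cnj b) * ip H v v"
    using ip_commute[of u v] by (simp add: ip_lincomb_left ip_lincomb_right algebra_simps)
  then have "Re (ip H (lincomb H a u b v) (lincomb H a u b v)) =
      Re ((a * cnj a) * ip H u u) + 2 * Re (a * cnj b * ip H u v) + Re ((b * cnj b) * ip H v v)"
    by (simp add: algebra_simps)
  also have "(a * cnj a) * ip H u u = of_real ((cmod a)\<^sup>2 * (hnorm H u)\<^sup>2)"
    by (simp only: complex_norm_square[symmetric] ip_self assms of_real_mult)
  also have "(b * cnj b) * ip H v v = of_real ((cmod b)\<^sup>2 * (hnorm H v)\<^sup>2)"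
    by (simp only: complex_norm_square[symmetric] ip_self assms of_real_mult)
  finally show ?thesis by (simp only: Re_ip_self lincomb_closed assms Re_complex_of_real)
qed

lemma hdist_sq:
  assumes "u \<in> vecs H" "v \<in> vecs H"
  shows "(hdist H u v)\<^sup>2 = (hnorm H u)\<^sup>2 - 2 * Re (ip H u v) + (hnorm H v)\<^sup>2"
  using hnorm_lincomb_sq[OF assms, of 1 "-1"] by (simp add: hdist_def)

text \<open>Without definiteness a zero norm does not mean a zero vector, so the usual normalization
  is replaced by a real form in two variables. The scalar \<open>s\<close> rotates \<open>z\<close>
  onto the positive axis; the squared norm of the combination of \<open>u\<close> and
  \<open>v\<close> with coefficients \<open>t * s\<close> and \<open>- r\<close> is then a
  nonnegative quadratic form in the real numbers \<open>t\<close> and \<open>r\<close>.\<close>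

lemma Cauchy_Schwarz:
  assumes [simp]: "u \<in> vecs H" "v \<in> vecs H"
  shows "cmod (ip H u v) \<le> hnorm H u * hnorm H v"
proof (cases "ip H u v = 0")
  case False
  define z where "z = ip H u v"
  define s where "s = cnj z / of_real (cmod z)"
  have s: "s * z = of_real (cmod z)" "cmod s = 1"
  proof -
    have "cnj z * z = of_real (cmod z * cmod z)"
      using complex_norm_square[of z] by (simp add: power2_eq_square mult.commute)
    then show "s * z = of_real (cmod z)" "cmod s = 1"
      using False by (simp_all add: s_def z_def norm_divide)
  qed
  have quad: "0 \<le> t\<^sup>2 * (hnorm H u)\<^sup>2 - 2 * t * r * cmod z + r\<^sup>2 * (hnorm H v)\<^sup>2" for t r :: real
  proof -
    have "(of_real t * s) * cnj (- of_real r) * z = of_real (- t * r) * (s * z)"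
      by simp
    then have "(of_real t * s) * cnj (- of_real r) * z = of_real (- t * r * cmod z)"
      by (simp only: s of_real_mult)
    then have "Re ((of_real t * s) * cnj (- of_real r) * z) = - t * r * cmod z"
      by (simp only: Re_complex_of_real)
    then have "(hnorm H (lincomb H (of_real t * s) u (- of_real r) v))\<^sup>2 =
        t\<^sup>2 * (hnorm H u)\<^sup>2 - 2 * t * r * cmod z + r\<^sup>2 * (hnorm H v)\<^sup>2"
      unfolding hnorm_lincomb_sq[OF assms] z_def[symmetric]
      by (simp only: norm_mult s norm_minus_cancel norm_of_real power_mult_distrib) simp
    then show ?thesis by (metis zero_le_power2)
  qed
  define A B where "A = hnorm H u" and "B = hnorm H v"
  have AB: "A \<ge> 0" "B \<ge> 0" by (simp_all add: A_def B_def)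
  have q: "0 \<le> t\<^sup>2 * A\<^sup>2 - 2 * t * r * cmod z + r\<^sup>2 * B\<^sup>2" for t r
    using quad by (simp add: A_def B_def)
  have "cmod z \<le> A * B"
  \<comment> \<open>If one norm vanishes, the form is affine in one variable; the value chosen for
    that variable would make it negative because \<open>cmod z\<close> is positive.\<close>
  proof (cases "A = 0 \<or> B = 0")
    case True
    have zp: "cmod z > 0" using False by (simp add: z_def)
    from True show ?thesis
    proof
      assume "A = 0"
      moreover have "(B\<^sup>2 + 1) / cmod z * cmod z = B\<^sup>2 + 1" using zp by simp
      ultimately have "0 \<le> - B\<^sup>2 - 2" using q[of "(B\<^sup>2 + 1) / cmod z" 1] zp by auto
      then show ?thesis by (smt (verit) zero_le_power2)
    next
      assume "B = 0"
      moreover have "(A\<^sup>2 + 1) / cmod z * cmod z = A\<^sup>2 + 1" using zp by simp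
      ultimately have "0 \<le> - A\<^sup>2 - 2" using q[of 1 "(A\<^sup>2 + 1) / cmod z"] zp by auto
      then show ?thesis by (smt (verit) zero_le_power2)
    qed
  next
    case False
    with AB have p: "A * B > 0" by simp
    \<comment> \<open>The values \<open>t = B\<close> and \<open>r = A\<close> make the two square
      terms equal and leave the common factor \<open>2 * (A * B)\<close>.\<close>
    have "0 \<le> 2 * (A * B) * (A * B - cmod z)"
      using q[of B A] by (simp add: algebra_simps power2_eq_square)
    with p show ?thesis by (simp add: zero_le_mult_iff)
  qed
  then show ?thesis by (simp add: z_def A_def B_def)
qed simp

lemma hdist_commute:
  assumes "u \<in> vecs H" "v \<in> vecs H"
  shows "hdist H u v = hdist H v u"
proof (rule power2_eq_imp_eq)
  show "(hdist H u v)\<^sup>2 = (hdist H v u)\<^sup>2"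
    using assms by (simp add: hdist_sq Re_ip_commute[OF assms])
qed (use assms in auto)

lemma hdist_self [simp]: "u \<in> vecs H \<Longrightarrow> hdist H u u = 0"
  using hdist_sq[of u u] Re_ip_self[of u] by simp

lemma hdist_triangle:
  assumes [simp]: "u \<in> vecs H" "v \<in> vecs H" "w \<in> vecs H"
  shows "hdist H u w \<le> hdist H u v + hdist H v w"
proof -
  let ?x = "lincomb H 1 u (-1) v" and ?y = "lincomb H 1 v (-1) w"
  have "(hdist H u w)\<^sup>2 = (hdist H u v)\<^sup>2 + 2 * Re (ip H ?x ?y) + (hdist H v w)\<^sup>2"
    by (simp add: hdist_sq ip_lincomb_left ip_lincomb_right Re_ip_self)
  also have "Re (ip H ?x ?y) \<le> hdist H u v * hdist H v w"
    using Cauchy_Schwarz[of ?x ?y] complex_Re_le_cmod[of "ip H ?x ?y"] by (simp add: hdist_def)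
  finally have "(hdist H u w)\<^sup>2 \<le> (hdist H u v + hdist H v w)\<^sup>2"
    by (simp add: power2_sum)
  then show ?thesis by (rule power2_le_imp_le) simp
qed

lemma ip_diff_bound:
  assumes [simp]: "u \<in> vecs H" "v \<in> vecs H" "w \<in> vecs H"
  shows "cmod (ip H u w - ip H v w) \<le> hdist H u v * hnorm H w"
  using Cauchy_Schwarz[of "lincomb H 1 u (-1) v" w] by (simp add: ip_lincomb_left hdist_def)

lemma tendsto_ip_left:
  assumes "\<And>n. u n \<in> vecs H" "v \<in> vecs H" "w \<in> vecs H"
    and lim: "((\<lambda>n. hdist H (u n) v) \<longlongrightarrow> 0) F"
  shows "((\<lambda>n. ip H (u n) w) \<longlongrightarrow> ip H v w) F"
proof (rule LIM_zero_cancel, rule Lim_null_comparison)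
  show "\<forall>\<^sub>F n in F. cmod (ip H (u n) w - ip H v w) \<le> hdist H (u n) v * hnorm H w"
    using ip_diff_bound assms by simp
  show "((\<lambda>n. hdist H (u n) v * hnorm H w) \<longlongrightarrow> 0) F"
    using tendsto_mult_left_zero[OF lim] .
qed

text \<open>The filter is arbitrary because both sequences and nets of finite index sets occur as
  limits later on.\<close>

lemma hdist_limits_eq:
  assumes "\<And>n. u n \<in> vecs H" "v \<in> vecs H" "w \<in> vecs H" "F \<noteq> bot"
    and "((\<lambda>n. hdist H (u n) v) \<longlongrightarrow> 0) F" "((\<lambda>n. hdist H (u n) w) \<longlongrightarrow> 0) F"
  shows "hdist H v w = 0"
proof -
  have "hdist H v w \<le> hdist H (u n) v + hdist H (u n) w" for n
    using hdist_triangle[of v "u n" w] hdist_commute[of v "u n"] assms by simp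
  moreover have "((\<lambda>n. hdist H (u n) v + hdist H (u n) w) \<longlongrightarrow> 0) F"
    using tendsto_add[OF assms(5,6)] by simp
  ultimately have "hdist H v w \<le> 0"
    using assms(4) by (intro tendsto_lowerbound[of _ 0 F]) auto
  then show ?thesis using hdist_nonneg[OF assms(2,3)] by linarith
qed

lemma hnorm_diff_le:
  assumes "u \<in> vecs H" "v \<in> vecs H"
  shows "\<bar>hnorm H u - hnorm H v\<bar> \<le> hdist H u v"
proof (rule power2_le_imp_le)
  have "Re (ip H u v) \<le> hnorm H u * hnorm H v"
    using Cauchy_Schwarz[OF assms] complex_Re_le_cmod[of "ip H u v"] by linarith
  then show "\<bar>hnorm H u - hnorm H v\<bar>\<^sup>2 \<le> (hdist H u v)\<^sup>2"
    by (simp add: hdist_sq[OF assms] power2_diff)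
qed (use assms in simp)

lemma tendsto_hnorm:
  assumes "\<And>n. u n \<in> vecs H" "v \<in> vecs H" "((\<lambda>n. hdist H (u n) v) \<longlongrightarrow> 0) F"
  shows "((\<lambda>n. hnorm H (u n)) \<longlongrightarrow> hnorm H v) F"
proof (rule LIM_zero_cancel, rule Lim_null_comparison[OF _ assms(3)])
  show "\<forall>\<^sub>F n in F. norm (hnorm H (u n) - hnorm H v) \<le> hdist H (u n) v"
    using hnorm_diff_le assms by simp
qed

text \<open>No vector space laws are available for \<open>lincomb\<close>, so the difference of the
  combinations is not rewritten into the combination of the differences. The two have the same inner
  products with every vector, hence the same norm, and that suffices.\<close>

lemma hdist_lincomb_le:
  assumes [simp]: "u \<in> vecs H" "v \<in> vecs H" "u' \<in> vecs H" "v' \<in> vecs H"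
  shows "hdist H (lincomb H a u b v) (lincomb H a u' b v') \<le> cmod a * hdist H u u' + cmod b * hdist H v v'"
proof (rule power2_le_imp_le)
  let ?x = "lincomb H 1 u (-1) u'" and ?y = "lincomb H 1 v (-1) v'"
  let ?z = "lincomb H 1 (lincomb H a u b v) (-1) (lincomb H a u' b v')"
  have "ip H ?z w = ip H (lincomb H a ?x b ?y) w" if "w \<in> vecs H" for w
    using that by (simp add: ip_lincomb_left algebra_simps)
  moreover have "ip H w ?z = ip H w (lincomb H a ?x b ?y)" if "w \<in> vecs H" for w
    using that by (simp add: ip_lincomb_right algebra_simps)
  ultimately have "ip H ?z ?z = ip H (lincomb H a ?x b ?y) (lincomb H a ?x b ?y)"
    by simp
  then have "(hdist H (lincomb H a u b v) (lincomb H a u' b v'))\<^sup>2 = (hnorm H (lincomb H a ?x b ?y))\<^sup>2"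
    by (simp add: hdist_def hnorm_def)
  also have "\<dots> = (cmod a)\<^sup>2 * (hdist H u u')\<^sup>2 + 2 * Re (a * cnj b * ip H ?x ?y) + (cmod b)\<^sup>2 * (hdist H v v')\<^sup>2"
    by (simp add: hnorm_lincomb_sq hdist_def)
  also have "Re (a * cnj b * ip H ?x ?y) \<le> cmod a * cmod b * (hdist H u u' * hdist H v v')"
  proof -
    have "Re (a * cnj b * ip H ?x ?y) \<le> cmod (a * cnj b * ip H ?x ?y)" by (rule complex_Re_le_cmod)
    also have "\<dots> = cmod a * cmod b * cmod (ip H ?x ?y)" by (simp add: norm_mult)
    also have "\<dots> \<le> cmod a * cmod b * (hdist H u u' * hdist H v v')"
      using Cauchy_Schwarz[of ?x ?y] by (intro mult_left_mono) (auto simp: hdist_def)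
    finally show ?thesis .
  qed
  finally show "(hdist H (lincomb H a u b v) (lincomb H a u' b v'))\<^sup>2
      \<le> (cmod a * hdist H u u' + cmod b * hdist H v v')\<^sup>2"
    by (simp add: power2_sum power_mult_distrib algebra_simps)
qed simp

text \<open>Elements of the span are only described through their inner products; this avoids the vector
  space axioms for \<open>lincomb\<close>.\<close>

lemma hspan_weak_representation:
  assumes e: "\<And>i. i \<in> I \<Longrightarrow> e i \<in> vecs H" and u: "u \<in> hspan H (e ` I)"
  shows "u \<in> vecs H \<and> (\<exists>J a. finite J \<and> J \<subseteq> I \<and>
    (\<forall>v\<in>vecs H. ip H u v = (\<Sum>i\<in>J. a i * ip H (e i) v)))"
proof -
  define U where "U = {u \<in> vecs H. \<exists>J a. finite J \<and> J \<subseteq> I \<and>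
    (\<forall>v\<in>vecs H. ip H u v = (\<Sum>i\<in>J. a i * ip H (e i) v))}"
  have "linear_subspace H U"
    unfolding linear_subspace_def
  proof (intro conjI ballI allI)
    show "U \<subseteq> vecs H" by (auto simp: U_def)
    obtain k where "k \<in> vecs H" using vecs_nonempty by auto
    then have "lincomb H 0 k 0 k \<in> U"
      by (auto simp: U_def ip_lincomb_left intro!: exI[of _ "{}"])
    then show "U \<noteq> {}" by auto
  next
    fix u v a b assume "u \<in> U" "v \<in> U"
    then obtain J c J' c' where u: "u \<in> vecs H" "finite J" "J \<subseteq> I"
        "\<And>w. w \<in> vecs H \<Longrightarrow> ip H u w = (\<Sum>i\<in>J. c i * ip H (e i) w)"
      and v: "v \<in> vecs H" "finite J'" "J' \<subseteq> I"
        "\<And>w. w \<in> vecs H \<Longrightarrow> ip H v w = (\<Sum>i\<in>J'. c' i * ip H (e i) w)"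
      unfolding U_def by blast
    let ?d = "\<lambda>i. a * (if i \<in> J then c i else 0) + b * (if i \<in> J' then c' i else 0)"
    have "ip H (lincomb H a u b v) w = (\<Sum>i\<in>J \<union> J'. ?d i * ip H (e i) w)"
      if w: "w \<in> vecs H" for w
    proof -
      have "(\<Sum>i\<in>J. c i * ip H (e i) w) = (\<Sum>i\<in>J \<union> J'. (if i \<in> J then c i else 0) * ip H (e i) w)"
        using u(2) v(2) by (intro sum.mono_neutral_cong_left) auto
      moreover have "(\<Sum>i\<in>J'. c' i * ip H (e i) w)
          = (\<Sum>i\<in>J \<union> J'. (if i \<in> J' then c' i else 0) * ip H (e i) w)"
        using u(2) v(2) by (intro sum.mono_neutral_cong_left) auto
      ultimately show ?thesis
        using u v w
        by (simp only: ip_lincomb_left sum_distrib_left sum.distrib[symmetric] distrib_right mult.assoc)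
    qed
    then show "lincomb H a u b v \<in> U"
      using u v unfolding U_def by (auto intro!: exI[of _ "J \<union> J'"] exI[of _ ?d])
  qed
  moreover have "e ` I \<subseteq> U"
  proof
    fix x assume "x \<in> e ` I"
    then obtain i where "i \<in> I" "x = e i" by auto
    then show "x \<in> U"
      unfolding U_def using e by (auto intro!: exI[of _ "{i}"] exI[of _ "\<lambda>_. 1"])
  qed
  ultimately have "u \<in> U" using u unfolding hspan_def by blast
  then show ?thesis unfolding U_def by blast
qed

text \<open>The formula \<open>expand\<close> splits the squared distance of \<open>k\<close> from a
  finite combination into the missing mass of the coefficients \<open>c\<close> and the error
  \<open>c - a\<close>. With \<open>a = c\<close> it gives Bessel's inequality; for an element of
  the span close to \<open>k\<close> it shows that the finite sums come arbitrarily near to the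
  squared norm.\<close>

lemma Parseval:
  assumes onb: "orthonormal_basis H I e" and k: "k \<in> vecs H"
  shows "((\<lambda>i. (cmod (ip H k (e i)))\<^sup>2) has_sum (hnorm H k)\<^sup>2) I"
proof -
  define c where "c i = ip H k (e i)" for i
  have eH: "e i \<in> vecs H" if "i \<in> I" for i
    using onb that by (auto simp: orthonormal_basis_def)
  have ee: "ip H (e i) (e j) = (if i = j then 1 else 0)" if "i \<in> I" "j \<in> I" for i j
    using onb that by (auto simp: orthonormal_basis_def)
  have expand: "(hdist H k u)\<^sup>2 = (hnorm H k)\<^sup>2 - (\<Sum>i\<in>J. (cmod (c i))\<^sup>2) + (\<Sum>i\<in>J. (cmod (c i - a i))\<^sup>2)"
    if u: "u \<in> vecs H" "finite J" "J \<subseteq> I"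
      "\<And>v. v \<in> vecs H \<Longrightarrow> ip H u v = (\<Sum>i\<in>J. a i * ip H (e i) v)" for u J a
  proof -
    have ue: "ip H u (e i) = (if i \<in> J then a i else 0)" if "i \<in> I" for i
    proof -
      have "(\<Sum>j\<in>J. a j * ip H (e j) (e i)) = (\<Sum>j\<in>J. if j = i then a j else 0)"
        using u(3) that ee by (intro sum.cong) auto
      then show ?thesis
        using u that eH by (simp add: sum.delta)
    qed
    have "ip H u u = (\<Sum>i\<in>J. a i * cnj (ip H u (e i)))"
      using u eH ip_commute[of u] by (intro trans[OF u(4)] sum.cong refl) (metis subsetD)+
    also have "\<dots> = (\<Sum>i\<in>J. a i * cnj (a i))"
      using u ue by (intro sum.cong) auto
    finally have "Re (ip H u u) = (\<Sum>i\<in>J. (cmod (a i))\<^sup>2)"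
      by (simp flip: complex_norm_square)
    then have uu: "(hnorm H u)\<^sup>2 = (\<Sum>i\<in>J. (cmod (a i))\<^sup>2)"
      using Re_ip_self[OF u(1)] by linarith
    have "ip H k u = cnj (ip H u k)" using k u ip_commute by blast
    also have "\<dots> = (\<Sum>i\<in>J. cnj (a i) * c i)"
      using u eH k ip_commute[of "e _" k] by (auto simp: c_def intro!: sum.cong)
    finally have ku: "Re (ip H k u) = (\<Sum>i\<in>J. Re (cnj (a i) * c i))" by simp
    have "(\<Sum>i\<in>J. (cmod (c i - a i))\<^sup>2) =
        (\<Sum>i\<in>J. (cmod (c i))\<^sup>2 - 2 * Re (cnj (a i) * c i) + (cmod (a i))\<^sup>2)"
      by (intro sum.cong refl, simp only: cmod_power2) (simp add: power2_eq_square algebra_simps)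
    also have "\<dots> = (\<Sum>i\<in>J. (cmod (c i))\<^sup>2) - 2 * Re (ip H k u) + (hnorm H u)\<^sup>2"
      by (simp only: ku uu sum.distrib sum_subtractf sum_distrib_left)
    finally show ?thesis
      using hdist_sq[OF k u(1)] by simp
  qed
  have Bessel: "(\<Sum>i\<in>J. (cmod (c i))\<^sup>2) \<le> (hnorm H k)\<^sup>2" if "finite J" "J \<subseteq> I" for J
  proof -
    \<comment> \<open>The partial expansion of \<open>k\<close> over \<open>J\<close>, known through
      its inner products; \<open>lincomb H 0 k 0 k\<close> acts as the zero vector.\<close>
    have "\<exists>u\<in>vecs H. \<forall>v\<in>vecs H. ip H u v = (\<Sum>i\<in>J. c i * ip H (e i) v)"
      using that
    proof (induction J rule: finite_induct)
      case empty
      show ?case using k by (intro bexI[of _ "lincomb H 0 k 0 k"]) (auto simp: ip_lincomb_left)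
    next
      case (insert j J)
      then obtain u where u: "u \<in> vecs H" "\<forall>v\<in>vecs H. ip H u v = (\<Sum>i\<in>J. c i * ip H (e i) v)"
        by auto
      show ?case
        using u insert eH by (intro bexI[of _ "lincomb H (c j) (e j) 1 u"]) (auto simp: ip_lincomb_left)
    qed
    then obtain u where u: "u \<in> vecs H" "\<And>v. v \<in> vecs H \<Longrightarrow> ip H u v = (\<Sum>i\<in>J. c i * ip H (e i) v)"
      by blast
    have "0 \<le> (hdist H k u)\<^sup>2" by simp
    also have "\<dots> = (hnorm H k)\<^sup>2 - (\<Sum>i\<in>J. (cmod (c i))\<^sup>2)"
      by (subst expand[OF u(1) that u(2)]) auto
    finally show ?thesis by simp
  qed
  show ?thesis
    unfolding has_sum_def c_def[symmetric]
  proof (rule tendstoI)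
    fix \<epsilon> :: real assume "\<epsilon> > 0"
    then obtain u where "u \<in> hspan H (e ` I)" and near: "hdist H k u < sqrt \<epsilon>"
      using onb k unfolding orthonormal_basis_def by (meson real_sqrt_gt_zero)
    then obtain J a where u: "u \<in> vecs H" "finite J" "J \<subseteq> I"
        "\<And>v. v \<in> vecs H \<Longrightarrow> ip H u v = (\<Sum>i\<in>J. a i * ip H (e i) v)"
      using hspan_weak_representation[of I e u] eH by blast
    have "(hnorm H k)\<^sup>2 - (\<Sum>i\<in>J. (cmod (c i))\<^sup>2) \<le> (hdist H k u)\<^sup>2"
      using expand[OF u] by (simp add: sum_nonneg)
    also have "\<dots> < \<epsilon>"
      using near \<open>\<epsilon> > 0\<close> u k by (metis abs_of_nonneg hdist_nonneg real_sqrt_abs real_sqrt_less_iff)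
    finally have J: "(hnorm H k)\<^sup>2 - (\<Sum>i\<in>J. (cmod (c i))\<^sup>2) < \<epsilon>" .
    show "\<forall>\<^sub>F J in finite_subsets_at_top I. dist (\<Sum>i\<in>J. (cmod (c i))\<^sup>2) ((hnorm H k)\<^sup>2) < \<epsilon>"
      unfolding eventually_finite_subsets_at_top
    proof (intro exI[of _ J] conjI allI impI)
      fix K assume K: "finite K \<and> J \<subseteq> K \<and> K \<subseteq> I"
      then have "(\<Sum>i\<in>J. (cmod (c i))\<^sup>2) \<le> (\<Sum>i\<in>K. (cmod (c i))\<^sup>2)"
        by (intro sum_mono2) auto
      then show "dist (\<Sum>i\<in>K. (cmod (c i))\<^sup>2) ((hnorm H k)\<^sup>2) < \<epsilon>"
        using J Bessel[of K] K by (simp add: dist_real_def)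
    qed (use u in auto)
  qed
qed

end

text \<open>Definiteness in metric form: two limits of the same net come out at distance zero, and
  this turns that into equality.\<close>

locale inner_space = semi_inner_space +
  assumes hdist_zero_imp_eq: "u \<in> vecs H \<Longrightarrow> v \<in> vecs H \<Longrightarrow> hdist H u v = 0 \<Longrightarrow> u = v"

text \<open>Polarization: comparing the norms of \<open>a u + v\<close> and of its image for
  \<open>a = 1\<close> and for the imaginary unit yields the real and the imaginary part of the
  inner product.\<close>

lemma isometry_preserves_ip:
  assumes H: "semi_inner_space H" and K: "semi_inner_space K"
    and T: "\<And>u. u \<in> vecs H \<Longrightarrow> T u \<in> vecs K"
    and lin: "\<And>u v a b. u \<in> vecs H \<Longrightarrow> v \<in> vecs H \<Longrightarrow>
      T (lincomb H a u b v) = lincomb K a (T u) b (T v)"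
    and iso: "\<And>u. u \<in> vecs H \<Longrightarrow> hnorm K (T u) = hnorm H u"
    and u: "u \<in> vecs H" and v: "v \<in> vecs H"
  shows "ip K (T u) (T v) = ip H u v"
proof -
  interpret H: semi_inner_space H by fact
  interpret K: semi_inner_space K by fact
  have *: "Re (a * ip K (T u) (T v)) = Re (a * ip H u v)" for a
  proof -
    have "(hnorm K (lincomb K a (T u) 1 (T v)))\<^sup>2 = (hnorm H (lincomb H a u 1 v))\<^sup>2"
      using iso[of "lincomb H a u 1 v"] lin u v by simp
    then show ?thesis
      using iso[OF u] iso[OF v]
      by (simp only: H.hnorm_lincomb_sq K.hnorm_lincomb_sq T u v) simp
  qed
  show ?thesis
    using *[of 1] *[of "\<i>"] by (simp add: complex_eq_iff)
qed

section \<open>The Hilbert space of square integrable functions\<close>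

lemma L2_funsI:
  "f \<in> borel_measurable M \<Longrightarrow> integrable M (\<lambda>x. (cmod (f x))\<^sup>2) \<Longrightarrow> f \<in> L2_funs M"
  by (simp add: L2_funs_def)

lemma borel_measurable_cnj [measurable (raw)]:
  "f \<in> borel_measurable M \<Longrightarrow> (\<lambda>x. cnj (f x)) \<in> borel_measurable M"
  by (rule borel_measurable_continuous_on[of cnj]) (auto intro: continuous_intros)

lemma L2_funs_measurable [simp]: "f \<in> L2_funs M \<Longrightarrow> f \<in> borel_measurable M"
  and L2_funs_integrable: "f \<in> L2_funs M \<Longrightarrow> integrable M (\<lambda>x. (cmod (f x))\<^sup>2)"
  by (simp_all add: L2_funs_def)

lemma L2_funs_lincomb [simp]:
  assumes f: "f \<in> L2_funs M" and g: "g \<in> L2_funs M"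
  shows "(\<lambda>x. a * f x + b * g x) \<in> L2_funs M"
proof -
  note [measurable] = L2_funs_measurable[OF f] L2_funs_measurable[OF g]
  have "integrable M (\<lambda>x. (cmod (a * f x + b * g x))\<^sup>2)"
  proof (rule Bochner_Integration.integrable_bound)
    show "integrable M (\<lambda>x. 2 * (cmod a)\<^sup>2 * (cmod (f x))\<^sup>2 + 2 * (cmod b)\<^sup>2 * (cmod (g x))\<^sup>2)"
      using L2_funs_integrable[OF f] L2_funs_integrable[OF g] by simp
    have "(cmod (a * f x + b * g x))\<^sup>2 \<le> 2 * (cmod a)\<^sup>2 * (cmod (f x))\<^sup>2 + 2 * (cmod b)\<^sup>2 * (cmod (g x))\<^sup>2" for x
    proof -
      have "(cmod (a * f x + b * g x))\<^sup>2 \<le> (cmod (a * f x) + cmod (b * g x))\<^sup>2"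
        by (intro power_mono norm_triangle_ineq) auto
      also have "\<dots> \<le> 2 * (cmod (a * f x))\<^sup>2 + 2 * (cmod (b * g x))\<^sup>2"
        using sum_squares_bound[of "cmod (a * f x)" "cmod (b * g x)"] by (simp add: power2_sum)
      finally show ?thesis by (simp add: norm_mult power_mult_distrib)
    qed
    then show "AE x in M. norm ((cmod (a * f x + b * g x))\<^sup>2) \<le>
        norm (2 * (cmod a)\<^sup>2 * (cmod (f x))\<^sup>2 + 2 * (cmod b)\<^sup>2 * (cmod (g x))\<^sup>2)"
      by (auto intro!: AE_I2 simp: add_nonneg_nonneg)
  qed measurable
  then show ?thesis by (intro L2_funsI) measurable
qed

lemma L2_funs_scale [simp]: "f \<in> L2_funs M \<Longrightarrow> (\<lambda>x. a * f x) \<in> L2_funs M"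
  using L2_funs_lincomb[of f M f a 0] by simp

lemma L2_funs_diff [simp]:
  "f \<in> L2_funs M \<Longrightarrow> g \<in> L2_funs M \<Longrightarrow> (\<lambda>x. f x - g x) \<in> L2_funs M"
  using L2_funs_lincomb[of f M g 1 "-1"] by simp

lemma L2_funs_zero [simp]: "(\<lambda>x. 0) \<in> L2_funs M"
  by (rule L2_funsI) auto

lemma L2_funs_cnj [simp]: "f \<in> L2_funs M \<Longrightarrow> (\<lambda>x. cnj (f x)) \<in> L2_funs M"
  using L2_funs_measurable[of f M] L2_funs_integrable[of f M]
  by (intro L2_funsI) (simp_all add: borel_measurable_cnj)

lemma L2_funs_sum:
  assumes "\<And>i. i \<in> J \<Longrightarrow> f i \<in> L2_funs M"
  shows "(\<lambda>x. \<Sum>i\<in>J. c i * f i x) \<in> L2_funs M"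
  using assms
proof (induction J rule: infinite_finite_induct)
  case (insert i J)
  then show ?case using L2_funs_lincomb[of "f i" M "\<lambda>x. \<Sum>i\<in>J. c i * f i x" "c i" 1] by simp
qed auto

lemma L2_funs_bound:
  assumes "f \<in> L2_funs M" "g \<in> borel_measurable M" "AE x in M. cmod (g x) \<le> cmod (f x)"
  shows "g \<in> L2_funs M"
proof (rule L2_funsI)
  show "integrable M (\<lambda>x. (cmod (g x))\<^sup>2)"
  proof (rule Bochner_Integration.integrable_bound[OF L2_funs_integrable[OF assms(1)]])
    show "AE x in M. norm ((cmod (g x))\<^sup>2) \<le> norm ((cmod (f x))\<^sup>2)"
      using assms(3) by eventually_elim (auto intro: power_mono)
  qed (use assms in measurable)
qed fact

lemma L2_funs_indicator [simp]:
  assumes "A \<in> fmeasurable M"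
  shows "indicator A \<in> L2_funs M"
proof -
  have "integrable M (indicator A :: _ \<Rightarrow> real)"
    using assms by (auto simp: fmeasurable_def)
  moreover have "(\<lambda>x. (cmod (indicator A x))\<^sup>2) = (indicator A :: _ \<Rightarrow> real)"
    by (auto simp: indicator_def)
  ultimately show ?thesis
    using assms by (intro L2_funsI) (auto simp: fmeasurable_def)
qed

lemma L2_funs_mult_integrable:
  assumes f: "f \<in> L2_funs M" and g: "g \<in> L2_funs M"
  shows "integrable M (\<lambda>x. f x * cnj (g x))"
proof (rule Bochner_Integration.integrable_bound)
  show "integrable M (\<lambda>x. (cmod (f x))\<^sup>2 + (cmod (g x))\<^sup>2)"
    using L2_funs_integrable[OF f] L2_funs_integrable[OF g] by simp
  have "cmod (f x) * cmod (g x) \<le> (cmod (f x))\<^sup>2 + (cmod (g x))\<^sup>2" for x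
    using sum_squares_bound[of "cmod (f x)" "cmod (g x)"]
      mult_nonneg_nonneg[OF norm_ge_zero norm_ge_zero, of "f x" "g x"] by linarith
  then show "AE x in M. cmod (f x * cnj (g x)) \<le> norm ((cmod (f x))\<^sup>2 + (cmod (g x))\<^sup>2)"
    by (auto intro!: AE_I2 simp: norm_mult)
qed (use f g L2_funs_measurable[of f M] L2_funs_measurable[of g M] in measurable)

section \<open>Square integrable functions modulo null sets as an inner product space\<close>

lemma equiv_L2_rel: "equiv (L2_funs M) (L2_rel M)"
proof (rule equivI)
  show "L2_rel M \<subseteq> L2_funs M \<times> L2_funs M" by (auto simp: L2_rel_def)
  show "refl_on (L2_funs M) (L2_rel M)" by (auto simp: refl_on_def L2_rel_def)
  show "sym (L2_rel M)"
  proof (rule symI)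
    fix f g assume "(f, g) \<in> L2_rel M"
    then show "(g, f) \<in> L2_rel M" unfolding L2_rel_def by (auto simp: eq_commute)
  qed
  show "trans (L2_rel M)"
  proof (rule transI)
    fix f g h assume "(f, g) \<in> L2_rel M" "(g, h) \<in> L2_rel M"
    then show "(f, h) \<in> L2_rel M" unfolding L2_rel_def by (auto elim: eventually_elim2)
  qed
qed

lemma L2_class_in [simp]: "f \<in> L2_funs M \<Longrightarrow> L2_class M f \<in> vecs (L2 M)"
  by (simp add: L2_def L2_class_def quotientI)

lemma L2_class_cases:
  assumes "u \<in> vecs (L2 M)"
  obtains f where "f \<in> L2_funs M" "u = L2_class M f"
  using assms by (auto simp: L2_def L2_class_def elim: quotientE)

lemma L2_class_eq_iff:
  assumes "f \<in> L2_funs M" "g \<in> L2_funs M"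
  shows "L2_class M f = L2_class M g \<longleftrightarrow> (AE x in M. f x = g x)"
  unfolding L2_class_def using eq_equiv_class_iff[OF equiv_L2_rel assms] assms
  by (simp add: L2_rel_def)

text \<open>The function picked by \<open>rep\<close> is known only up to almost everywhere
  equality, which is enough for linear combinations and integrals; this is how the choice in the
  definition of \<open>L2\<close> is eliminated.\<close>

lemma rep_L2_class:
  assumes "f \<in> L2_funs M"
  shows "rep (L2_class M f) \<in> L2_funs M" "AE x in M. f x = rep (L2_class M f) x"
proof -
  have "f \<in> L2_class M f" using assms by (auto simp: L2_class_def L2_rel_def)
  then have "rep (L2_class M f) \<in> L2_class M f" unfolding rep_def by (rule someI[of "\<lambda>f. f \<in> L2_class M _"])
  then show "rep (L2_class M f) \<in> L2_funs M" "AE x in M. f x = rep (L2_class M f) x"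
    by (auto simp: L2_class_def L2_rel_def)
qed

lemma L2_class_rep:
  assumes "u \<in> vecs (L2 M)"
  shows "rep u \<in> L2_funs M" "L2_class M (rep u) = u"
proof -
  obtain f where f: "f \<in> L2_funs M" "u = L2_class M f" using assms by (rule L2_class_cases)
  show "rep u \<in> L2_funs M" using rep_L2_class f by blast
  then show "L2_class M (rep u) = u"
    using L2_class_eq_iff[of f M "rep u"] rep_L2_class f by auto
qed

lemma L2_lincomb:
  assumes f: "f \<in> L2_funs M" and g: "g \<in> L2_funs M"
  shows "lincomb (L2 M) a (L2_class M f) b (L2_class M g) = L2_class M (\<lambda>x. a * f x + b * g x)"
proof -
  have "AE x in M. a * rep (L2_class M f) x + b * rep (L2_class M g) x = a * f x + b * g x"
    using rep_L2_class(2)[OF f] rep_L2_class(2)[OF g] by eventually_elim simp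
  then show ?thesis
    using f g rep_L2_class(1)[OF f] rep_L2_class(1)[OF g]
    by (simp add: L2_def) (subst L2_class_eq_iff, auto)
qed

lemma L2_ip:
  assumes f: "f \<in> L2_funs M" and g: "g \<in> L2_funs M"
  shows "ip (L2 M) (L2_class M f) (L2_class M g) = (\<integral>x. f x * cnj (g x) \<partial>M)"
proof -
  have "AE x in M. rep (L2_class M f) x * cnj (rep (L2_class M g) x) = f x * cnj (g x)"
    using rep_L2_class(2)[OF f] rep_L2_class(2)[OF g] by eventually_elim simp
  then show ?thesis
    using L2_funs_measurable[OF f] L2_funs_measurable[OF g]
      L2_funs_measurable[OF rep_L2_class(1)[OF f]] L2_funs_measurable[OF rep_L2_class(1)[OF g]]
    by (simp add: L2_def) (intro integral_cong_AE, auto)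
qed

lemma L2_Re_ip_self:
  assumes f: "f \<in> L2_funs M"
  shows "Re (ip (L2 M) (L2_class M f) (L2_class M f)) = (\<integral>x. (cmod (f x))\<^sup>2 \<partial>M)"
  using f by (simp only: L2_ip complex_norm_square[symmetric] integral_complex_of_real Re_complex_of_real)

lemma L2_hnorm:
  assumes f: "f \<in> L2_funs M"
  shows "hnorm (L2 M) (L2_class M f) = sqrt (\<integral>x. (cmod (f x))\<^sup>2 \<partial>M)"
  using f by (simp only: hnorm_def L2_Re_ip_self)

lemma L2_hdist:
  assumes f: "f \<in> L2_funs M" and g: "g \<in> L2_funs M"
  shows "hdist (L2 M) (L2_class M f) (L2_class M g) = sqrt (\<integral>x. (cmod (f x - g x))\<^sup>2 \<partial>M)"
  using L2_hnorm[OF L2_funs_diff[OF f g]] L2_lincomb[OF f g, of 1 "-1"] by (simp add: hdist_def)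

lemma inner_space_L2: "inner_space (L2 M)"
proof
  show "vecs (L2 M) \<noteq> {}" using L2_class_in[OF L2_funs_zero] by blast
next
  fix u v a b assume "u \<in> vecs (L2 M)" "v \<in> vecs (L2 M)"
  then show "lincomb (L2 M) a u b v \<in> vecs (L2 M)"
    by (elim L2_class_cases) (simp add: L2_lincomb)
next
  fix u v w a b assume "u \<in> vecs (L2 M)" "v \<in> vecs (L2 M)" "w \<in> vecs (L2 M)"
  then obtain f g h where f: "f \<in> L2_funs M" "u = L2_class M f" and g: "g \<in> L2_funs M" "v = L2_class M g"
    and h: "h \<in> L2_funs M" "w = L2_class M h"
    by (metis L2_class_cases)
  have "(\<lambda>x. (a * f x + b * g x) * cnj (h x)) = (\<lambda>x. a * (f x * cnj (h x)) + b * (g x * cnj (h x)))"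
    by (simp add: algebra_simps)
  then show "ip (L2 M) (lincomb (L2 M) a u b v) w = a * ip (L2 M) u w + b * ip (L2 M) v w"
    using f g h by (simp add: L2_lincomb L2_ip L2_funs_mult_integrable)
next
  fix u v assume "u \<in> vecs (L2 M)" "v \<in> vecs (L2 M)"
  then obtain f g where f: "f \<in> L2_funs M" "u = L2_class M f" and g: "g \<in> L2_funs M" "v = L2_class M g"
    by (metis L2_class_cases)
  have "(\<integral>x. g x * cnj (f x) \<partial>M) = (\<integral>x. cnj (f x * cnj (g x)) \<partial>M)"
    by (simp add: mult.commute)
  then show "ip (L2 M) v u = cnj (ip (L2 M) u v)"
    using f g by (simp only: L2_ip Bochner_Integration.integral_cnj[of M "\<lambda>x. f x * cnj (g x)"])
next
  fix u assume "u \<in> vecs (L2 M)"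
  then show "0 \<le> Re (ip (L2 M) u u)"
    by (elim L2_class_cases) (simp only: L2_Re_ip_self, simp)
next
  fix u v assume uv: "u \<in> vecs (L2 M)" "v \<in> vecs (L2 M)" and 0: "hdist (L2 M) u v = 0"
  then obtain f g where f: "f \<in> L2_funs M" "u = L2_class M f" and g: "g \<in> L2_funs M" "v = L2_class M g"
    by (metis L2_class_cases)
  have "(\<integral>x. (cmod (f x - g x))\<^sup>2 \<partial>M) = 0"
    using 0 f g by (simp add: L2_hdist)
  then have "AE x in M. (cmod (f x - g x))\<^sup>2 = 0"
    using L2_funs_integrable[OF L2_funs_diff[OF f(1) g(1)]]
    by (subst (asm) integral_nonneg_eq_0_iff_AE) auto
  then show "u = v"
    using f g by (simp add: L2_class_eq_iff)
qed

interpretation L2: inner_space "L2 M" for M :: "'a measure"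
  by (rule inner_space_L2)

text \<open>Along a subsequence the squared distances of neighbours are at most
  \<open>(1/8)^k\<close>. Weighted with \<open>4^k\<close> they still have the summable bound
  \<open>(1/2)^k\<close>, so almost everywhere the increments are at most a constant times
  \<open>(1/2)^k\<close> and the subsequence converges pointwise. Fatou's lemma then turns the
  pointwise limit into the norm limit of the whole sequence.\<close>

theorem Riesz_Fischer:
  assumes u: "\<And>n. u n \<in> vecs (L2 M)"
    and Cauchy: "\<And>\<epsilon>. \<epsilon> > 0 \<Longrightarrow> \<exists>N. \<forall>m\<ge>N. \<forall>n\<ge>N. hdist (L2 M) (u m) (u n) < \<epsilon>"
  shows "\<exists>v\<in>vecs (L2 M). (\<lambda>n. hdist (L2 M) (u n) v) \<longlonglongrightarrow> 0"
proof -
  define f where "f n = rep (u n)" for n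
  have f[simp]: "f n \<in> L2_funs M" and uf: "u n = L2_class M (f n)" for n
    using L2_class_rep[OF u] by (simp_all add: f_def)
  have [measurable]: "f n \<in> borel_measurable M" for n using f by (rule L2_funs_measurable)
  define D where "D g h = (\<integral>\<^sup>+x. ennreal ((cmod (g x - h x))\<^sup>2) \<partial>M)" for g h :: "'a \<Rightarrow> complex"
  have D: "D (f m) (f n) = ennreal ((hdist (L2 M) (u m) (u n))\<^sup>2)" for m n
    unfolding D_def uf by (subst nn_integral_eq_integral)
      (auto simp: L2_hdist intro!: L2_funs_integrable)
  have "\<exists>N. \<forall>m\<ge>N. \<forall>n\<ge>N. D (f m) (f n) \<le> ennreal \<epsilon>" if "\<epsilon> > 0" for \<epsilon>
  proof -
    have "sqrt \<epsilon> > 0" using that by simp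
    from Cauchy[OF this] obtain N where N: "\<forall>m\<ge>N. \<forall>n\<ge>N. hdist (L2 M) (u m) (u n) < sqrt \<epsilon>"
      by blast
    have "(hdist (L2 M) (u m) (u n))\<^sup>2 \<le> \<epsilon>" if "m \<ge> N" "n \<ge> N" for m n
    proof -
      have "(hdist (L2 M) (u m) (u n))\<^sup>2 \<le> (sqrt \<epsilon>)\<^sup>2"
        using N that u by (intro power_mono less_imp_le[of _ "sqrt \<epsilon>"]) auto
      then show ?thesis using \<open>\<epsilon> > 0\<close> by simp
    qed
    then show ?thesis by (auto simp: D intro!: exI[of _ N] ennreal_leI)
  qed
  then obtain N where N: "\<And>\<epsilon> m n. \<epsilon> > 0 \<Longrightarrow> m \<ge> N \<epsilon> \<Longrightarrow> n \<ge> N \<epsilon> \<Longrightarrow> D (f m) (f n) \<le> ennreal \<epsilon>"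
    by metis
  \<comment> \<open>Adding up all thresholds up to \<open>k\<close> puts both \<open>r k\<close> and
    \<open>r (Suc k)\<close> beyond the threshold for \<open>(1/8)^k\<close>; the summand
    \<open>k\<close> makes \<open>r\<close> unbounded, as the Fatou step requires.\<close>
  define r where "r k = k + (\<Sum>j\<le>k. N ((1/8)^j))" for k :: nat
  have r: "r k \<ge> N ((1/8)^k)" "r (Suc k) \<ge> N ((1/8)^k)" "r k \<ge> k" for k
  proof -
    have "N ((1/8)^k) \<le> (\<Sum>j\<le>k. N ((1/8)^j))" by (intro member_le_sum) auto
    then show "r k \<ge> N ((1/8)^k)" "r (Suc k) \<ge> N ((1/8)^k)" "r k \<ge> k" by (auto simp: r_def)
  qed
  define g where "g k x = cmod (f (r (Suc k)) x - f (r k) x)" for k x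
  have [measurable]: "g k \<in> borel_measurable M" for k unfolding g_def by measurable
  have g_nonneg: "g k x \<ge> 0" for k x by (simp add: g_def)
  have "(\<integral>\<^sup>+x. (\<Sum>k. ennreal (4^k * (g k x)\<^sup>2)) \<partial>M) = (\<Sum>k. \<integral>\<^sup>+x. ennreal (4^k * (g k x)\<^sup>2) \<partial>M)"
    by (rule nn_integral_suminf) measurable
  also have "\<dots> \<le> (\<Sum>k. ennreal ((1/2)^k))"
  proof (intro suminf_le allI)
    fix k
    have "(\<integral>\<^sup>+x. ennreal (4^k * (g k x)\<^sup>2) \<partial>M) = ennreal (4^k) * D (f (r (Suc k))) (f (r k))"
      unfolding D_def g_def by (subst nn_integral_cmult[symmetric]) (auto simp: ennreal_mult)
    also have "\<dots> \<le> ennreal (4^k) * ennreal ((1/8)^k)"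
      by (intro mult_left_mono N) (auto simp: r)
    also have "\<dots> = ennreal ((1/2)^k)"
      by (simp add: ennreal_mult[symmetric] power_mult_distrib[symmetric])
    finally show "(\<integral>\<^sup>+x. ennreal (4^k * (g k x)\<^sup>2) \<partial>M) \<le> ennreal ((1/2)^k)" .
  qed auto
  also have "\<dots> < \<infinity>"
    using summable_geometric[of "1/2::real"]
    by (subst suminf_ennreal2) (auto simp: top.not_eq_extremum)
  finally have "AE x in M. (\<Sum>k. ennreal (4^k * (g k x)\<^sup>2)) \<noteq> \<infinity>"
    by (intro nn_integral_PInf_AE) auto
  then have conv: "AE x in M. (\<lambda>k. f (r k) x) \<longlonglongrightarrow> lim (\<lambda>k. f (r k) x)"
  proof eventually_elim
    case (elim x)
    then have summ: "summable (\<lambda>k. 4^k * (g k x)\<^sup>2)"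
      by (intro summable_suminf_not_top) auto
    define C where "C = (\<Sum>k. 4^k * (g k x)\<^sup>2)"
    have step: "norm (f (r (Suc k)) x - f (r k) x) \<le> sqrt C * (1/2)^k" for k
    proof -
      have "(\<Sum>j\<in>{k}. 4^j * (g j x)\<^sup>2) \<le> C" unfolding C_def by (intro sum_le_suminf summ) auto
      moreover have "(2^k)\<^sup>2 = (4::real)^k"
        by (simp add: power2_eq_square flip: power_mult_distrib)
      ultimately have "(2^k * g k x)\<^sup>2 \<le> C"
        by (simp add: power_mult_distrib)
      then have "2^k * g k x \<le> sqrt C" by (simp add: real_le_rsqrt)
      then show ?thesis by (simp add: g_def field_simps)
    qed
    have "summable (\<lambda>k. sqrt C * (1/2)^k)"
      by (intro summable_mult summable_geometric) simp
    then have "summable (\<lambda>k. f (r (Suc k)) x - f (r k) x)"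
      by (rule summable_comparison_test') (rule step)
    then have "convergent (\<lambda>n. \<Sum>k<n. f (r (Suc k)) x - f (r k) x)"
      by (simp only: summable_iff_convergent)
    then have "convergent (\<lambda>n. (f (r n) x - f (r 0) x) + f (r 0) x)"
      by (intro convergent_add convergent_const) (simp only: sum_lessThan_telescope[of "\<lambda>k. f (r k) x"])
    then show ?case by (simp add: convergent_LIMSEQ_iff)
  qed
  define h where "h x = lim (\<lambda>k. f (r k) x)" for x
  have h[measurable]: "h \<in> borel_measurable M" unfolding h_def by measurable
  have Fatou: "D (f m) h \<le> ennreal \<epsilon>" if "\<epsilon> > 0" "m \<ge> N \<epsilon>" for m \<epsilon>
  proof -
    have "D (f m) h = (\<integral>\<^sup>+x. liminf (\<lambda>k. ennreal ((cmod (f m x - f (r k) x))\<^sup>2)) \<partial>M)"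
      unfolding D_def
    proof (intro nn_integral_cong_AE, use conv in eventually_elim)
      case (elim x)
      then have "(\<lambda>k. ennreal ((cmod (f m x - f (r k) x))\<^sup>2)) \<longlonglongrightarrow> ennreal ((cmod (f m x - h x))\<^sup>2)"
        unfolding h_def by (intro tendsto_intros)
      then show ?case using lim_imp_Liminf by (metis trivial_limit_sequentially)
    qed
    also have "\<dots> \<le> liminf (\<lambda>k. D (f m) (f (r k)))"
      unfolding D_def by (rule nn_integral_liminf) measurable
    also have "\<dots> \<le> ennreal \<epsilon>"
    proof (rule Liminf_le)
      have "D (f m) (f (r k)) \<le> ennreal \<epsilon>" if "k \<ge> N \<epsilon>" for k
        using that \<open>m \<ge> N \<epsilon>\<close> r(3)[of k] \<open>\<epsilon> > 0\<close> by (intro N) auto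
      then show "\<forall>\<^sub>F k in sequentially. D (f m) (f (r k)) \<le> ennreal \<epsilon>"
        by (auto simp: eventually_sequentially)
    qed simp
    finally show ?thesis .
  qed
  have "D (f (N 1)) h < \<infinity>"
    using Fatou[of 1 "N 1"] by (auto intro: le_less_trans[of _ 1])
  then have "integrable M (\<lambda>x. (cmod (f (N 1) x - h x))\<^sup>2)"
    unfolding D_def by (intro integrableI_bounded) auto
  then have "(\<lambda>x. f (N 1) x - h x) \<in> L2_funs M" by (intro L2_funsI) measurable
  then have "(\<lambda>x. f (N 1) x - (f (N 1) x - h x)) \<in> L2_funs M"
    by (rule L2_funs_diff[OF f])
  then have hL[simp]: "h \<in> L2_funs M" by simp
  show ?thesis
  proof (intro bexI[of _ "L2_class M h"] tendstoI)
    fix \<epsilon> :: real assume "\<epsilon> > 0"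
    have "hdist (L2 M) (u m) (L2_class M h) < \<epsilon>" if "m \<ge> N (\<epsilon>\<^sup>2/2)" for m
    proof -
      have "D (f m) h = ennreal ((hdist (L2 M) (u m) (L2_class M h))\<^sup>2)"
        unfolding D_def uf by (subst nn_integral_eq_integral)
          (auto simp: L2_hdist intro!: L2_funs_integrable)
      then have "(hdist (L2 M) (u m) (L2_class M h))\<^sup>2 \<le> \<epsilon>\<^sup>2 / 2"
        using Fatou[of "\<epsilon>\<^sup>2/2" m] that \<open>\<epsilon> > 0\<close> by simp
      also have "\<dots> < \<epsilon>\<^sup>2" using \<open>\<epsilon> > 0\<close> by simp
      finally show ?thesis using \<open>\<epsilon> > 0\<close> by (auto intro: power_less_imp_less_base)
    qed
    then show "\<forall>\<^sub>F m in sequentially. dist (hdist (L2 M) (u m) (L2_class M h)) 0 < \<epsilon>"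
      using u by (auto simp: eventually_sequentially)
  qed simp
qed

text \<open>Density of simple functions, packaged as an induction. As \<open>P\<close> speaks of
  functions and not of classes, the limit case also has to carry it between functions that agree
  almost everywhere.\<close>

lemma L2_induct [consumes 1, case_names indicator lincomb limit]:
  assumes f: "f \<in> L2_funs M"
    and ind: "\<And>A. A \<in> fmeasurable M \<Longrightarrow> P (indicator A)"
    and lin: "\<And>f g a b. f \<in> L2_funs M \<Longrightarrow> g \<in> L2_funs M \<Longrightarrow> P f \<Longrightarrow> P g \<Longrightarrow> P (\<lambda>x. a * f x + b * g x)"
    and lim: "\<And>f s. f \<in> L2_funs M \<Longrightarrow> (\<And>n::nat. s n \<in> L2_funs M) \<Longrightarrow> (\<And>n. P (s n)) \<Longrightarrow>
      (\<lambda>n. hdist (L2 M) (L2_class M (s n)) (L2_class M f)) \<longlonglongrightarrow> 0 \<Longrightarrow> P f"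
  shows "P f"
proof -
  have fM[measurable]: "f \<in> borel_measurable M" using f by simp
  obtain s where "(\<forall>i. simple_function M (s i)) \<and> (\<forall>x\<in>space M. (\<lambda>i. s i x) \<longlonglongrightarrow> f x) \<and>
      (\<forall>i. \<forall>x\<in>space M. dist (s i x) 0 \<le> 2 * dist (f x) 0)"
    using borel_measurable_implies_sequence_metric[OF fM, of 0] by (rule exE)
  then have s: "\<And>i. simple_function M (s i)"
    and conv: "\<And>x. x \<in> space M \<Longrightarrow> (\<lambda>i. s i x) \<longlonglongrightarrow> f x"
    and bound: "\<And>i x. x \<in> space M \<Longrightarrow> dist (s i x) 0 \<le> 2 * dist (f x) 0"
    by blast+
  have sM[measurable]: "s i \<in> borel_measurable M" for i
    using s by (rule borel_measurable_simple_function)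
  have sL: "s i \<in> L2_funs M" for i
  proof (rule L2_funs_bound)
    show "(\<lambda>x. 2 * f x) \<in> L2_funs M" using f by simp
    show "AE x in M. cmod (s i x) \<le> cmod (2 * f x)"
      using bound by (auto intro!: AE_I2 simp: norm_mult)
  qed measurable
  have "P (s i)" for i
  proof -
    define Y where "Y = s i ` space M - {0}"
    have fin: "finite Y" using s simple_functionD(1) by (auto simp: Y_def)
    define A where "A y = s i -` {y} \<inter> space M" for y
    \<comment> \<open>Markov's inequality: a nonzero value is taken on a set of finite measure. This
      is why \<open>0\<close> was removed from \<open>Y\<close>.\<close>
    have A: "A y \<in> fmeasurable M" if "y \<in> Y" for y
    proof (rule fmeasurableI)
      show Ay: "A y \<in> sets M" unfolding A_def using s by (intro simple_functionD)
      have "y \<noteq> 0" using that by (auto simp: Y_def)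
      have "ennreal ((cmod y)\<^sup>2) * emeasure M (A y) = (\<integral>\<^sup>+x. ennreal ((cmod y)\<^sup>2) * indicator (A y) x \<partial>M)"
        using Ay by (simp add: nn_integral_cmult_indicator)
      also have "\<dots> \<le> (\<integral>\<^sup>+x. ennreal ((cmod (s i x))\<^sup>2) \<partial>M)"
        by (intro nn_integral_mono) (auto simp: A_def indicator_def)
      also have "\<dots> < \<infinity>"
        using L2_funs_integrable[OF sL] by (auto simp: integrable_iff_bounded)
      finally show "emeasure M (A y) < \<infinity>"
        using \<open>y \<noteq> 0\<close> by (auto simp: ennreal_mult_less_top)
    qed
    have key: "(\<lambda>x. \<Sum>y\<in>Z. y * indicator (A y) x) \<in> L2_funs M \<and> P (\<lambda>x. \<Sum>y\<in>Z. y * indicator (A y) x)"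
      if "Z \<subseteq> Y" for Z
      using finite_subset[OF that fin] that
    proof (induction Z rule: finite_induct)
      case empty
      have "P (\<lambda>x. 0 * indicator {} x + 0 * indicator {} x)"
        by (intro lin L2_funs_indicator ind) auto
      then show ?case by simp
    next
      case (insert y Z)
      then have "P (\<lambda>x. y * indicator (A y) x + 1 * (\<Sum>y\<in>Z. y * indicator (A y) x))"
        by (intro lin L2_funs_indicator ind A) auto
      moreover have "(\<lambda>x. y * indicator (A y) x + 1 * (\<Sum>y\<in>Z. y * indicator (A y) x)) \<in> L2_funs M"
        using insert by (intro L2_funs_lincomb L2_funs_indicator A) auto
      moreover have "(\<lambda>x. \<Sum>y\<in>insert y Z. y * indicator (A y) x) =
          (\<lambda>x. y * indicator (A y) x + 1 * (\<Sum>y\<in>Z. y * indicator (A y) x))"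
        using insert.hyps by (simp only: sum.insert mult_1_left not_False_eq_True)
      ultimately show ?case by (simp only: conj_absorb)
    qed
    have eq: "s i x = (\<Sum>y\<in>Y. y * indicator (A y) x)" if "x \<in> space M" for x
    proof -
      have "(\<Sum>y\<in>Y. y * indicator (A y) x) = (\<Sum>y\<in>Y. if y = s i x then y else 0)"
        using that by (intro sum.cong) (auto simp: A_def)
      then show ?thesis
        using fin that by (auto simp: sum.delta Y_def)
    qed
    show ?thesis
    \<comment> \<open>The sum over the level sets equals \<open>s i\<close> only on
      \<open>space M\<close>; a constant sequence transfers \<open>P\<close> from the sum to
      \<open>s i\<close>.\<close>
    proof (rule lim[where s = "\<lambda>n x. \<Sum>y\<in>Y. y * indicator (A y) x"])
      have "L2_class M (\<lambda>x. \<Sum>y\<in>Y. y * indicator (A y) x) = L2_class M (s i)"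
        using key[OF subset_refl] sL eq by (subst L2_class_eq_iff) (auto intro!: AE_I2)
      then show "(\<lambda>n. hdist (L2 M) (L2_class M (\<lambda>x. \<Sum>y\<in>Y. y * indicator (A y) x)) (L2_class M (s i))) \<longlonglongrightarrow> 0"
        using sL by simp
    qed (use key[OF subset_refl] sL in auto)
  qed
  moreover have "(\<lambda>n. hdist (L2 M) (L2_class M (s n)) (L2_class M f)) \<longlonglongrightarrow> 0"
  proof -
    have "(\<lambda>n. \<integral>x. (cmod (s n x - f x))\<^sup>2 \<partial>M) \<longlonglongrightarrow> (\<integral>x. 0 \<partial>M)"
    \<comment> \<open>The factor is the square of \<open>3\<close>: the approximants are bounded by
      \<open>2 * cmod (f x)\<close>, so their difference from \<open>f x\<close> is at most three
      times \<open>cmod (f x)\<close>.\<close>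
    proof (rule integral_dominated_convergence[where w = "\<lambda>x. 9 * (cmod (f x))\<^sup>2"])
      show "integrable M (\<lambda>x. 9 * (cmod (f x))\<^sup>2)" using L2_funs_integrable[OF f] by simp
      show "AE x in M. (\<lambda>n. (cmod (s n x - f x))\<^sup>2) \<longlonglongrightarrow> 0"
      proof (rule AE_I2)
        fix x assume "x \<in> space M"
        have "(\<lambda>n. (cmod (s n x - f x))\<^sup>2) \<longlonglongrightarrow> (cmod (f x - f x))\<^sup>2"
          by (intro tendsto_intros conv) fact
        then show "(\<lambda>n. (cmod (s n x - f x))\<^sup>2) \<longlonglongrightarrow> 0" by simp
      qed
      fix n
      show "AE x in M. norm ((cmod (s n x - f x))\<^sup>2) \<le> 9 * (cmod (f x))\<^sup>2"
      proof (rule AE_I2)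
        fix x assume "x \<in> space M"
        have "cmod (s n x - f x) \<le> 3 * cmod (f x)"
          using bound[OF \<open>x \<in> space M\<close>, of n] norm_triangle_ineq4[of "s n x" "f x"] by simp
        then have "(cmod (s n x - f x))\<^sup>2 \<le> (3 * cmod (f x))\<^sup>2" by (intro power_mono) auto
        then show "norm ((cmod (s n x - f x))\<^sup>2) \<le> 9 * (cmod (f x))\<^sup>2"
          by (simp add: power_mult_distrib)
      qed
    qed measurable
    then have "(\<lambda>n. sqrt (\<integral>x. (cmod (s n x - f x))\<^sup>2 \<partial>M)) \<longlonglongrightarrow> sqrt 0"
      by (intro tendsto_intros) simp
    then show ?thesis using sL f by (simp add: L2_hdist)
  qed
  ultimately show ?thesis using f sL by (intro lim[of f s])
qed

section \<open>Half-densities and the universal space\<close>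

text \<open>A one-measure version of \<open>dominates\<close> with sigma-finiteness on both sides
  built in, so that dominations compose into chains.\<close>

definition sf_dominates :: "'a measure \<Rightarrow> 'a measure \<Rightarrow> bool" where
  "sf_dominates \<kappa> \<mu> \<longleftrightarrow> sigma_finite_measure \<kappa> \<and> sigma_finite_measure \<mu> \<and> sets \<mu> = sets \<kappa> \<and>
    absolutely_continuous \<kappa> \<mu>"

lemma sf_dominatesD:
  assumes "sf_dominates \<kappa> \<mu>"
  shows "sigma_finite_measure \<kappa>" "sigma_finite_measure \<mu>" "sets \<mu> = sets \<kappa>"
    "space \<mu> = space \<kappa>" "absolutely_continuous \<kappa> \<mu>"
  using assms sets_eq_imp_space_eq[of \<mu> \<kappa>] by (auto simp: sf_dominates_def)

lemma sf_dominates_refl: "sigma_finite_measure \<mu> \<Longrightarrow> sf_dominates \<mu> \<mu>"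
  by (simp add: sf_dominates_def absolutely_continuous_def)

lemma sf_dominates_trans:
  "sf_dominates \<kappa> \<nu> \<Longrightarrow> sf_dominates \<nu> \<mu> \<Longrightarrow> sf_dominates \<kappa> \<mu>"
  by (auto simp: sf_dominates_def absolutely_continuous_def)

text \<open>The sum of the two measures works: its null sets are the common null sets, and it is
  finite on the intersections of members of the two countable covers.\<close>

lemma sf_dominates_pair:
  assumes \<mu>: "sigma_finite_measure \<mu>" and \<nu>: "sigma_finite_measure \<nu>" and eq: "sets \<nu> = sets \<mu>"
  shows "\<exists>\<kappa>. sf_dominates \<kappa> \<mu> \<and> sf_dominates \<kappa> \<nu>"
proof -
  define \<kappa> where "\<kappa> = measure_of (space \<mu>) (sets \<mu>) (\<lambda>A. emeasure \<mu> A + emeasure \<nu> A)"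
  have sets[simp]: "sets \<kappa> = sets \<mu>" and space[simp]: "space \<kappa> = space \<mu>"
    by (simp_all add: \<kappa>_def)
  have em: "emeasure \<kappa> A = emeasure \<mu> A + emeasure \<nu> A" if "A \<in> sets \<mu>" for A
    unfolding \<kappa>_def
  proof (rule emeasure_measure_of_sigma)
    show "countably_additive (sets \<mu>) (\<lambda>A. emeasure \<mu> A + emeasure \<nu> A)"
    proof (rule countably_additiveI)
      fix A :: "nat \<Rightarrow> _" assume A: "range A \<subseteq> sets \<mu>" "disjoint_family A" "\<Union> (range A) \<in> sets \<mu>"
      have "(\<Sum>i. emeasure \<mu> (A i) + emeasure \<nu> (A i)) = (\<Sum>i. emeasure \<mu> (A i)) + (\<Sum>i. emeasure \<nu> (A i))"
        by (intro suminf_add[symmetric] summableI)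
      also have "\<dots> = emeasure \<mu> (\<Union> (range A)) + emeasure \<nu> (\<Union> (range A))"
        using A eq by (simp add: suminf_emeasure)
      finally show "(\<Sum>i. emeasure \<mu> (A i) + emeasure \<nu> (A i)) = emeasure \<mu> (\<Union> (range A)) + emeasure \<nu> (\<Union> (range A))" .
    qed
  qed (use that in \<open>auto simp: positive_def sets.sigma_algebra_axioms\<close>)
  have "sigma_finite_measure \<kappa>"
  proof
    interpret \<mu>: sigma_finite_measure \<mu> by fact
    interpret \<nu>: sigma_finite_measure \<nu> by fact
    obtain A where A: "countable A" "A \<subseteq> sets \<mu>" "\<Union>A = space \<mu>" "\<forall>a\<in>A. emeasure \<mu> a \<noteq> \<infinity>"
      using \<mu>.sigma_finite_countable by blast
    obtain B where B: "countable B" "B \<subseteq> sets \<nu>" "\<Union>B = space \<nu>" "\<forall>a\<in>B. emeasure \<nu> a \<noteq> \<infinity>"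
      using \<nu>.sigma_finite_countable by blast
    have sp: "space \<nu> = space \<mu>" using eq by (rule sets_eq_imp_space_eq)
    have "emeasure \<kappa> (a \<inter> b) \<noteq> \<infinity>" if ab: "a \<in> A" "b \<in> B" for a b
    proof -
      have s: "a \<in> sets \<mu>" "b \<in> sets \<mu>" "a \<in> sets \<nu>" "b \<in> sets \<nu>" using ab A B eq by auto
      have "emeasure \<mu> (a \<inter> b) \<le> emeasure \<mu> a" "emeasure \<nu> (a \<inter> b) \<le> emeasure \<nu> b"
        using s by (auto intro!: emeasure_mono)
      then show ?thesis
        using ab A(4) B(4) s by (auto simp: em top_unique)
    qed
    moreover have "\<Union> ((\<lambda>(a, b). a \<inter> b) ` (A \<times> B)) = \<Union>A \<inter> \<Union>B" by auto
    moreover have "(\<lambda>(a, b). a \<inter> b) ` (A \<times> B) \<subseteq> sets \<kappa>"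
      using A(2) B(2) eq by auto
    ultimately show "\<exists>A. countable A \<and> A \<subseteq> sets \<kappa> \<and> \<Union> A = space \<kappa> \<and> (\<forall>a\<in>A. emeasure \<kappa> a \<noteq> \<infinity>)"
      using A(1,3) B(1,3) sp
      by (intro exI[of _ "(\<lambda>(a, b). a \<inter> b) ` (A \<times> B)"] conjI) auto
  qed
  moreover have "absolutely_continuous \<kappa> \<mu>" "absolutely_continuous \<kappa> \<nu>"
    using eq by (auto simp: absolutely_continuous_def null_sets_def em)
  ultimately show ?thesis using \<mu> \<nu> eq by (auto simp: sf_dominates_def)
qed

lemma sf_dominates_finite:
  assumes "finite S" "\<And>\<mu>. \<mu> \<in> S \<Longrightarrow> sigma_finite_measure \<mu> \<and> sets \<mu> = sets \<mu>\<^sub>0" "\<mu>\<^sub>0 \<in> S"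
  shows "\<exists>\<kappa>. \<forall>\<mu>\<in>S. sf_dominates \<kappa> \<mu>"
proof -
  \<comment> \<open>Carrying \<open>\<mu>\<^sub>0\<close> along fixes the sigma-algebra of the
    dominating measure even when \<open>T\<close> is empty.\<close>
  have "\<exists>\<kappa>. sf_dominates \<kappa> \<mu>\<^sub>0 \<and> (\<forall>\<mu>\<in>T. sf_dominates \<kappa> \<mu>)" if "T \<subseteq> S" for T
    using finite_subset[OF that assms(1)] that
  proof (induction T rule: finite_induct)
    case empty
    then show ?case using assms(2,3) sf_dominates_refl by blast
  next
    case (insert \<mu> T)
    then obtain \<kappa> where \<kappa>: "sf_dominates \<kappa> \<mu>\<^sub>0" "\<forall>\<mu>\<in>T. sf_dominates \<kappa> \<mu>" by blast
    have "sigma_finite_measure \<mu>" "sets \<mu> = sets \<kappa>"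
      using assms(2)[of \<mu>] insert.prems sf_dominatesD(3)[OF \<kappa>(1)] by auto
    then obtain \<theta> where "sf_dominates \<theta> \<kappa>" "sf_dominates \<theta> \<mu>"
      using sf_dominates_pair[of \<kappa> \<mu>] sf_dominatesD(1)[OF \<kappa>(1)] by blast
    then show ?case using \<kappa> sf_dominates_trans by blast
  qed
  then show ?thesis by blast
qed

section \<open>Square roots of Radon-Nikodym derivatives and half-densities\<close>

lemma sqrt_deriv_measurable [measurable]: "sqrt_deriv \<nu> \<mu> \<in> borel_measurable \<nu>"
  unfolding sqrt_deriv_def by measurable

lemma cnj_sqrt_deriv [simp]: "cnj (sqrt_deriv \<nu> \<mu> x) = sqrt_deriv \<nu> \<mu> x"
  by (simp add: sqrt_deriv_def)

lemma sqrt_deriv_sq: "sqrt_deriv \<nu> \<mu> x * sqrt_deriv \<nu> \<mu> x = of_real ((cmod (sqrt_deriv \<nu> \<mu> x))\<^sup>2)"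
  using complex_norm_square[of "sqrt_deriv \<nu> \<mu> x"] by simp

text \<open>Radon-Nikodym. The passage through \<open>enn2real\<close> loses nothing, because
  sigma-finiteness of \<mu> makes the derivative finite almost everywhere.\<close>

lemma density_sqrt_deriv:
  assumes "sf_dominates \<nu> \<mu>"
  shows "density \<nu> (\<lambda>x. ennreal ((cmod (sqrt_deriv \<nu> \<mu> x))\<^sup>2)) = \<mu>"
proof -
  note d = sf_dominatesD[OF assms]
  interpret sigma_finite_measure \<nu> by fact
  have "AE x in \<nu>. ennreal ((cmod (sqrt_deriv \<nu> \<mu> x))\<^sup>2) = RN_deriv \<nu> \<mu> x"
    using RN_deriv_finite[OF d(2) d(5) d(3)]
    by eventually_elim (simp add: sqrt_deriv_def less_top)
  then have "density \<nu> (\<lambda>x. ennreal ((cmod (sqrt_deriv \<nu> \<mu> x))\<^sup>2)) = density \<nu> (RN_deriv \<nu> \<mu>)"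
    by (intro density_cong) auto
  then show ?thesis using density_RN_deriv[OF d(5) d(3)] by simp
qed

lemma AE_sqrt_deriv_iff:
  assumes "sf_dominates \<nu> \<mu>"
  shows "(AE x in \<mu>. P x) \<longleftrightarrow> (AE x in \<nu>. sqrt_deriv \<nu> \<mu> x \<noteq> 0 \<longrightarrow> P x)"
  by (subst density_sqrt_deriv[OF assms, symmetric], subst AE_density) (auto simp: zero_less_power2)

lemma integral_sqrt_deriv:
  fixes h :: "'a \<Rightarrow> 'b::{banach, second_countable_topology}"
  assumes d: "sf_dominates \<nu> \<mu>" and h: "h \<in> borel_measurable \<mu>"
  shows "(\<integral>x. h x \<partial>\<mu>) = (\<integral>x. (cmod (sqrt_deriv \<nu> \<mu> x))\<^sup>2 *\<^sub>R h x \<partial>\<nu>)"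
    and "integrable \<mu> h \<longleftrightarrow> integrable \<nu> (\<lambda>x. (cmod (sqrt_deriv \<nu> \<mu> x))\<^sup>2 *\<^sub>R h x)"
proof -
  have [measurable]: "h \<in> borel_measurable \<nu>"
    using h sf_dominatesD(3)[OF d] measurable_cong_sets by blast
  show "(\<integral>x. h x \<partial>\<mu>) = (\<integral>x. (cmod (sqrt_deriv \<nu> \<mu> x))\<^sup>2 *\<^sub>R h x \<partial>\<nu>)"
    by (subst density_sqrt_deriv[OF d, symmetric], subst integral_density) auto
  show "integrable \<mu> h \<longleftrightarrow> integrable \<nu> (\<lambda>x. (cmod (sqrt_deriv \<nu> \<mu> x))\<^sup>2 *\<^sub>R h x)"
    by (subst density_sqrt_deriv[OF d, symmetric], subst integrable_density) auto
qed

lemma sqrt_deriv_self: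
  assumes "sigma_finite_measure \<nu>"
  shows "AE x in \<nu>. sqrt_deriv \<nu> \<nu> x = 1"
proof -
  interpret sigma_finite_measure \<nu> by fact
  have "AE x in \<nu>. 1 = RN_deriv \<nu> \<nu> x"
    by (rule RN_deriv_unique) (auto simp: density_1)
  then show ?thesis
  proof eventually_elim
    case (elim x)
    show ?case unfolding sqrt_deriv_def elim[symmetric] by simp
  qed
qed

lemma sqrt_deriv_chain:
  assumes \<kappa>: "sf_dominates \<kappa> \<nu>" and \<nu>: "sf_dominates \<nu> \<mu>"
  shows "AE x in \<kappa>. sqrt_deriv \<kappa> \<mu> x = sqrt_deriv \<nu> \<mu> x * sqrt_deriv \<kappa> \<nu> x"
proof -
  note dk = sf_dominatesD[OF \<kappa>] and dn = sf_dominatesD[OF \<nu>]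
  interpret \<kappa>: sigma_finite_measure \<kappa> by fact
  interpret \<nu>: sigma_finite_measure \<nu> by fact
  have [measurable]: "RN_deriv \<nu> \<mu> \<in> borel_measurable \<kappa>"
    using borel_measurable_RN_deriv[of \<nu> \<mu>] measurable_cong_sets[OF dk(3) refl] by blast
  have "density \<kappa> (\<lambda>x. RN_deriv \<kappa> \<nu> x * RN_deriv \<nu> \<mu> x) = density (density \<kappa> (RN_deriv \<kappa> \<nu>)) (RN_deriv \<nu> \<mu>)"
    by (simp add: density_density_eq)
  also have "\<dots> = \<mu>"
    by (simp add: \<kappa>.density_RN_deriv \<nu>.density_RN_deriv dk dn)
  finally have "AE x in \<kappa>. RN_deriv \<kappa> \<nu> x * RN_deriv \<nu> \<mu> x = RN_deriv \<kappa> \<mu> x"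
    by (intro \<kappa>.RN_deriv_unique) auto
  then show ?thesis
  proof eventually_elim
    case (elim x)
    show ?case
      unfolding sqrt_deriv_def elim[symmetric] by (simp add: enn2real_mult real_sqrt_mult)
  qed
qed

text \<open>The coordinate of the class \<open>f sqrt mu\<close> in \<open>L2 nu\<close>: for
  dominating \<nu> this is an isometry of \<open>L2 mu\<close> into \<open>L2 nu\<close>, in which
  the operations of the universal space become pointwise ones.\<close>

definition half_density :: "'a measure \<Rightarrow> ('a \<Rightarrow> complex) \<Rightarrow> 'a measure \<Rightarrow> 'a \<Rightarrow> complex" where
  "half_density \<nu> f \<mu> x = f x * sqrt_deriv \<nu> \<mu> x"

lemma measurable_dominates:
  "sf_dominates \<nu> \<mu> \<Longrightarrow> f \<in> borel_measurable \<mu> \<longleftrightarrow> f \<in> borel_measurable \<nu>"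
  using sf_dominatesD(3)[of \<nu> \<mu>] measurable_cong_sets by blast

lemma half_density_L2:
  assumes d: "sf_dominates \<nu> \<mu>" and f: "f \<in> L2_funs \<mu>"
  shows "half_density \<nu> f \<mu> \<in> L2_funs \<nu>"
proof (rule L2_funsI)
  have [measurable]: "f \<in> borel_measurable \<nu>" using measurable_dominates[OF d] L2_funs_measurable[OF f] by blast
  show "half_density \<nu> f \<mu> \<in> borel_measurable \<nu>" unfolding half_density_def by measurable
  have "integrable \<nu> (\<lambda>x. (cmod (sqrt_deriv \<nu> \<mu> x))\<^sup>2 *\<^sub>R (cmod (f x))\<^sup>2)"
    using L2_funs_integrable[OF f] integral_sqrt_deriv(2)[OF d, of "\<lambda>x. (cmod (f x))\<^sup>2"] f by simp
  then show "integrable \<nu> (\<lambda>x. (cmod (half_density \<nu> f \<mu> x))\<^sup>2)"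
    by (simp add: half_density_def norm_mult power_mult_distrib mult.commute)
qed

lemma half_density_ip:
  assumes d: "sf_dominates \<nu> \<mu>" and f: "f \<in> L2_funs \<mu>" and g: "g \<in> L2_funs \<mu>"
  shows "(\<integral>x. half_density \<nu> f \<mu> x * cnj (half_density \<nu> g \<mu> x) \<partial>\<nu>) = (\<integral>x. f x * cnj (g x) \<partial>\<mu>)"
proof -
  have "half_density \<nu> f \<mu> x * cnj (half_density \<nu> g \<mu> x) =
      (cmod (sqrt_deriv \<nu> \<mu> x))\<^sup>2 *\<^sub>R (f x * cnj (g x))" for x
    using sqrt_deriv_sq[of \<nu> \<mu> x]
    by (simp add: half_density_def scaleR_conv_of_real algebra_simps del: of_real_power)
  moreover have "(\<lambda>x. f x * cnj (g x)) \<in> borel_measurable \<mu>"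
    using L2_funs_mult_integrable[OF f g] by (rule borel_measurable_integrable)
  ultimately show ?thesis by (simp add: integral_sqrt_deriv(1)[OF d])
qed

lemma half_density_chain:
  assumes \<kappa>: "sf_dominates \<kappa> \<nu>" and \<nu>: "sf_dominates \<nu> \<mu>"
  shows "AE x in \<kappa>. half_density \<kappa> (half_density \<nu> f \<mu>) \<nu> x = half_density \<kappa> f \<mu> x"
  using sqrt_deriv_chain[OF assms] by eventually_elim (simp add: half_density_def)

lemma half_density_self:
  assumes "sigma_finite_measure \<nu>"
  shows "AE x in \<nu>. half_density \<nu> f \<nu> x = f x"
  using sqrt_deriv_self[OF assms] by eventually_elim (simp add: half_density_def)

lemma half_density_cong_iff:
  assumes d: "sf_dominates \<kappa> \<nu>"
  shows "(AE x in \<nu>. f x = g x) \<longleftrightarrow> (AE x in \<kappa>. half_density \<kappa> f \<nu> x = half_density \<kappa> g \<nu> x)"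
  unfolding AE_sqrt_deriv_iff[OF d] half_density_def by (intro AE_cong) auto

text \<open>Both \<kappa> and \<nu> are compared with a measure \<theta> dominating them. Equality
  almost everywhere passes from either one to \<theta> and back, and the chain rule identifies the
  half-density taken in two stages with the direct one.\<close>

lemma half_density_eq_independent:
  assumes \<kappa>: "sf_dominates \<kappa> \<mu>" "sf_dominates \<kappa> \<rho>" and \<nu>: "sf_dominates \<nu> \<mu>" "sf_dominates \<nu> \<rho>"
  shows "(AE x in \<kappa>. half_density \<kappa> f \<mu> x = half_density \<kappa> g \<rho> x) \<longleftrightarrow>
    (AE x in \<nu>. half_density \<nu> f \<mu> x = half_density \<nu> g \<rho> x)"
proof -
  have "sets \<nu> = sets \<kappa>" using sf_dominatesD(3)[OF \<kappa>(1)] sf_dominatesD(3)[OF \<nu>(1)] by simp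
  then obtain \<theta> where l: "sf_dominates \<theta> \<kappa>" "sf_dominates \<theta> \<nu>"
    using sf_dominates_pair[of \<kappa> \<nu>] sf_dominatesD(1)[OF \<kappa>(1)] sf_dominatesD(1)[OF \<nu>(1)] by auto
  have "(AE x in \<tau>. half_density \<tau> f \<mu> x = half_density \<tau> g \<rho> x) \<longleftrightarrow>
      (AE x in \<theta>. half_density \<theta> f \<mu> x = half_density \<theta> g \<rho> x)"
    if t: "sf_dominates \<tau> \<mu>" "sf_dominates \<tau> \<rho>" "sf_dominates \<theta> \<tau>" for \<tau>
    unfolding half_density_cong_iff[OF t(3)]
  proof
    assume "AE x in \<theta>. half_density \<theta> (half_density \<tau> f \<mu>) \<tau> x = half_density \<theta> (half_density \<tau> g \<rho>) \<tau> x"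
    with half_density_chain[OF t(3,1), of f] half_density_chain[OF t(3,2), of g]
    show "AE x in \<theta>. half_density \<theta> f \<mu> x = half_density \<theta> g \<rho> x"
      by eventually_elim simp
  next
    assume "AE x in \<theta>. half_density \<theta> f \<mu> x = half_density \<theta> g \<rho> x"
    with half_density_chain[OF t(3,1), of f] half_density_chain[OF t(3,2), of g]
    show "AE x in \<theta>. half_density \<theta> (half_density \<tau> f \<mu>) \<tau> x = half_density \<theta> (half_density \<tau> g \<rho>) \<tau> x"
      by eventually_elim simp
  qed
  then show ?thesis using \<kappa> \<nu> l by metis
qed

section \<open>The equivalence relation and the operations of the universal space\<close>

lemma uni_pairs_iff:
  "(f, \<mu>) \<in> uni_pairs X F \<longleftrightarrow> sigma_finite_on X F \<mu> \<and> f \<in> L2_funs \<mu>"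
  by (simp add: uni_pairs_def)

lemma dominates_iff:
  assumes "sigma_finite_on X F \<mu>\<^sub>1" "sigma_finite_on X F \<mu>\<^sub>2"
  shows "dominates X F \<nu> \<mu>\<^sub>1 \<mu>\<^sub>2 \<longleftrightarrow> sf_dominates \<nu> \<mu>\<^sub>1 \<and> sf_dominates \<nu> \<mu>\<^sub>2"
  using assms sets_eq_imp_space_eq[of \<mu>\<^sub>1 \<nu>]
  by (auto simp: dominates_def sf_dominates_def sigma_finite_on_def)

lemma sigma_finite_on_dominating:
  assumes "sigma_finite_on X F \<mu>" "sf_dominates \<nu> \<mu>"
  shows "sigma_finite_on X F \<nu>"
  using assms sf_dominatesD[OF assms(2)] by (simp add: sigma_finite_on_def)

lemma sf_dominates_finite_on:
  assumes "finite S" "\<And>\<mu>. \<mu> \<in> S \<Longrightarrow> sigma_finite_on X F \<mu>" "S \<noteq> {}"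
  shows "\<exists>\<kappa>. \<forall>\<mu>\<in>S. sf_dominates \<kappa> \<mu>"
proof -
  from \<open>S \<noteq> {}\<close> obtain \<mu>\<^sub>0 where "\<mu>\<^sub>0 \<in> S" by blast
  with assms show ?thesis
    by (intro sf_dominates_finite[of S \<mu>\<^sub>0]) (auto simp: sigma_finite_on_def)
qed

lemma common_dom:
  assumes "sigma_finite_on X F \<mu>\<^sub>1" "sigma_finite_on X F \<mu>\<^sub>2"
  shows "sf_dominates (common_dom X F \<mu>\<^sub>1 \<mu>\<^sub>2) \<mu>\<^sub>1" "sf_dominates (common_dom X F \<mu>\<^sub>1 \<mu>\<^sub>2) \<mu>\<^sub>2"
proof -
  obtain \<kappa> where "\<forall>\<mu>\<in>{\<mu>\<^sub>1, \<mu>\<^sub>2}. sf_dominates \<kappa> \<mu>"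
    using sf_dominates_finite_on[of "{\<mu>\<^sub>1, \<mu>\<^sub>2}" X F] assms by auto
  then have "dominates X F \<kappa> \<mu>\<^sub>1 \<mu>\<^sub>2" using dominates_iff[OF assms] by simp
  then have "dominates X F (common_dom X F \<mu>\<^sub>1 \<mu>\<^sub>2) \<mu>\<^sub>1 \<mu>\<^sub>2" unfolding common_dom_def by (rule someI)
  then show "sf_dominates (common_dom X F \<mu>\<^sub>1 \<mu>\<^sub>2) \<mu>\<^sub>1" "sf_dominates (common_dom X F \<mu>\<^sub>1 \<mu>\<^sub>2) \<mu>\<^sub>2"
    using dominates_iff[OF assms] by auto
qed

text \<open>Independence of the dominating measure lets the existential measure in
  \<open>uni_rel\<close> be replaced by any convenient one; transitivity, for example, follows over
  one measure that dominates all three.\<close>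

lemma uni_rel_iff:
  assumes f: "(f, \<mu>) \<in> uni_pairs X F" and g: "(g, \<rho>) \<in> uni_pairs X F"
    and \<kappa>: "sf_dominates \<kappa> \<mu>" "sf_dominates \<kappa> \<rho>"
  shows "((f, \<mu>), (g, \<rho>)) \<in> uni_rel X F \<longleftrightarrow>
    (AE x in \<kappa>. half_density \<kappa> f \<mu> x = half_density \<kappa> g \<rho> x)"
proof -
  have s: "sigma_finite_on X F \<mu>" "sigma_finite_on X F \<rho>" using f g by (auto simp: uni_pairs_iff)
  have "((f, \<mu>), (g, \<rho>)) \<in> uni_rel X F \<longleftrightarrow> (\<exists>\<nu>. sf_dominates \<nu> \<mu> \<and> sf_dominates \<nu> \<rho> \<and>
      (AE x in \<nu>. half_density \<nu> f \<mu> x = half_density \<nu> g \<rho> x))"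
    using f g by (simp add: uni_rel_def dominates_iff[OF s] half_density_def)
  then show ?thesis using half_density_eq_independent \<kappa> by metis
qed

lemma uni_rel_in: "(p, q) \<in> uni_rel X F \<Longrightarrow> p \<in> uni_pairs X F \<and> q \<in> uni_pairs X F"
  by (auto simp: uni_rel_def)

lemma equiv_uni_rel: "equiv (uni_pairs X F) (uni_rel X F)"
proof (rule equivI)
  show "uni_rel X F \<subseteq> uni_pairs X F \<times> uni_pairs X F" by (auto simp: uni_rel_def)
  show "refl_on (uni_pairs X F) (uni_rel X F)"
  proof (rule refl_onI)
    fix p assume "p \<in> uni_pairs X F"
    moreover obtain f \<mu> where "p = (f, \<mu>)" by force
    ultimately show "(p, p) \<in> uni_rel X F"
      using uni_rel_iff[of f \<mu> X F f \<mu> \<mu>] by (auto simp: uni_pairs_iff sigma_finite_on_def sf_dominates_refl)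
  qed
  show "sym (uni_rel X F)"
  proof (rule symI)
    fix p q assume pq: "(p, q) \<in> uni_rel X F"
    obtain f \<mu> g \<rho> where p: "p = (f, \<mu>)" "q = (g, \<rho>)" by force
    have in_pairs: "(f, \<mu>) \<in> uni_pairs X F" "(g, \<rho>) \<in> uni_pairs X F"
      using uni_rel_in[OF pq] p by auto
    then obtain \<kappa> where k: "sf_dominates \<kappa> \<mu>" "sf_dominates \<kappa> \<rho>"
      using common_dom[of X F \<mu> \<rho>] by (auto simp: uni_pairs_iff)
    show "(q, p) \<in> uni_rel X F"
      using pq unfolding p uni_rel_iff[OF in_pairs k] uni_rel_iff[OF in_pairs(2,1) k(2,1)]
      by eventually_elim simp
  qed
  show "trans (uni_rel X F)"
  proof (rule transI)
    fix p q r assume pq: "(p, q) \<in> uni_rel X F" and qr: "(q, r) \<in> uni_rel X F"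
    obtain f \<mu> g \<rho> h \<tau> where p: "p = (f, \<mu>)" "q = (g, \<rho>)" "r = (h, \<tau>)" by (metis surj_pair)
    have in_pairs: "(f, \<mu>) \<in> uni_pairs X F" "(g, \<rho>) \<in> uni_pairs X F" "(h, \<tau>) \<in> uni_pairs X F"
      using uni_rel_in[OF pq] uni_rel_in[OF qr] p by auto
    obtain \<kappa> where k: "sf_dominates \<kappa> \<mu>" "sf_dominates \<kappa> \<rho>" "sf_dominates \<kappa> \<tau>"
      using sf_dominates_finite_on[of "{\<mu>, \<rho>, \<tau>}" X F] in_pairs by (auto simp: uni_pairs_iff)
    show "(p, r) \<in> uni_rel X F"
      using pq qr
      unfolding p uni_rel_iff[OF in_pairs(1,2) k(1,2)] uni_rel_iff[OF in_pairs(2,3) k(2,3)]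
        uni_rel_iff[OF in_pairs(1,3) k(1,3)]
      by eventually_elim simp
  qed
qed

lemma uni_class_in:
  "(f, \<mu>) \<in> uni_pairs X F \<Longrightarrow> uni_class X F f \<mu> \<in> vecs (universal_space X F)"
  by (simp add: universal_space_def uni_class_def quotientI)

lemma uni_class_eq_iff:
  assumes "(f, \<mu>) \<in> uni_pairs X F" "(g, \<rho>) \<in> uni_pairs X F"
  shows "uni_class X F f \<mu> = uni_class X F g \<rho> \<longleftrightarrow> ((f, \<mu>), (g, \<rho>)) \<in> uni_rel X F"
  unfolding uni_class_def using eq_equiv_class_iff[OF equiv_uni_rel assms] .

lemma rep_uni_class:
  assumes "(f, \<mu>) \<in> uni_pairs X F"
  obtains g \<rho> where "rep (uni_class X F f \<mu>) = (g, \<rho>)" "(g, \<rho>) \<in> uni_pairs X F"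
    "((f, \<mu>), (g, \<rho>)) \<in> uni_rel X F"
proof -
  have "(f, \<mu>) \<in> uni_class X F f \<mu>"
    unfolding uni_class_def using equiv_class_self[OF equiv_uni_rel assms] .
  then have "rep (uni_class X F f \<mu>) \<in> uni_class X F f \<mu>"
    unfolding rep_def by (rule someI[of "\<lambda>p. p \<in> uni_class X F f \<mu>"])
  then have "((f, \<mu>), rep (uni_class X F f \<mu>)) \<in> uni_rel X F" by (simp add: uni_class_def)
  then show thesis
    using that uni_rel_in[of "(f, \<mu>)" _ X F] by (metis surj_pair)
qed

text \<open>Change of representative: finitely many classes can be written over one common measure,
  which reduces general operations to those with equal measures.\<close>

lemma uni_class_dominated:
  assumes f: "(f, \<mu>) \<in> uni_pairs X F" and d: "sf_dominates \<nu> \<mu>"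
  shows "(half_density \<nu> f \<mu>, \<nu>) \<in> uni_pairs X F"
    and "uni_class X F (half_density \<nu> f \<mu>) \<nu> = uni_class X F f \<mu>"
proof -
  show *: "(half_density \<nu> f \<mu>, \<nu>) \<in> uni_pairs X F"
    using f half_density_L2[OF d] sigma_finite_on_dominating[OF _ d] by (auto simp: uni_pairs_iff)
  note r = sf_dominates_refl[OF sf_dominatesD(1)[OF d]]
  show "uni_class X F (half_density \<nu> f \<mu>) \<nu> = uni_class X F f \<mu>"
    unfolding uni_class_eq_iff[OF * f] uni_rel_iff[OF * f r d]
    using half_density_self[OF sf_dominatesD(1)[OF d]] .
qed

text \<open>The definition integrates unknown representatives over the chosen measure \<tau>. Over a
  third measure \<kappa>, which dominates both \<tau> and \<nu>, the chosen and the given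
  half-densities agree almost everywhere; \<open>half_density_ip\<close> moves the integral from
  \<tau> up to \<kappa> and down to \<nu>.\<close>

lemma uni_ip_same:
  assumes f: "(f, \<nu>) \<in> uni_pairs X F" and g: "(g, \<nu>) \<in> uni_pairs X F"
  shows "ip (universal_space X F) (uni_class X F f \<nu>) (uni_class X F g \<nu>) = (\<integral>x. f x * cnj (g x) \<partial>\<nu>)"
proof -
  obtain f' \<mu> where f': "rep (uni_class X F f \<nu>) = (f', \<mu>)" "(f', \<mu>) \<in> uni_pairs X F"
    "((f, \<nu>), (f', \<mu>)) \<in> uni_rel X F" using f by (rule rep_uni_class)
  obtain g' \<rho> where g': "rep (uni_class X F g \<nu>) = (g', \<rho>)" "(g', \<rho>) \<in> uni_pairs X F"
    "((g, \<nu>), (g', \<rho>)) \<in> uni_rel X F" using g by (rule rep_uni_class)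
  define \<tau> where "\<tau> = common_dom X F \<mu> \<rho>"
  have t: "sf_dominates \<tau> \<mu>" "sf_dominates \<tau> \<rho>"
    using common_dom[of X F \<mu> \<rho>] f' g' by (auto simp: \<tau>_def uni_pairs_iff)
  obtain \<kappa> where k: "sf_dominates \<kappa> \<tau>" "sf_dominates \<kappa> \<nu>"
    using sf_dominates_finite_on[of "{\<tau>, \<nu>}" X F] f f'(2) sigma_finite_on_dominating[OF _ t(1)]
    by (auto simp: uni_pairs_iff)
  note km = sf_dominates_trans[OF k(1) t(1)] and kr = sf_dominates_trans[OF k(1) t(2)]
  have L: "f \<in> L2_funs \<nu>" "g \<in> L2_funs \<nu>" "f' \<in> L2_funs \<mu>" "g' \<in> L2_funs \<rho>"
    using f g f' g' by (auto simp: uni_pairs_iff)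
  have T: "half_density \<tau> f' \<mu> \<in> L2_funs \<tau>" "half_density \<tau> g' \<rho> \<in> L2_funs \<tau>"
    using half_density_L2 t L by auto
  have "ip (universal_space X F) (uni_class X F f \<nu>) (uni_class X F g \<nu>) =
      (\<integral>x. half_density \<tau> f' \<mu> x * cnj (half_density \<tau> g' \<rho> x) \<partial>\<tau>)"
    by (simp add: universal_space_def f' g' Let_def \<tau>_def[symmetric] half_density_def mult_ac)
  also have "\<dots> = (\<integral>x. half_density \<kappa> (half_density \<tau> f' \<mu>) \<tau> x * cnj (half_density \<kappa> (half_density \<tau> g' \<rho>) \<tau> x) \<partial>\<kappa>)"
    using half_density_ip[OF k(1) T] by simp
  also have "\<dots> = (\<integral>x. half_density \<kappa> f \<nu> x * cnj (half_density \<kappa> g \<nu> x) \<partial>\<kappa>)"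
  proof (rule integral_cong_AE)
    have "AE x in \<kappa>. half_density \<kappa> f \<nu> x = half_density \<kappa> f' \<mu> x"
      using uni_rel_iff[OF f f'(2) k(2) km] f'(3) by simp
    moreover have "AE x in \<kappa>. half_density \<kappa> g \<nu> x = half_density \<kappa> g' \<rho> x"
      using uni_rel_iff[OF g g'(2) k(2) kr] g'(3) by simp
    ultimately show "AE x in \<kappa>. half_density \<kappa> (half_density \<tau> f' \<mu>) \<tau> x * cnj (half_density \<kappa> (half_density \<tau> g' \<rho>) \<tau> x)
        = half_density \<kappa> f \<nu> x * cnj (half_density \<kappa> g \<nu> x)"
      using half_density_chain[OF k(1) t(1), of f'] half_density_chain[OF k(1) t(2), of g']
      by eventually_elim simp
  qed (use L2_funs_measurable[OF half_density_L2[OF k(1) T(1)]] L2_funs_measurable[OF half_density_L2[OF k(1) T(2)]]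
      L2_funs_measurable[OF half_density_L2[OF k(2) L(1)]] L2_funs_measurable[OF half_density_L2[OF k(2) L(2)]]
      in measurable)
  also have "\<dots> = (\<integral>x. f x * cnj (g x) \<partial>\<nu>)"
    by (rule half_density_ip[OF k(2) L(1,2)])
  finally show ?thesis .
qed

lemma uni_ip:
  assumes f: "(f, \<mu>) \<in> uni_pairs X F" and g: "(g, \<rho>) \<in> uni_pairs X F"
    and d: "sf_dominates \<nu> \<mu>" "sf_dominates \<nu> \<rho>"
  shows "ip (universal_space X F) (uni_class X F f \<mu>) (uni_class X F g \<rho>) =
    (\<integral>x. half_density \<nu> f \<mu> x * cnj (half_density \<nu> g \<rho> x) \<partial>\<nu>)"
  using uni_ip_same[OF uni_class_dominated(1)[OF f d(1)] uni_class_dominated(1)[OF g d(2)]]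
  by (simp add: uni_class_dominated(2)[OF f d(1)] uni_class_dominated(2)[OF g d(2)])

lemma uni_pairs_lincomb:
  "(f, \<nu>) \<in> uni_pairs X F \<Longrightarrow> (g, \<nu>) \<in> uni_pairs X F \<Longrightarrow> (\<lambda>x. a * f x + b * g x, \<nu>) \<in> uni_pairs X F"
  by (simp add: uni_pairs_iff)

lemma uni_lincomb:
  assumes f: "(f, \<nu>) \<in> uni_pairs X F" and g: "(g, \<nu>) \<in> uni_pairs X F"
  shows "lincomb (universal_space X F) a (uni_class X F f \<nu>) b (uni_class X F g \<nu>) =
    uni_class X F (\<lambda>x. a * f x + b * g x) \<nu>"
proof -
  obtain f' \<mu> where f': "rep (uni_class X F f \<nu>) = (f', \<mu>)" "(f', \<mu>) \<in> uni_pairs X F"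
    "((f, \<nu>), (f', \<mu>)) \<in> uni_rel X F" using f by (rule rep_uni_class)
  obtain g' \<rho> where g': "rep (uni_class X F g \<nu>) = (g', \<rho>)" "(g', \<rho>) \<in> uni_pairs X F"
    "((g, \<nu>), (g', \<rho>)) \<in> uni_rel X F" using g by (rule rep_uni_class)
  define \<tau> where "\<tau> = common_dom X F \<mu> \<rho>"
  have t: "sf_dominates \<tau> \<mu>" "sf_dominates \<tau> \<rho>"
    using common_dom[of X F \<mu> \<rho>] f' g' by (auto simp: \<tau>_def uni_pairs_iff)
  obtain \<kappa> where k: "sf_dominates \<kappa> \<tau>" "sf_dominates \<kappa> \<nu>"
    using sf_dominates_finite_on[of "{\<tau>, \<nu>}" X F] f f'(2) sigma_finite_on_dominating[OF _ t(1)]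
    by (auto simp: uni_pairs_iff)
  note km = sf_dominates_trans[OF k(1) t(1)] and kr = sf_dominates_trans[OF k(1) t(2)]
  let ?h = "\<lambda>x. a * half_density \<tau> f' \<mu> x + b * half_density \<tau> g' \<rho> x"
  have h: "(?h, \<tau>) \<in> uni_pairs X F"
    using uni_class_dominated(1)[OF f'(2) t(1)] uni_class_dominated(1)[OF g'(2) t(2)]
    by (rule uni_pairs_lincomb)
  have "lincomb (universal_space X F) a (uni_class X F f \<nu>) b (uni_class X F g \<nu>) = uni_class X F ?h \<tau>"
    by (simp add: universal_space_def f' g' Let_def \<tau>_def[symmetric] half_density_def mult_ac)
  also have "\<dots> = uni_class X F (\<lambda>x. a * f x + b * g x) \<nu>"
    unfolding uni_class_eq_iff[OF h uni_pairs_lincomb[OF f g]] uni_rel_iff[OF h uni_pairs_lincomb[OF f g] k]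
  proof -
    have "AE x in \<kappa>. half_density \<kappa> f \<nu> x = half_density \<kappa> f' \<mu> x"
      using uni_rel_iff[OF f f'(2) k(2) km] f'(3) by simp
    moreover have "AE x in \<kappa>. half_density \<kappa> g \<nu> x = half_density \<kappa> g' \<rho> x"
      using uni_rel_iff[OF g g'(2) k(2) kr] g'(3) by simp
    ultimately show "AE x in \<kappa>. half_density \<kappa> ?h \<tau> x = half_density \<kappa> (\<lambda>x. a * f x + b * g x) \<nu> x"
      using half_density_chain[OF k(1) t(1), of f'] half_density_chain[OF k(1) t(2), of g']
    proof eventually_elim
      case (elim x)
      have "half_density \<kappa> ?h \<tau> x = a * half_density \<kappa> (half_density \<tau> f' \<mu>) \<tau> x + b * half_density \<kappa> (half_density \<tau> g' \<rho>) \<tau> x"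
        by (simp add: half_density_def algebra_simps)
      also have "\<dots> = a * half_density \<kappa> f \<nu> x + b * half_density \<kappa> g \<nu> x"
        by (simp only: elim)
      also have "\<dots> = half_density \<kappa> (\<lambda>x. a * f x + b * g x) \<nu> x"
        by (simp add: half_density_def algebra_simps)
      finally show ?case .
    qed
  qed
  finally show ?thesis .
qed

lemma uni_common_representation:
  assumes "u \<in> vecs (universal_space X F)" "v \<in> vecs (universal_space X F)" "w \<in> vecs (universal_space X F)"
  obtains \<nu> f g h where "(f, \<nu>) \<in> uni_pairs X F" "u = uni_class X F f \<nu>"
    "(g, \<nu>) \<in> uni_pairs X F" "v = uni_class X F g \<nu>" "(h, \<nu>) \<in> uni_pairs X F" "w = uni_class X F h \<nu>"
proof -
  have "\<exists>f \<mu>. (f, \<mu>) \<in> uni_pairs X F \<and> x = uni_class X F f \<mu>" if "x \<in> vecs (universal_space X F)" for x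
    using that by (auto simp: universal_space_def uni_class_def elim!: quotientE)
  then obtain f \<mu> g \<rho> h \<tau> where *: "(f, \<mu>) \<in> uni_pairs X F" "u = uni_class X F f \<mu>"
      "(g, \<rho>) \<in> uni_pairs X F" "v = uni_class X F g \<rho>" "(h, \<tau>) \<in> uni_pairs X F" "w = uni_class X F h \<tau>"
    using assms by metis
  then obtain \<nu> where "sf_dominates \<nu> \<mu>" "sf_dominates \<nu> \<rho>" "sf_dominates \<nu> \<tau>"
    using sf_dominates_finite_on[of "{\<mu>, \<rho>, \<tau>}" X F] by (auto simp: uni_pairs_iff)
  with * show thesis
    using that[of "half_density \<nu> f \<mu>" \<nu> "half_density \<nu> g \<rho>" "half_density \<nu> h \<tau>"] by (simp add: uni_class_dominated)
qed

text \<open>The measure \<mu> witnesses that the carrier is nonempty. The other axioms are checked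
  on representatives over one dominating measure, where they are properties of integrals.\<close>

lemma semi_inner_space_universal:
  assumes "sigma_finite_on X F \<mu>"
  shows "semi_inner_space (universal_space X F)"
proof
  have "uni_class X F (\<lambda>x. 0) \<mu> \<in> vecs (universal_space X F)"
    using assms by (intro uni_class_in) (simp add: uni_pairs_iff)
  then show "vecs (universal_space X F) \<noteq> {}" by blast
next
  fix u v a b assume uv: "u \<in> vecs (universal_space X F)" "v \<in> vecs (universal_space X F)"
  show "lincomb (universal_space X F) a u b v \<in> vecs (universal_space X F)"
    by (rule uni_common_representation[OF uv uv(2)])
      (simp add: uni_lincomb uni_class_in uni_pairs_lincomb)
next
  fix u v w a b
  assume "u \<in> vecs (universal_space X F)" "v \<in> vecs (universal_space X F)" "w \<in> vecs (universal_space X F)"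
  then obtain \<nu> f g h where f: "(f, \<nu>) \<in> uni_pairs X F" "u = uni_class X F f \<nu>"
    and g: "(g, \<nu>) \<in> uni_pairs X F" "v = uni_class X F g \<nu>"
    and h: "(h, \<nu>) \<in> uni_pairs X F" "w = uni_class X F h \<nu>"
    by (rule uni_common_representation)
  have "(\<lambda>x. (a * f x + b * g x) * cnj (h x)) = (\<lambda>x. a * (f x * cnj (h x)) + b * (g x * cnj (h x)))"
    by (simp add: algebra_simps)
  then show "ip (universal_space X F) (lincomb (universal_space X F) a u b v) w =
      a * ip (universal_space X F) u w + b * ip (universal_space X F) v w"
    using f g h by (simp add: uni_lincomb uni_ip_same uni_pairs_lincomb L2_funs_mult_integrable uni_pairs_iff)
next
  fix u v assume uv: "u \<in> vecs (universal_space X F)" "v \<in> vecs (universal_space X F)"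
  obtain \<nu> f g where f: "(f, \<nu>) \<in> uni_pairs X F" "u = uni_class X F f \<nu>"
    and g: "(g, \<nu>) \<in> uni_pairs X F" "v = uni_class X F g \<nu>"
    by (rule uni_common_representation[OF uv uv(2)]) blast
  have "(\<integral>x. g x * cnj (f x) \<partial>\<nu>) = (\<integral>x. cnj (f x * cnj (g x)) \<partial>\<nu>)"
    by (simp add: mult.commute)
  then show "ip (universal_space X F) v u = cnj (ip (universal_space X F) u v)"
    using f g by (simp only: uni_ip_same Bochner_Integration.integral_cnj[of \<nu> "\<lambda>x. f x * cnj (g x)"])
next
  fix u assume u: "u \<in> vecs (universal_space X F)"
  obtain \<nu> f where f: "(f, \<nu>) \<in> uni_pairs X F" "u = uni_class X F f \<nu>"
    by (rule uni_common_representation[OF u u u]) blast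
  then have "f \<in> L2_funs \<nu>" by (simp add: uni_pairs_iff)
  then have "ip (universal_space X F) u u = ip (L2 \<nu>) (L2_class \<nu> f) (L2_class \<nu> f)"
    using f by (simp add: uni_ip_same L2_ip)
  then show "0 \<le> Re (ip (universal_space X F) u u)"
    using L2.ip_nonneg[OF L2_class_in[OF \<open>f \<in> L2_funs \<nu>\<close>]] by (simp only:)
qed

text \<open>Square roots of derivatives are real, so the integrand equals its conjugate. Reality on
  \<open>X\<close> is enough because \<open>X\<close> is the space of the dominating
  measure.\<close>

lemma uni_ip_real:
  assumes f: "(f, \<mu>) \<in> uni_pairs X F" "\<And>x. x \<in> X \<Longrightarrow> f x \<in> \<real>"
    and g: "(g, \<rho>) \<in> uni_pairs X F" "\<And>x. x \<in> X \<Longrightarrow> g x \<in> \<real>"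
  shows "ip (universal_space X F) (uni_class X F f \<mu>) (uni_class X F g \<rho>) \<in> \<real>"
proof -
  define \<nu> where "\<nu> = common_dom X F \<mu> \<rho>"
  have d: "sf_dominates \<nu> \<mu>" "sf_dominates \<nu> \<rho>"
    using common_dom[of X F \<mu> \<rho>] f g by (auto simp: \<nu>_def uni_pairs_iff)
  have "space \<nu> = X"
    using sf_dominatesD(4)[OF d(1)] f(1) by (simp add: uni_pairs_iff sigma_finite_on_def)
  let ?i = "\<integral>x. half_density \<nu> f \<mu> x * cnj (half_density \<nu> g \<rho> x) \<partial>\<nu>"
  have "cnj ?i = (\<integral>x. cnj (half_density \<nu> f \<mu> x * cnj (half_density \<nu> g \<rho> x)) \<partial>\<nu>)"
    by (simp only: Bochner_Integration.integral_cnj)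
  also have "\<dots> = ?i"
  proof (rule Bochner_Integration.integral_cong[OF refl])
    fix x assume "x \<in> space \<nu>"
    then have "cnj (f x) = f x" "cnj (g x) = g x"
      using f(2) g(2) \<open>space \<nu> = X\<close> by (auto simp: Reals_cnj_iff)
    then show "cnj (half_density \<nu> f \<mu> x * cnj (half_density \<nu> g \<rho> x)) = half_density \<nu> f \<mu> x * cnj (half_density \<nu> g \<rho> x)"
      by (simp add: half_density_def)
  qed
  finally show ?thesis
    unfolding uni_ip[OF f(1) g(1) d] by (simp add: Reals_cnj_iff)
qed

section \<open>The isonormal map\<close>

abbreviation std_gauss :: "real measure" where
  "std_gauss \<equiv> density lborel std_normal_density"

lemma prob_space_gauss_space: "prob_space (gauss_space I)"
  unfolding gauss_space_def by (intro prob_space_PiM prob_space_normal_density) simp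

lemma coordinate_measurable:
  "i \<in> I \<Longrightarrow> (\<lambda>\<omega>. \<omega> i) \<in> borel_measurable (gauss_space I)"
proof -
  assume "i \<in> I"
  then have "(\<lambda>\<omega>. \<omega> i) \<in> measurable (gauss_space I) std_gauss"
    unfolding gauss_space_def by measurable
  then show ?thesis by (simp cong: measurable_cong_sets)
qed

lemma coordinate_distr:
  assumes "i \<in> I"
  shows "distr (gauss_space I) borel (\<lambda>\<omega>. \<omega> i) = std_gauss"
proof -
  have "distr (gauss_space I) borel (\<lambda>\<omega>. \<omega> i) = distr (gauss_space I) std_gauss (\<lambda>\<omega>. \<omega> i)"
    by (rule distr_cong) auto
  also have "\<dots> = std_gauss"
    unfolding gauss_space_def
    by (rule distr_PiM_component[of I "\<lambda>_. std_gauss"]) (use assms prob_space_normal_density in auto)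
  finally show ?thesis .
qed

lemma coordinate_moment:
  assumes "i \<in> I"
  shows "integrable (gauss_space I) (\<lambda>\<omega>. (\<omega> i) ^ k)"
    and "(\<integral>\<omega>. (\<omega> i) ^ k \<partial>gauss_space I) = (\<integral>x. std_normal_density x * x ^ k \<partial>lborel)"
proof -
  note [measurable] = coordinate_measurable[OF assms]
  have "integrable std_gauss (\<lambda>x. x ^ k)"
    by (subst integrable_density) (auto intro: integrable_std_normal_moment)
  then have "integrable (distr (gauss_space I) borel (\<lambda>\<omega>. \<omega> i)) (\<lambda>x. x ^ k)"
    by (simp add: coordinate_distr[OF assms])
  then show "integrable (gauss_space I) (\<lambda>\<omega>. (\<omega> i) ^ k)"
    by (subst (asm) integrable_distr_eq) auto
  have "(\<integral>\<omega>. (\<omega> i) ^ k \<partial>gauss_space I) = (\<integral>x. x ^ k \<partial>distr (gauss_space I) borel (\<lambda>\<omega>. \<omega> i))"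
    by (subst integral_distr) auto
  also have "\<dots> = (\<integral>x. std_normal_density x * x ^ k \<partial>lborel)"
    unfolding coordinate_distr[OF assms] by (subst integral_density) auto
  finally show "(\<integral>\<omega>. (\<omega> i) ^ k \<partial>gauss_space I) = (\<integral>x. std_normal_density x * x ^ k \<partial>lborel)" .
qed

text \<open>The joint law of the coordinates is the product measure itself, and its factors are
  their laws.\<close>

lemma coordinates_indep:
  assumes "I \<noteq> {}"
  shows "prob_space.indep_vars (gauss_space I) (\<lambda>_. borel) (\<lambda>i \<omega>. \<omega> i) I"
proof -
  interpret prob_space "gauss_space I" by (rule prob_space_gauss_space)
  have s: "sets (Pi\<^sub>M I (\<lambda>_. borel)) = sets (gauss_space I)"
    unfolding gauss_space_def by (intro sets_PiM_cong) auto
  show ?thesis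
  proof (rule indep_vars_iff_distr_eq_PiM'[THEN iffD2])
    have "distr (gauss_space I) (Pi\<^sub>M I (\<lambda>_. borel)) (\<lambda>\<omega>. \<lambda>i\<in>I. \<omega> i) = distr (gauss_space I) (gauss_space I) (\<lambda>\<omega>. \<omega>)"
    proof (rule distr_cong)
      fix \<omega> assume "\<omega> \<in> space (gauss_space I)"
      then show "(\<lambda>i\<in>I. \<omega> i) = \<omega>" by (auto simp: gauss_space_def space_PiM PiE_restrict)
    qed (use s in auto)
    also have "\<dots> = gauss_space I" by (rule distr_id2) simp
    also have "\<dots> = Pi\<^sub>M I (\<lambda>i. distr (gauss_space I) borel (\<lambda>\<omega>. \<omega> i))"
      unfolding gauss_space_def[of I] by (intro PiM_cong refl) (simp add: coordinate_distr gauss_space_def[symmetric])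
    finally show "distr (gauss_space I) (Pi\<^sub>M I (\<lambda>_. borel)) (\<lambda>\<omega>. \<lambda>i\<in>I. \<omega> i) =
      Pi\<^sub>M I (\<lambda>i. distr (gauss_space I) borel (\<lambda>\<omega>. \<omega> i))" .
  qed (fact assms, rule coordinate_measurable)
qed

lemma coordinate_L2:
  assumes "i \<in> I"
  shows "(\<lambda>\<omega>. complex_of_real (\<omega> i)) \<in> L2_funs (gauss_space I)"
proof (rule L2_funsI)
  note [measurable] = coordinate_measurable[OF assms]
  show "(\<lambda>\<omega>. complex_of_real (\<omega> i)) \<in> borel_measurable (gauss_space I)" by measurable
  show "integrable (gauss_space I) (\<lambda>\<omega>. (cmod (complex_of_real (\<omega> i)))\<^sup>2)"
    using coordinate_moment(1)[OF assms, of 2] by simp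
qed

text \<open>The diagonal case is the second moment of the standard Gaussian; off the diagonal
  independence factors the integral and the means vanish.\<close>

lemma coordinates_orthonormal:
  assumes i: "i \<in> I" and j: "j \<in> I"
  shows "(\<integral>\<omega>. complex_of_real (\<omega> i) * cnj (complex_of_real (\<omega> j)) \<partial>gauss_space I) = (if i = j then 1 else 0)"
proof -
  interpret prob_space "gauss_space I" by (rule prob_space_gauss_space)
  have "(\<integral>\<omega>. \<omega> i * \<omega> j \<partial>gauss_space I) = (if i = j then 1 else 0)"
  proof (cases "i = j")
    case True
    then show ?thesis
      using coordinate_moment(2)[OF i, of 2] integral_std_normal_moment_even[of 1]
      by (simp add: power2_eq_square fact_numeral)
  next
    case False
    have int: "integrable (gauss_space I) (\<lambda>\<omega>. \<omega> l)" if "l \<in> I" for l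
      using coordinate_moment(1)[OF that, of 1] by simp
    have zero: "(\<integral>\<omega>. \<omega> i \<partial>gauss_space I) = 0"
      using coordinate_moment(2)[OF i, of 1] integral_std_normal_moment_odd[of 0] by simp
    have "indep_vars (\<lambda>_. borel) (\<lambda>i \<omega>. \<omega> i) {i, j}"
      using i j by (intro indep_vars_subset[OF coordinates_indep]) auto
    then have "(\<integral>\<omega>. (\<Prod>l\<in>{i, j}. \<omega> l) \<partial>gauss_space I) = (\<Prod>l\<in>{i, j}. \<integral>\<omega>. \<omega> l \<partial>gauss_space I)"
      using int i j by (intro indep_vars_lebesgue_integral) auto
    then show ?thesis using False zero by simp
  qed
  moreover have "(\<integral>\<omega>. complex_of_real (\<omega> i) * cnj (complex_of_real (\<omega> j)) \<partial>gauss_space I)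
      = complex_of_real (\<integral>\<omega>. \<omega> i * \<omega> j \<partial>gauss_space I)"
    by (simp flip: of_real_mult)
  ultimately show ?thesis by simp
qed

section \<open>Finite Gaussian sums and their limits along finite index sets\<close>

definition gauss_sum :: "'i set \<Rightarrow> ('i \<Rightarrow> complex) \<Rightarrow> 'i set \<Rightarrow> (('i \<Rightarrow> real) \<Rightarrow> complex) set" where
  "gauss_sum I c J = L2_class (gauss_space I) (\<lambda>\<omega>. \<Sum>i\<in>J. c i * complex_of_real (\<omega> i))"

lemma gauss_sum_L2:
  "J \<subseteq> I \<Longrightarrow> (\<lambda>\<omega>. \<Sum>i\<in>J. c i * complex_of_real (\<omega> i)) \<in> L2_funs (gauss_space I)"
  by (rule L2_funs_sum) (auto intro: coordinate_L2)

lemma gauss_sum_in: "J \<subseteq> I \<Longrightarrow> gauss_sum I c J \<in> vecs (L2 (gauss_space I))"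
  by (simp add: gauss_sum_def gauss_sum_L2)

lemma gauss_sum_hnorm:
  assumes J: "finite J" "J \<subseteq> I"
  shows "(hnorm (L2 (gauss_space I)) (gauss_sum I c J))\<^sup>2 = (\<Sum>i\<in>J. (cmod (c i))\<^sup>2)"
proof -
  let ?Z = "\<lambda>i \<omega>. complex_of_real (\<omega> i)" and ?P = "gauss_space I"
  have int: "integrable ?P (\<lambda>\<omega>. ?Z i \<omega> * cnj (?Z j \<omega>))" if "i \<in> J" "j \<in> J" for i j
    using that J by (intro L2_funs_mult_integrable coordinate_L2) auto
  have "ip (L2 ?P) (gauss_sum I c J) (gauss_sum I c J)
      = (\<integral>\<omega>. (\<Sum>i\<in>J. c i * ?Z i \<omega>) * cnj (\<Sum>j\<in>J. c j * ?Z j \<omega>) \<partial>?P)"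
    unfolding gauss_sum_def using L2_ip[OF gauss_sum_L2[OF J(2)] gauss_sum_L2[OF J(2)]] .
  also have "\<dots> = (\<integral>\<omega>. (\<Sum>i\<in>J. \<Sum>j\<in>J. (c i * cnj (c j)) * (?Z i \<omega> * cnj (?Z j \<omega>))) \<partial>?P)"
    by (simp add: sum_product mult_ac)
  also have "\<dots> = (\<Sum>i\<in>J. \<Sum>j\<in>J. (c i * cnj (c j)) * (\<integral>\<omega>. ?Z i \<omega> * cnj (?Z j \<omega>) \<partial>?P))"
    using int by (simp add: Bochner_Integration.integral_sum del: complex_cnj_complex_of_real)
  also have "\<dots> = (\<Sum>i\<in>J. \<Sum>j\<in>J. if i = j then c i * cnj (c j) else 0)"
  proof (intro sum.cong refl)
    fix i j assume "i \<in> J" "j \<in> J"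
    then have "(\<integral>\<omega>. ?Z i \<omega> * cnj (?Z j \<omega>) \<partial>?P) = (if i = j then 1 else 0)"
      using J(2) by (intro coordinates_orthonormal) auto
    then show "c i * cnj (c j) * (\<integral>\<omega>. ?Z i \<omega> * cnj (?Z j \<omega>) \<partial>?P) = (if i = j then c i * cnj (c j) else 0)"
      by (cases "i = j") simp_all
  qed
  also have "\<dots> = (\<Sum>i\<in>J. c i * cnj (c i))"
    using J(1) by (simp add: sum.delta)
  also have "\<dots> = of_real (\<Sum>i\<in>J. (cmod (c i))\<^sup>2)"
    by (simp only: complex_norm_square of_real_sum)
  finally show ?thesis
    using L2.Re_ip_self[OF gauss_sum_in[OF J(2)], of c] by (simp only: Re_complex_of_real)
qed

lemma gauss_sum_lincomb:
  assumes "J \<subseteq> I"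
  shows "lincomb (L2 (gauss_space I)) a (gauss_sum I c J) b (gauss_sum I d J)
    = gauss_sum I (\<lambda>i. a * c i + b * d i) J"
  unfolding gauss_sum_def L2_lincomb[OF gauss_sum_L2[OF assms] gauss_sum_L2[OF assms]]
  by (simp add: sum_distrib_left sum.distrib distrib_right mult.assoc)

text \<open>Extending the coefficients by zero from \<open>J\<close> to \<open>K\<close> makes the
  difference a Gaussian sum over \<open>K\<close> whose coefficients vanish on
  \<open>J\<close>.\<close>

lemma gauss_sum_hdist:
  assumes "finite K" "J \<subseteq> K" "K \<subseteq> I"
  shows "(hdist (L2 (gauss_space I)) (gauss_sum I c J) (gauss_sum I c K))\<^sup>2
    = (\<Sum>i\<in>K. (cmod (c i))\<^sup>2) - (\<Sum>i\<in>J. (cmod (c i))\<^sup>2)"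
proof -
  let ?d = "\<lambda>i. if i \<in> J then c i else 0"
  have "gauss_sum I c J = gauss_sum I ?d K"
  proof -
    have "(\<Sum>i\<in>J. c i * complex_of_real (\<omega> i)) = (\<Sum>i\<in>K. ?d i * complex_of_real (\<omega> i))" for \<omega>
      using assms by (intro sum.mono_neutral_cong_left) auto
    then show ?thesis by (simp only: gauss_sum_def)
  qed
  then have "(hdist (L2 (gauss_space I)) (gauss_sum I c J) (gauss_sum I c K))\<^sup>2
      = (\<Sum>i\<in>K. (cmod (?d i - c i))\<^sup>2)"
    using gauss_sum_hnorm[OF assms(1,3), of "\<lambda>i. 1 * ?d i + (-1) * c i"]
    by (simp only: hdist_def gauss_sum_lincomb[OF assms(3)]) simp
  also have "\<dots> = (\<Sum>i\<in>K - J. (cmod (c i))\<^sup>2)"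
    using assms by (intro sum.mono_neutral_cong_right) auto
  also have "\<dots> = (\<Sum>i\<in>K. (cmod (c i))\<^sup>2) - (\<Sum>i\<in>J. (cmod (c i))\<^sup>2)"
    using assms by (intro sum_diff) auto
  finally show ?thesis .
qed

text \<open>Completeness for nets from completeness for sequences: the finite sets belonging to the
  tolerances \<open>1/(n+1)\<close> yield a Cauchy sequence, and its limit is the limit of the net
  because every larger finite set stays close to one of them.\<close>

lemma L2_net_limit:
  assumes S: "\<And>J. J \<subseteq> I \<Longrightarrow> S J \<in> vecs (L2 M)"
    and Cauchy: "\<And>\<epsilon>. \<epsilon> > 0 \<Longrightarrow> \<exists>A. finite A \<and> A \<subseteq> I \<and>
      (\<forall>K. finite K \<and> A \<subseteq> K \<and> K \<subseteq> I \<longrightarrow> hdist (L2 M) (S A) (S K) < \<epsilon>)"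
  shows "\<exists>w\<in>vecs (L2 M). ((\<lambda>J. hdist (L2 M) (S J) w) \<longlongrightarrow> 0) (finite_subsets_at_top I)"
proof -
  have "\<exists>A. finite A \<and> A \<subseteq> I \<and>
      (\<forall>K. finite K \<and> A \<subseteq> K \<and> K \<subseteq> I \<longrightarrow> hdist (L2 M) (S A) (S K) < inverse (of_nat (Suc n)))" for n
    by (rule Cauchy) simp
  then obtain A where A: "\<And>n. finite (A n)" "\<And>n. A n \<subseteq> I"
    "\<And>n K. finite K \<Longrightarrow> A n \<subseteq> K \<Longrightarrow> K \<subseteq> I \<Longrightarrow> hdist (L2 M) (S (A n)) (S K) < inverse (of_nat (Suc n))"
    by metis
  \<comment> \<open>The sets \<open>A n\<close> may fail to be nested. Their unions are, and
    \<open>B n\<close> is an admissible \<open>K\<close> for each \<open>A m\<close> with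
    \<open>m \<le> n\<close>.\<close>
  define B where "B n = (\<Union>m\<le>n. A m)" for n
  have B: "finite (B n)" "B n \<subseteq> I" "A n \<subseteq> B n" for n using A by (auto simp: B_def)
  have AB: "A m \<subseteq> B n" if "m \<le> n" for m n using that by (auto simp: B_def)
  have "\<exists>w\<in>vecs (L2 M). (\<lambda>n. hdist (L2 M) (S (B n)) w) \<longlonglongrightarrow> 0"
  proof (rule Riesz_Fischer)
    fix \<epsilon> :: real assume "\<epsilon> > 0"
    then obtain N where N: "inverse (of_nat (Suc N)) < \<epsilon> / 2"
      using reals_Archimedean[of "\<epsilon> / 2"] by auto
    have "hdist (L2 M) (S (B m)) (S (B n)) < \<epsilon>" if "m \<ge> N" "n \<ge> N" for m n
    proof -
      have "hdist (L2 M) (S (B m)) (S (B n)) \<le> hdist (L2 M) (S (B m)) (S (A N)) + hdist (L2 M) (S (A N)) (S (B n))"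
        using A B by (intro L2.hdist_triangle S)
      also have "hdist (L2 M) (S (B m)) (S (A N)) = hdist (L2 M) (S (A N)) (S (B m))"
        using A B by (intro L2.hdist_commute S)
      finally show ?thesis
        using A(3)[OF B(1) AB[OF that(1)] B(2)] A(3)[OF B(1) AB[OF that(2)] B(2)] N by linarith
    qed
    then show "\<exists>N. \<forall>m\<ge>N. \<forall>n\<ge>N. hdist (L2 M) (S (B m)) (S (B n)) < \<epsilon>" by blast
  qed (use S B in auto)
  then obtain w where w: "w \<in> vecs (L2 M)" and lim: "(\<lambda>n. hdist (L2 M) (S (B n)) w) \<longlonglongrightarrow> 0" by blast
  have "((\<lambda>J. hdist (L2 M) (S J) w) \<longlongrightarrow> 0) (finite_subsets_at_top I)"
  proof (rule tendstoI)
    fix \<epsilon> :: real assume "\<epsilon> > 0"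
    \<comment> \<open>Three distances are added: from \<open>S K\<close> to \<open>S (A N)\<close>,
      on to \<open>S (B n)\<close>, and on to \<open>w\<close>.\<close>
    then obtain N where N: "inverse (of_nat (Suc N)) < \<epsilon> / 3"
      using reals_Archimedean[of "\<epsilon> / 3"] by auto
    have "\<forall>\<^sub>F n in sequentially. dist (hdist (L2 M) (S (B n)) w) 0 < \<epsilon> / 3"
      using lim \<open>\<epsilon> > 0\<close> by (intro tendstoD) auto
    then have "\<forall>\<^sub>F n in sequentially. n \<ge> N \<and> hdist (L2 M) (S (B n)) w < \<epsilon> / 3"
      using eventually_ge_at_top[of N] by eventually_elim auto
    then obtain n where n: "n \<ge> N" "hdist (L2 M) (S (B n)) w < \<epsilon> / 3"
      by (auto simp: eventually_sequentially)
    show "\<forall>\<^sub>F J in finite_subsets_at_top I. dist (hdist (L2 M) (S J) w) 0 < \<epsilon>"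
      unfolding eventually_finite_subsets_at_top
    proof (intro exI[of _ "A N"] conjI allI impI)
      fix K assume K: "finite K \<and> A N \<subseteq> K \<and> K \<subseteq> I"
      have v: "S K \<in> vecs (L2 M)" "S (A N) \<in> vecs (L2 M)" "S (B n) \<in> vecs (L2 M)"
        using S K A B by auto
      have "hdist (L2 M) (S K) w \<le> hdist (L2 M) (S (A N)) (S K) + hdist (L2 M) (S (A N)) w"
        using L2.hdist_triangle[OF v(1,2) w] L2.hdist_commute[OF v(1,2)] by simp
      moreover have "hdist (L2 M) (S (A N)) w \<le> hdist (L2 M) (S (A N)) (S (B n)) + hdist (L2 M) (S (B n)) w"
        using L2.hdist_triangle[OF v(2,3) w] .
      ultimately have "hdist (L2 M) (S K) w < \<epsilon>"
        using A(3)[OF B(1) AB[OF n(1)] B(2)] A(3)[of K N] K N n(2) by linarith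
      then show "dist (hdist (L2 M) (S K) w) 0 < \<epsilon>"
        using L2.hdist_nonneg[OF v(1) w] by simp
    qed (use A in auto)
  qed
  with w show ?thesis by blast
qed

text \<open>The property described in \<open>isonormal\<close>, for arbitrary coefficients, so that
  linearity and norms can be treated at the level of coefficient families.\<close>

definition gauss_limit :: "'i set \<Rightarrow> ('i \<Rightarrow> complex) \<Rightarrow> (('i \<Rightarrow> real) \<Rightarrow> complex) set \<Rightarrow> bool" where
  "gauss_limit I c w \<longleftrightarrow> w \<in> vecs (L2 (gauss_space I)) \<and>
    ((\<lambda>J. hdist (L2 (gauss_space I)) (gauss_sum I c J) w) \<longlongrightarrow> 0) (finite_subsets_at_top I)"

lemma gauss_limit_exists:
  assumes "((\<lambda>i. (cmod (c i))\<^sup>2) has_sum s) I"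
  shows "\<exists>w. gauss_limit I c w"
proof -
  have "\<exists>w\<in>vecs (L2 (gauss_space I)).
      ((\<lambda>J. hdist (L2 (gauss_space I)) (gauss_sum I c J) w) \<longlongrightarrow> 0) (finite_subsets_at_top I)"
  proof (rule L2_net_limit)
    fix \<epsilon> :: real assume "\<epsilon> > 0"
    then have "\<forall>\<^sub>F J in finite_subsets_at_top I. dist (\<Sum>i\<in>J. (cmod (c i))\<^sup>2) s < \<epsilon>\<^sup>2 / 2"
      using assms unfolding has_sum_def by (intro tendstoD) auto
    then obtain A where "finite A \<and> A \<subseteq> I \<and>
        (\<forall>K. finite K \<and> A \<subseteq> K \<and> K \<subseteq> I \<longrightarrow> dist (\<Sum>i\<in>K. (cmod (c i))\<^sup>2) s < \<epsilon>\<^sup>2 / 2)"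
      unfolding eventually_finite_subsets_at_top by (rule exE)
    then have A: "finite A" "A \<subseteq> I"
      "\<And>K. finite K \<Longrightarrow> A \<subseteq> K \<Longrightarrow> K \<subseteq> I \<Longrightarrow> dist (\<Sum>i\<in>K. (cmod (c i))\<^sup>2) s < \<epsilon>\<^sup>2 / 2"
      by simp_all
    have "hdist (L2 (gauss_space I)) (gauss_sum I c A) (gauss_sum I c K) < \<epsilon>"
      if K: "finite K" "A \<subseteq> K" "K \<subseteq> I" for K
    proof (rule power_less_imp_less_base)
      \<comment> \<open>The squared distance is the difference of two partial sums, each within half
        of \<open>\<epsilon>\<^sup>2\<close> of the total.\<close>
      show "(hdist (L2 (gauss_space I)) (gauss_sum I c A) (gauss_sum I c K))\<^sup>2 < \<epsilon>\<^sup>2"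
        using A(3)[OF K] A(3)[OF A(1) subset_refl A(2)]
        unfolding gauss_sum_hdist[OF K] dist_real_def by linarith
    qed (use \<open>\<epsilon> > 0\<close> in simp)
    with A(1,2) show "\<exists>A. finite A \<and> A \<subseteq> I \<and> (\<forall>K. finite K \<and> A \<subseteq> K \<and> K \<subseteq> I \<longrightarrow>
        hdist (L2 (gauss_space I)) (gauss_sum I c A) (gauss_sum I c K) < \<epsilon>)" by auto
  qed (rule gauss_sum_in)
  then show ?thesis by (auto simp: gauss_limit_def)
qed

lemma eventually_subset_finite_subsets_at_top:
  "\<forall>\<^sub>F J in finite_subsets_at_top I. finite J \<and> J \<subseteq> I"
  unfolding eventually_finite_subsets_at_top by (intro exI[of _ "{}"]) auto

text \<open>Sums over sets that leave \<open>I\<close> play no role in the limit; cutting them off keeps every term of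
  the net in the carrier.\<close>

lemma gauss_limit_cut:
  "gauss_limit I c w \<longleftrightarrow> w \<in> vecs (L2 (gauss_space I)) \<and>
    ((\<lambda>J. hdist (L2 (gauss_space I)) (gauss_sum I c (J \<inter> I)) w) \<longlongrightarrow> 0) (finite_subsets_at_top I)"
  unfolding gauss_limit_def
proof (intro conj_cong refl tendsto_cong)
  show "\<forall>\<^sub>F J in finite_subsets_at_top I. hdist (L2 (gauss_space I)) (gauss_sum I c J) w
      = hdist (L2 (gauss_space I)) (gauss_sum I c (J \<inter> I)) w"
    using eventually_subset_finite_subsets_at_top[of I] by eventually_elim (simp add: Int_absorb2)
qed

lemma gauss_limit_unique:
  assumes "gauss_limit I c v" "gauss_limit I c w"
  shows "v = w"
  using assms L2.hdist_limits_eq[of "\<lambda>J. gauss_sum I c (J \<inter> I)" "gauss_space I" v w "finite_subsets_at_top I"]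
    L2.hdist_zero_imp_eq[of v "gauss_space I" w]
  by (auto simp: gauss_limit_cut gauss_sum_in)

lemma gauss_limit_lincomb:
  assumes v: "gauss_limit I c v" and w: "gauss_limit I d w"
  shows "gauss_limit I (\<lambda>i. a * c i + b * d i) (lincomb (L2 (gauss_space I)) a v b w)"
proof -
  let ?L = "L2 (gauss_space I)"
  have vw: "v \<in> vecs ?L" "w \<in> vecs ?L" using v w by (auto simp: gauss_limit_def)
  have "((\<lambda>J. hdist ?L (gauss_sum I (\<lambda>i. a * c i + b * d i) (J \<inter> I)) (lincomb ?L a v b w)) \<longlongrightarrow> 0)
      (finite_subsets_at_top I)"
  proof (rule Lim_null_comparison)
    show "((\<lambda>J. cmod a * hdist ?L (gauss_sum I c (J \<inter> I)) v + cmod b * hdist ?L (gauss_sum I d (J \<inter> I)) w) \<longlongrightarrow> 0)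
        (finite_subsets_at_top I)"
      using v w unfolding gauss_limit_cut
      by (intro tendsto_add_zero tendsto_mult_right_zero) auto
    have "norm (hdist ?L (gauss_sum I (\<lambda>i. a * c i + b * d i) (J \<inter> I)) (lincomb ?L a v b w))
        \<le> cmod a * hdist ?L (gauss_sum I c (J \<inter> I)) v + cmod b * hdist ?L (gauss_sum I d (J \<inter> I)) w" for J
      using L2.hdist_lincomb_le[of "gauss_sum I c (J \<inter> I)" "gauss_space I" "gauss_sum I d (J \<inter> I)" v w a b] vw
      by (simp add: gauss_sum_in gauss_sum_lincomb)
    then show "\<forall>\<^sub>F J in finite_subsets_at_top I.
        norm (hdist ?L (gauss_sum I (\<lambda>i. a * c i + b * d i) (J \<inter> I)) (lincomb ?L a v b w))
        \<le> cmod a * hdist ?L (gauss_sum I c (J \<inter> I)) v + cmod b * hdist ?L (gauss_sum I d (J \<inter> I)) w"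
      by simp
  qed
  then show ?thesis using vw by (simp add: gauss_limit_cut)
qed

lemma gauss_limit_hnorm:
  assumes w: "gauss_limit I c w" and c: "((\<lambda>i. (cmod (c i))\<^sup>2) has_sum s) I"
  shows "(hnorm (L2 (gauss_space I)) w)\<^sup>2 = s"
proof (rule tendsto_unique)
  let ?L = "L2 (gauss_space I)"
  show "((\<lambda>J. (hnorm ?L (gauss_sum I c (J \<inter> I)))\<^sup>2) \<longlongrightarrow> (hnorm ?L w)\<^sup>2) (finite_subsets_at_top I)"
    using w unfolding gauss_limit_cut by (intro tendsto_power L2.tendsto_hnorm) (auto simp: gauss_sum_in)
  have "\<forall>\<^sub>F J in finite_subsets_at_top I. (\<Sum>i\<in>J. (cmod (c i))\<^sup>2) = (hnorm ?L (gauss_sum I c (J \<inter> I)))\<^sup>2"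
    using eventually_subset_finite_subsets_at_top[of I]
    by eventually_elim (simp add: gauss_sum_hnorm Int_absorb2)
  then show "((\<lambda>J. (hnorm ?L (gauss_sum I c (J \<inter> I)))\<^sup>2) \<longlongrightarrow> s) (finite_subsets_at_top I)"
    using c unfolding has_sum_def by (rule Lim_transform_eventually[rotated])
qed simp

text \<open>Conjugation fixes the partial sums and preserves distances, so the conjugate of the
  limit is again a limit, and limits are unique.\<close>

lemma gauss_limit_real:
  assumes w: "gauss_limit I c w" and c: "\<And>i. i \<in> I \<Longrightarrow> c i \<in> \<real>"
  shows "AE \<omega> in gauss_space I. cnj (rep w \<omega>) = rep w \<omega>"
proof -
  let ?P = "gauss_space I"
  have wL: "w \<in> vecs (L2 ?P)" using w by (simp add: gauss_limit_def)
  note r = L2_class_rep[OF wL]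
  have "hdist (L2 ?P) (gauss_sum I c (J \<inter> I)) (L2_class ?P (\<lambda>\<omega>. cnj (rep w \<omega>)))
      = hdist (L2 ?P) (gauss_sum I c (J \<inter> I)) w" for J
  proof -
    have "cnj (\<Sum>i\<in>J \<inter> I. c i * complex_of_real (\<omega> i)) = (\<Sum>i\<in>J \<inter> I. c i * complex_of_real (\<omega> i))" for \<omega>
      using c by (auto simp: Reals_cnj_iff intro!: sum.cong)
    then have "cmod ((\<Sum>i\<in>J \<inter> I. c i * complex_of_real (\<omega> i)) - cnj (rep w \<omega>))
        = cmod ((\<Sum>i\<in>J \<inter> I. c i * complex_of_real (\<omega> i)) - rep w \<omega>)" for \<omega>
      by (metis complex_cnj_diff complex_mod_cnj)
    then show ?thesis
      unfolding gauss_sum_def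
      by (subst (2) r(2)[symmetric], subst (1 2) L2_hdist) (auto simp: gauss_sum_L2 r)
  qed
  then have "gauss_limit I c (L2_class ?P (\<lambda>\<omega>. cnj (rep w \<omega>)))"
    using w r by (simp add: gauss_limit_cut)
  then have "L2_class ?P (\<lambda>\<omega>. cnj (rep w \<omega>)) = L2_class ?P (rep w)"
    unfolding r(2) by (rule gauss_limit_unique[OF _ w])
  then show ?thesis by (subst (asm) L2_class_eq_iff) (simp_all only: r(1) L2_funs_cnj)
qed

section \<open>The isonormal map as a linear isometry\<close>

lemma isonormal_gauss_limit:
  assumes U: "semi_inner_space (universal_space X F)" and onb: "orthonormal_basis (universal_space X F) I e"
    and k: "k \<in> vecs (universal_space X F)"
  shows "gauss_limit I (\<lambda>i. ip (universal_space X F) k (e i)) (isonormal X F I e k)"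
proof -
  let ?c = "\<lambda>i. ip (universal_space X F) k (e i)"
  obtain w where w: "gauss_limit I ?c w"
    using gauss_limit_exists[OF semi_inner_space.Parseval[OF U onb k]] by (rule exE)
  have "gauss_limit I ?c (THE w. gauss_limit I ?c w)"
    by (rule theI[of _ w]) (use w gauss_limit_unique[OF _ w] in blast)+
  then show ?thesis by (simp only: isonormal_def gauss_limit_def gauss_sum_def)
qed

lemma isonormal_in:
  assumes "semi_inner_space (universal_space X F)" "orthonormal_basis (universal_space X F) I e"
    "k \<in> vecs (universal_space X F)"
  shows "isonormal X F I e k \<in> vecs (L2 (gauss_space I))"
  using isonormal_gauss_limit[OF assms] by (simp add: gauss_limit_def)

lemma isonormal_lincomb:
  assumes U: "semi_inner_space (universal_space X F)" and onb: "orthonormal_basis (universal_space X F) I e"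
    and u: "u \<in> vecs (universal_space X F)" and v: "v \<in> vecs (universal_space X F)"
  shows "isonormal X F I e (lincomb (universal_space X F) a u b v)
    = lincomb (L2 (gauss_space I)) a (isonormal X F I e u) b (isonormal X F I e v)"
proof -
  interpret semi_inner_space "universal_space X F" by fact
  let ?U = "universal_space X F"
  let ?w = "lincomb (L2 (gauss_space I)) a (isonormal X F I e u) b (isonormal X F I e v)"
  have ei: "e i \<in> vecs ?U" if "i \<in> I" for i using onb that by (auto simp: orthonormal_basis_def)
  have *: "gauss_limit I (\<lambda>i. a * ip ?U u (e i) + b * ip ?U v (e i)) ?w"
    by (intro gauss_limit_lincomb isonormal_gauss_limit U onb u v)
  \<comment> \<open>The two coefficient families are compared only on \<open>I\<close>, where
    \<open>e i\<close> is known to lie in the carrier; passing to the sums cut off at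
    \<open>I\<close> removes the difference.\<close>
  have "gauss_sum I (\<lambda>i. a * ip ?U u (e i) + b * ip ?U v (e i)) (J \<inter> I)
      = gauss_sum I (\<lambda>i. ip ?U (lincomb ?U a u b v) (e i)) (J \<inter> I)" for J
  proof -
    have "(\<Sum>i\<in>J \<inter> I. (a * ip ?U u (e i) + b * ip ?U v (e i)) * complex_of_real (\<omega> i))
        = (\<Sum>i\<in>J \<inter> I. ip ?U (lincomb ?U a u b v) (e i) * complex_of_real (\<omega> i))" for \<omega>
      using u v ei by (intro sum.cong) (auto simp: ip_lincomb_left)
    then show ?thesis by (simp only: gauss_sum_def)
  qed
  with * have "gauss_limit I (\<lambda>i. ip ?U (lincomb ?U a u b v) (e i)) ?w"
    by (simp only: gauss_limit_cut)
  then show ?thesis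
    by (rule gauss_limit_unique[OF isonormal_gauss_limit[OF U onb lincomb_closed[OF u v]]])
qed

lemma isonormal_ip:
  assumes U: "semi_inner_space (universal_space X F)" and onb: "orthonormal_basis (universal_space X F) I e"
    and u: "u \<in> vecs (universal_space X F)" and v: "v \<in> vecs (universal_space X F)"
  shows "ip (L2 (gauss_space I)) (isonormal X F I e u) (isonormal X F I e v) = ip (universal_space X F) u v"
proof (rule isometry_preserves_ip[OF U L2.semi_inner_space_axioms isonormal_in[OF U onb]
    isonormal_lincomb[OF U onb] _ u v])
  fix k assume k: "k \<in> vecs (universal_space X F)"
  have "(hnorm (L2 (gauss_space I)) (isonormal X F I e k))\<^sup>2 = (hnorm (universal_space X F) k)\<^sup>2"
    by (rule gauss_limit_hnorm[OF isonormal_gauss_limit[OF U onb k] semi_inner_space.Parseval[OF U onb k]])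
  then show "hnorm (L2 (gauss_space I)) (isonormal X F I e k) = hnorm (universal_space X F) k"
    using L2.hnorm_nonneg[OF isonormal_in[OF U onb k]] semi_inner_space.hnorm_nonneg[OF U k]
    by (simp add: power2_eq_iff_nonneg)
qed

section \<open>Reproducing kernel Hilbert spaces\<close>

lemma is_rkhsD:
  assumes rk: "is_rkhs S k H"
  shows "semi_inner_space H"
    and "u \<in> vecs H \<Longrightarrow> u \<in> extensional S"
    and "u \<in> vecs H \<Longrightarrow> v \<in> vecs H \<Longrightarrow> lincomb H a u b v = (\<lambda>s\<in>S. a * u s + b * v s)"
    and "t \<in> S \<Longrightarrow> (\<lambda>s\<in>S. k s t) \<in> vecs H"
    and "t \<in> S \<Longrightarrow> u \<in> vecs H \<Longrightarrow> u t = ip H u (\<lambda>s\<in>S. k s t)"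
proof -
  note c1 = conjunct1[OF rk[unfolded is_rkhs_def]] and r1 = conjunct2[OF rk[unfolded is_rkhs_def]]
  note c2 = conjunct1[OF r1] and r2 = conjunct2[OF r1]
  note c3 = conjunct1[OF r2] and r3 = conjunct2[OF r2]
  note c4 = conjunct1[OF r3] and r4 = conjunct2[OF r3]
  note c5 = conjunct1[OF r4] and r5 = conjunct2[OF r4]
  note c6 = conjunct1[OF r5] and c8 = conjunct2[OF conjunct2[OF r5]]
  show "semi_inner_space H"
  proof
    show "vecs H \<noteq> {}" using c2 unfolding linear_subspace_def by blast
    show "u \<in> vecs H \<Longrightarrow> v \<in> vecs H \<Longrightarrow> lincomb H a u b v \<in> vecs H" for u v a b
      using c2 unfolding linear_subspace_def by blast
    show "u \<in> vecs H \<Longrightarrow> v \<in> vecs H \<Longrightarrow> w \<in> vecs H \<Longrightarrow>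
        ip H (lincomb H a u b v) w = a * ip H u w + b * ip H v w" for u v w a b
      by (rule c4[rule_format])
    show "u \<in> vecs H \<Longrightarrow> v \<in> vecs H \<Longrightarrow> ip H v u = cnj (ip H u v)" for u v
      by (rule c5[rule_format])
    show "u \<in> vecs H \<Longrightarrow> 0 \<le> Re (ip H u u)" for u
      using c6 by blast
  qed
  show "u \<in> vecs H \<Longrightarrow> u \<in> extensional S" using c1 by blast
  show "u \<in> vecs H \<Longrightarrow> v \<in> vecs H \<Longrightarrow> lincomb H a u b v = (\<lambda>s\<in>S. a * u s + b * v s)"
    by (rule c3[rule_format])
  show "t \<in> S \<Longrightarrow> (\<lambda>s\<in>S. k s t) \<in> vecs H"
    by (rule conjunct1[OF bspec[OF c8]])
  show "t \<in> S \<Longrightarrow> u \<in> vecs H \<Longrightarrow> u t = ip H u (\<lambda>s\<in>S. k s t)"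
    by (rule bspec[OF conjunct2[OF bspec[OF c8]]])
qed

lemma is_rkhs_complete:
  assumes rk: "is_rkhs S k H" and u: "\<And>n. u n \<in> vecs H"
    and C: "\<And>\<epsilon>. \<epsilon> > 0 \<Longrightarrow> \<exists>N. \<forall>m\<ge>N. \<forall>n\<ge>N. hdist H (u m) (u n) < \<epsilon>"
  shows "\<exists>v\<in>vecs H. (\<lambda>n. hdist H (u n) v) \<longlonglongrightarrow> 0"
proof -
  have *: "\<forall>u. (\<forall>n::nat. u n \<in> vecs H) \<and>
          (\<forall>\<epsilon>>0. \<exists>N. \<forall>m\<ge>N. \<forall>n\<ge>N. hdist H (u m) (u n) < \<epsilon>) \<longrightarrow>
          (\<exists>v\<in>vecs H. (\<lambda>n. hdist H (u n) v) \<longlonglongrightarrow> 0)"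
    using rk unfolding is_rkhs_def by (elim conjE)
  show ?thesis
    by (rule mp[OF spec[OF *, of u]]) (intro conjI allI impI u C)
qed

text \<open>The common part of the two spaces on which their inner products agree is a subspace that
  contains the kernel functions, hence it is dense in either space; as convergence in norm implies
  pointwise convergence, both spaces consist of the pointwise limits of its Cauchy sequences.\<close>

lemma is_rkhs_subset:
  assumes rk: "is_rkhs S k H" and rk': "is_rkhs S k H'"
  shows "vecs H \<subseteq> vecs H'"
proof
  fix u assume u: "u \<in> vecs H"
  interpret H: semi_inner_space H by (rule is_rkhsD(1)[OF rk])
  interpret H': semi_inner_space H' by (rule is_rkhsD(1)[OF rk'])
  note D = is_rkhsD(2-)[OF rk] and D' = is_rkhsD(2-)[OF rk']
  \<comment> \<open>Testing against the whole intersection makes membership a linear condition on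
    \<open>v\<close>. Kernel functions satisfy it because both inner products evaluate
    \<open>w\<close> at the same point.\<close>
  define G where "G = {v \<in> vecs H \<inter> vecs H'. \<forall>w\<in>vecs H \<inter> vecs H'. ip H w v = ip H' w v}"
  have G: "v \<in> vecs H" "v \<in> vecs H'" if "v \<in> G" for v using that by (auto simp: G_def)
  have G_ip: "ip H v w = ip H' v w" if "v \<in> G" "w \<in> G" for v w using that by (auto simp: G_def)
  have G_lincomb: "lincomb H' a v b w = lincomb H a v b w" "lincomb H a v b w \<in> G"
    if "v \<in> G" "w \<in> G" for a b v w
  proof -
    show eq: "lincomb H' a v b w = lincomb H a v b w" using G that by (simp add: D(2) D'(2))
    have "ip H x (lincomb H a v b w) = ip H' x (lincomb H a v b w)" if x: "x \<in> vecs H" "x \<in> vecs H'" for x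
      using \<open>v \<in> G\<close> \<open>w \<in> G\<close> x unfolding eq[symmetric] H'.ip_lincomb_right[OF G(2)[OF \<open>v \<in> G\<close>] G(2)[OF \<open>w \<in> G\<close>] x(2)]
      unfolding eq H.ip_lincomb_right[OF G(1)[OF \<open>v \<in> G\<close>] G(1)[OF \<open>w \<in> G\<close>] x(1)]
      by (simp add: G_def)
    moreover have "lincomb H a v b w \<in> vecs H'"
      using H'.lincomb_closed[OF G(2)[OF that(1)] G(2)[OF that(2)], of a b] eq by simp
    moreover have "lincomb H a v b w \<in> vecs H"
      using H.lincomb_closed[OF G(1)[OF that(1)] G(1)[OF that(2)]] .
    ultimately show "lincomb H a v b w \<in> G" unfolding G_def by blast
  qed
  have G_hdist: "hdist H' v w = hdist H v w" if "v \<in> G" "w \<in> G" for v w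
    using G_lincomb[OF that] G_ip by (simp add: hdist_def hnorm_def)
  have kernel: "(\<lambda>s\<in>S. k s t) \<in> G" if "t \<in> S" for t
    using D(3)[OF that] D'(3)[OF that] D(4)[OF that, symmetric] D'(4)[OF that, symmetric]
    by (simp add: G_def)
  have "G \<noteq> {}"
  proof -
    obtain u' where u': "u' \<in> vecs H'" using H'.vecs_nonempty by auto
    have z: "lincomb H 0 u 0 u = lincomb H' 0 u' 0 u'" using u u' by (simp add: D(2) D'(2))
    have "ip H w (lincomb H 0 u 0 u) = ip H' w (lincomb H' 0 u' 0 u')"
      if "w \<in> vecs H" "w \<in> vecs H'" for w
      using that u u' by (simp add: H.ip_lincomb_right H'.ip_lincomb_right)
    then have "lincomb H 0 u 0 u \<in> G"
      using u u' H.lincomb_closed[of u u 0 0] H'.lincomb_closed[of u' u' 0 0] by (simp add: G_def z)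
    then show ?thesis by blast
  qed
  \<comment> \<open>The projection of \<open>u\<close> onto the closure of \<open>G\<close> is built
    from a minimizing sequence in \<open>G\<close>.\<close>
  define d where "d = (INF g\<in>G. (hdist H u g)\<^sup>2)"
  have bdd: "bdd_below ((\<lambda>g. (hdist H u g)\<^sup>2) ` G)" by (rule bdd_belowI2[of _ 0]) simp
  have d_le: "d \<le> (hdist H u g)\<^sup>2" if "g \<in> G" for g
    unfolding d_def using bdd that by (rule cINF_lower)
  have "\<exists>g\<in>G. (hdist H u g)\<^sup>2 < d + inverse (real (Suc n))" for n
    using cINF_less_iff[OF \<open>G \<noteq> {}\<close> bdd, of "d + inverse (real (Suc n))"] by (simp add: d_def)
  then obtain g where g: "\<And>n. g n \<in> G" "\<And>n. (hdist H u (g n))\<^sup>2 < d + inverse (real (Suc n))"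
    by metis
  \<comment> \<open>Midpoints stay in \<open>G\<close>, so the squared distance of
    \<open>g m\<close> and \<open>g n\<close> is below \<open>2/(m+1) + 2/(n+1)\<close>; hence the
    bound \<open>\<epsilon>\<^sup>2 / 4\<close> used for the Cauchy property.\<close>
  have parallelogram: "(hdist H x y)\<^sup>2 = 2 * (hdist H u x)\<^sup>2 + 2 * (hdist H u y)\<^sup>2
      - 4 * (hdist H u (lincomb H (1/2) x (1/2) y))\<^sup>2" if "x \<in> G" "y \<in> G" for x y
  proof -
    have xy: "x \<in> vecs H" "y \<in> vecs H" using G that by auto
    have "Re (ip H u (lincomb H (1/2) x (1/2) y)) = Re (ip H u x) / 2 + Re (ip H u y) / 2"
      using xy u by (simp add: H.ip_lincomb_right)
    moreover have "(hnorm H (lincomb H (1/2) x (1/2) y))\<^sup>2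
        = (hnorm H x)\<^sup>2 / 4 + Re (ip H x y) / 2 + (hnorm H y)\<^sup>2 / 4"
      using H.hnorm_lincomb_sq[OF xy, of "1/2" "1/2"] by (simp add: power2_eq_square norm_divide)
    ultimately show ?thesis
      using xy u by (simp add: H.hdist_sq)
  qed
  have Cauchy: "\<exists>N. \<forall>m\<ge>N. \<forall>n\<ge>N. hdist H (g m) (g n) < \<epsilon>" if "\<epsilon> > 0" for \<epsilon>
  proof -
    have "\<epsilon>\<^sup>2 / 4 > 0" using that by simp
    from reals_Archimedean[OF this] obtain N where N: "inverse (real (Suc N)) < \<epsilon>\<^sup>2 / 4" by blast
    have "hdist H (g m) (g n) < \<epsilon>" if "m \<ge> N" "n \<ge> N" for m n
    proof (rule power_less_imp_less_base)
      have "inverse (real (Suc m)) \<le> inverse (real (Suc N))" "inverse (real (Suc n)) \<le> inverse (real (Suc N))"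
        using that by (simp_all add: le_imp_inverse_le)
      then show "(hdist H (g m) (g n))\<^sup>2 < \<epsilon>\<^sup>2"
        using parallelogram[OF g(1)[of m] g(1)[of n]] g(2)[of m] g(2)[of n] N
          d_le[OF G_lincomb(2)[OF g(1)[of m] g(1)[of n], of "1/2" "1/2"]] by linarith
    qed (use \<open>\<epsilon> > 0\<close> in simp)
    then show ?thesis by blast
  qed
  have gH: "g n \<in> vecs H" "g n \<in> vecs H'" for n using G g by auto
  obtain v where v: "v \<in> vecs H" and gv: "(\<lambda>n. hdist H (g n) v) \<longlonglongrightarrow> 0"
    using is_rkhs_complete[OF rk gH(1) Cauchy] by blast
  have "\<exists>N. \<forall>m\<ge>N. \<forall>n\<ge>N. hdist H' (g m) (g n) < \<epsilon>" if "\<epsilon> > 0" for \<epsilon>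
    using Cauchy[OF that] by (simp add: G_hdist g)
  from is_rkhs_complete[OF rk' gH(2) this]
  obtain v' where v': "v' \<in> vecs H'" and gv': "(\<lambda>n. hdist H' (g n) v') \<longlonglongrightarrow> 0"
    by blast
  have orth: "ip H u h = ip H v h" if h: "h \<in> G" for h
  proof -
    have hH: "h \<in> vecs H" by (rule G(1)[OF h])
    define z where "z = ip H (lincomb H 1 u (-1) v) h"
    \<comment> \<open>The limit \<open>v\<close> need not belong to \<open>G\<close>, but
      \<open>v + c h\<close> is a limit of the elements \<open>g n + c h\<close> of
      \<open>G\<close>.\<close>
    have bound: "d \<le> (hdist H u (lincomb H 1 v c h))\<^sup>2" for c
    proof (rule LIMSEQ_le_const)
      have "(\<lambda>n. hdist H u (lincomb H 1 v c h) + hdist H (g n) v) \<longlonglongrightarrow> hdist H u (lincomb H 1 v c h) + 0"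
        by (intro tendsto_add tendsto_const gv)
      then show "(\<lambda>n. (hdist H u (lincomb H 1 v c h) + hdist H (g n) v)\<^sup>2) \<longlonglongrightarrow> (hdist H u (lincomb H 1 v c h))\<^sup>2"
        by (intro tendsto_power) simp
      have "d \<le> (hdist H u (lincomb H 1 v c h) + hdist H (g n) v)\<^sup>2" for n
      proof -
        have "hdist H u (lincomb H 1 (g n) c h)
            \<le> hdist H u (lincomb H 1 v c h) + hdist H (lincomb H 1 v c h) (lincomb H 1 (g n) c h)"
          using u v hH gH by (intro H.hdist_triangle) auto
        also have "hdist H (lincomb H 1 v c h) (lincomb H 1 (g n) c h) \<le> hdist H (g n) v"
          using H.hdist_lincomb_le[of v h "g n" h 1 c] H.hdist_commute[of v "g n"] v hH gH by simp
        finally have "(hdist H u (lincomb H 1 (g n) c h))\<^sup>2 \<le> (hdist H u (lincomb H 1 v c h) + hdist H (g n) v)\<^sup>2"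
          using u hH gH by (intro power_mono) auto
        then show ?thesis using d_le[OF G_lincomb(2)[OF g(1) h]] by (rule order_trans[rotated])
      qed
      then show "\<exists>N. \<forall>n\<ge>N. d \<le> (hdist H u (lincomb H 1 v c h) + hdist H (g n) v)\<^sup>2" by blast
    qed
    have "(hdist H u v)\<^sup>2 \<le> d"
    proof (rule LIMSEQ_le)
      have "(\<lambda>n. \<bar>hdist H u (g n) - hdist H u v\<bar>) \<longlonglongrightarrow> 0"
      proof (rule tendsto_sandwich[OF _ _ tendsto_const gv])
        show "\<forall>\<^sub>F n in sequentially. \<bar>hdist H u (g n) - hdist H u v\<bar> \<le> hdist H (g n) v"
        proof (rule always_eventually, rule allI)
          fix n
          show "\<bar>hdist H u (g n) - hdist H u v\<bar> \<le> hdist H (g n) v"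
            using H.hdist_triangle[OF u gH(1) v, of n] H.hdist_triangle[OF u v gH(1), of n]
              H.hdist_commute[OF gH(1) v, of n] by linarith
        qed
      qed simp
      then have "(\<lambda>n. hdist H u (g n)) \<longlonglongrightarrow> hdist H u v"
        by (simp only: tendsto_rabs_zero_iff LIM_zero_iff)
      then show "(\<lambda>n. (hdist H u (g n))\<^sup>2) \<longlonglongrightarrow> (hdist H u v)\<^sup>2" by (rule tendsto_power)
      show "(\<lambda>n. d + inverse (real (Suc n))) \<longlonglongrightarrow> d"
        using tendsto_add[OF tendsto_const LIMSEQ_inverse_real_of_nat, of d] by simp
      show "\<exists>N. \<forall>n\<ge>N. (hdist H u (g n))\<^sup>2 \<le> d + inverse (real (Suc n))"
        using g(2) less_imp_le by blast
    qed
    \<comment> \<open>The squared distance of \<open>u\<close> to \<open>v\<close> is at most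
      \<open>d\<close> and that to \<open>v + c h\<close> at least \<open>d\<close>, so the term
      linear in \<open>c\<close> is controlled by the quadratic one.\<close>
    then have quad: "2 * Re (cnj c * z) \<le> (cmod c)\<^sup>2 * (hnorm H h)\<^sup>2" for c
    proof -
      have "(hdist H u (lincomb H 1 v c h))\<^sup>2 = (hnorm H (lincomb H 1 (lincomb H 1 u (-1) v) (-c) h))\<^sup>2"
        using u v hH
        by (simp add: H.hdist_sq H.hnorm_lincomb_sq H.ip_lincomb_right H.ip_lincomb_left algebra_simps
            H.Re_ip_commute)
      also have "\<dots> = (hdist H u v)\<^sup>2 + 2 * Re (- cnj c * z) + (cmod c)\<^sup>2 * (hnorm H h)\<^sup>2"
        using H.hnorm_lincomb_sq[of "lincomb H 1 u (-1) v" h 1 "-c"] u v hH by (simp add: hdist_def z_def)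
      finally show ?thesis using bound[of c] \<open>(hdist H u v)\<^sup>2 \<le> d\<close> by simp
    qed
    have "z = 0"
    proof (rule ccontr)
      assume "z \<noteq> 0"
      \<comment> \<open>With \<open>c = s * z\<close> the quadratic term is at most half of the
        linear one, which forces \<open>z = 0\<close>; the added \<open>1\<close> keeps the
        denominator positive when \<open>h\<close> has norm zero.\<close>
      define s where "s = 1 / ((hnorm H h)\<^sup>2 + 1)"
      have p: "(hnorm H h)\<^sup>2 + 1 > 0" by (simp add: add_nonneg_pos)
      then have s: "s > 0" "s * (hnorm H h)\<^sup>2 \<le> 1" by (simp_all add: s_def field_simps)
      have "cnj (of_real s * z) * z = of_real (s * (cmod z)\<^sup>2)"
        using complex_norm_square[of z] by (simp add: mult_ac)
      then have "2 * (s * (cmod z)\<^sup>2) \<le> (s * cmod z)\<^sup>2 * (hnorm H h)\<^sup>2"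
        using quad[of "of_real s * z"] s(1) by (simp only: Re_complex_of_real norm_mult norm_of_real abs_of_pos)
      also have "\<dots> = (s * (cmod z)\<^sup>2) * (s * (hnorm H h)\<^sup>2)" by (simp add: power2_eq_square)
      also have "\<dots> \<le> (s * (cmod z)\<^sup>2) * 1" using s by (intro mult_left_mono) auto
      finally have "s * (cmod z)\<^sup>2 \<le> 0" by simp
      then show False using s(1) \<open>z \<noteq> 0\<close> by (simp add: mult_le_0_iff)
    qed
    then show ?thesis using u v hH by (simp add: z_def H.ip_lincomb_left)
  qed
  \<comment> \<open>Orthogonality to the kernel functions gives \<open>u\<close> the values of
    \<open>v\<close>. On \<open>G\<close> both spaces have the same inner product, so the limits of
    \<open>g n\<close> in the two spaces have the same values, those of \<open>v'\<close>.\<close>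
  have "u = v'"
  proof (rule extensionalityI[OF D(1)[OF u] D'(1)[OF v']])
    fix t assume t: "t \<in> S"
    let ?k = "\<lambda>s\<in>S. k s t"
    have "(\<lambda>n. ip H (g n) ?k) \<longlonglongrightarrow> ip H v ?k"
      by (rule H.tendsto_ip_left[OF gH(1) v D(3)[OF t] gv])
    moreover have "(\<lambda>n. ip H' (g n) ?k) \<longlonglongrightarrow> ip H' v' ?k"
      by (rule H'.tendsto_ip_left[OF gH(2) v' D'(3)[OF t] gv'])
    ultimately have "ip H v ?k = ip H' v' ?k"
      using G_ip[OF g(1) kernel[OF t]] by (simp add: LIMSEQ_unique)
    then show "u t = v' t"
      using orth[OF kernel[OF t]] D(4)[OF t u] D'(4)[OF t v'] by simp
  qed
  then show "u \<in> vecs H'" using v' by simp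
qed

lemma rkhs_eqI:
  assumes "is_rkhs S k H"
  shows "rkhs S k = vecs H"
  unfolding rkhs_def
proof (rule the_equality)
  show "\<exists>H'. is_rkhs S k H' \<and> vecs H' = vecs H" using assms by blast
next
  fix V assume "\<exists>H'. is_rkhs S k H' \<and> vecs H' = V"
  then show "V = vecs H" using is_rkhs_subset assms by blast
qed

section \<open>The reproducing kernel space of a measure and the Krein-Feller derivative\<close>

definition set_function :: "'a measure \<Rightarrow> ('a \<Rightarrow> complex) set \<Rightarrow> 'a set \<Rightarrow> complex" where
  "set_function \<mu> h = (\<lambda>A\<in>fmeasurable \<mu>. ip (L2 \<mu>) h (L2_class \<mu> (indicator A)))"

text \<open>\<open>set_function\<close> is defined by inner products with indicators, so that its
  linearity comes from \<open>L2\<close>; here it is recognized as the indefinite integral of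
  \<open>h\<close>.\<close>

lemma set_function_eq_integral:
  assumes h: "h \<in> vecs (L2 \<mu>)" and A: "A \<in> fmeasurable \<mu>"
  shows "set_function \<mu> h A = (LINT x:A|\<mu>. rep h x)"
proof -
  have "ip (L2 \<mu>) h (L2_class \<mu> (indicator A)) = (\<integral>x. rep h x * cnj (indicator A x) \<partial>\<mu>)"
    using L2_ip[OF L2_class_rep(1)[OF h] L2_funs_indicator[OF A]] L2_class_rep(2)[OF h] by simp
  also have "\<dots> = (LINT x:A|\<mu>. rep h x)"
    unfolding set_lebesgue_integral_def
    by (intro Bochner_Integration.integral_cong) (auto simp: indicator_def)
  finally show ?thesis using A by (simp add: set_function_def)
qed

text \<open>Agreement on indicators extends to all of \<open>L2\<close> by conjugate-linearity and
  continuity in the second argument; then the difference of \<open>u\<close> and \<open>v\<close> is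
  orthogonal to itself.\<close>

lemma L2_eq_indicatorI:
  assumes u: "u \<in> vecs (L2 M)" and v: "v \<in> vecs (L2 M)"
    and eq: "\<And>A. A \<in> fmeasurable M \<Longrightarrow> ip (L2 M) u (L2_class M (indicator A)) = ip (L2 M) v (L2_class M (indicator A))"
  shows "u = v"
proof -
  let ?L = "L2 M"
  have *: "ip ?L u (L2_class M f) = ip ?L v (L2_class M f)" if "f \<in> L2_funs M" for f
    using that
  proof (induction rule: L2_induct)
    case (indicator A)
    then show ?case by (rule eq)
  next
    case (lincomb f g a b)
    then show ?case
      using u v by (simp add: L2.ip_lincomb_right flip: L2_lincomb)
  next
    case (limit f s)
    have lim: "(\<lambda>n. ip ?L w (L2_class M (s n))) \<longlonglongrightarrow> ip ?L w (L2_class M f)" if w: "w \<in> vecs ?L" for w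
    proof -
      have "(\<lambda>n. cnj (ip ?L (L2_class M (s n)) w)) \<longlonglongrightarrow> cnj (ip ?L (L2_class M f) w)"
        using limit w by (intro tendsto_cnj L2.tendsto_ip_left) auto
      then show ?thesis
        unfolding L2.ip_commute[OF L2_class_in[OF limit(1)] w, symmetric]
          L2.ip_commute[OF L2_class_in[OF limit(2)] w, symmetric] .
    qed
    show ?case
      using lim[OF u] lim[OF v] unfolding limit.IH by (rule LIMSEQ_unique)
  qed
  have "ip ?L u w = ip ?L v w" if "w \<in> vecs ?L" for w
    using that * by (auto elim: L2_class_cases)
  then have "ip ?L (lincomb ?L 1 u (-1) v) (lincomb ?L 1 u (-1) v) = 0"
    using u v by (simp add: L2.ip_lincomb_left)
  then have "hdist ?L u v = 0" by (simp add: hdist_def hnorm_def)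
  then show ?thesis using L2.hdist_zero_imp_eq u v by blast
qed

lemma inj_set_function: "inj_on (set_function \<mu>) (vecs (L2 \<mu>))"
proof (rule inj_onI)
  fix u v assume uv: "u \<in> vecs (L2 \<mu>)" "v \<in> vecs (L2 \<mu>)" and eq: "set_function \<mu> u = set_function \<mu> v"
  show "u = v"
  proof (rule L2_eq_indicatorI[OF uv])
    fix A assume "A \<in> fmeasurable \<mu>"
    then show "ip (L2 \<mu>) u (L2_class \<mu> (indicator A)) = ip (L2 \<mu>) v (L2_class \<mu> (indicator A))"
      using fun_cong[OF eq, of A] by (simp add: set_function_def)
  qed
qed

lemma set_function_lincomb:
  assumes "u \<in> vecs (L2 \<mu>)" "v \<in> vecs (L2 \<mu>)"
  shows "set_function \<mu> (lincomb (L2 \<mu>) a u b v)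
    = (\<lambda>A\<in>fmeasurable \<mu>. a * set_function \<mu> u A + b * set_function \<mu> v A)"
  unfolding set_function_def using assms by (intro restrict_ext) (simp add: L2.ip_lincomb_left)

text \<open>The structure of \<open>L2\<close> transported along the injective map
  \<open>set_function\<close>, whose inverse on its range is given by
  \<open>inv_into\<close>.\<close>

definition measure_cips :: "'a measure \<Rightarrow> ('a set \<Rightarrow> complex) cips" where
  "measure_cips \<mu> = \<lparr> vecs = set_function \<mu> ` vecs (L2 \<mu>),
     lincomb = (\<lambda>a u b v. \<lambda>A\<in>fmeasurable \<mu>. a * u A + b * v A),
     ip = (\<lambda>u v. ip (L2 \<mu>) (inv_into (vecs (L2 \<mu>)) (set_function \<mu>) u)
                          (inv_into (vecs (L2 \<mu>)) (set_function \<mu>) v)) \<rparr>"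

text \<open>The kernel function at \<open>B\<close> is the image of the indicator of
  \<open>B\<close>, so reproduction is just the definition of \<open>set_function\<close>;
  completeness is Riesz-Fischer, transported.\<close>

lemma is_rkhs_measure_cips:
  "is_rkhs (fmeasurable \<mu>) (\<lambda>A B. complex_of_real (measure \<mu> (A \<inter> B))) (measure_cips \<mu>)"
proof -
  let ?H = "measure_cips \<mu>" and ?L = "L2 \<mu>" and ?S = "fmeasurable \<mu>" and ?f = "set_function \<mu>"
  have V: "vecs ?H = ?f ` vecs ?L" by (simp add: measure_cips_def)
  have lin: "lincomb ?H a (?f u) b (?f v) = ?f (lincomb ?L a u b v)" if "u \<in> vecs ?L" "v \<in> vecs ?L" for a b u v
    using that by (simp add: measure_cips_def set_function_lincomb)
  have ip: "ip ?H (?f u) (?f v) = ip ?L u v" if "u \<in> vecs ?L" "v \<in> vecs ?L" for u v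
    using that by (simp add: measure_cips_def inv_into_f_f[OF inj_set_function])
  have dist: "hdist ?H (?f u) (?f v) = hdist ?L u v" if "u \<in> vecs ?L" "v \<in> vecs ?L" for u v
    using that by (simp add: hdist_def hnorm_def lin ip)
  have kernel: "(\<lambda>A\<in>?S. complex_of_real (measure \<mu> (A \<inter> B))) = ?f (L2_class \<mu> (indicator B))"
    if B: "B \<in> ?S" for B
    unfolding set_function_def
  proof (rule restrict_ext)
    fix A assume A: "A \<in> ?S"
    have "ip ?L (L2_class \<mu> (indicator B)) (L2_class \<mu> (indicator A)) = (\<integral>x. indicator B x * cnj (indicator A x) \<partial>\<mu>)"
      by (rule L2_ip[OF L2_funs_indicator[OF B] L2_funs_indicator[OF A]])
    also have "\<dots> = (\<integral>x. complex_of_real (indicator (A \<inter> B) x) \<partial>\<mu>)"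
      by (intro Bochner_Integration.integral_cong) (auto simp: indicator_def)
    also have "\<dots> = complex_of_real (measure \<mu> (A \<inter> B))"
      using A B by (simp add: integral_complex_of_real fmeasurable_def Int_absorb2[OF sets.sets_into_space] sets.Int)
    finally show "complex_of_real (measure \<mu> (A \<inter> B)) = ip ?L (L2_class \<mu> (indicator B)) (L2_class \<mu> (indicator A))" ..
  qed
  show ?thesis
    unfolding is_rkhs_def
  proof (intro conjI)
    show "vecs ?H \<subseteq> extensional ?S" by (auto simp: V set_function_def)
    show "linear_subspace ?H (vecs ?H)"
      unfolding linear_subspace_def using L2.vecs_nonempty by (auto simp: V lin)
    show "\<forall>u\<in>vecs ?H. \<forall>v\<in>vecs ?H. \<forall>a b. lincomb ?H a u b v = (\<lambda>s\<in>?S. a * u s + b * v s)"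
      by (simp add: measure_cips_def)
    show "\<forall>u\<in>vecs ?H. \<forall>v\<in>vecs ?H. \<forall>w\<in>vecs ?H. \<forall>a b.
        ip ?H (lincomb ?H a u b v) w = a * ip ?H u w + b * ip ?H v w"
      by (auto simp: V lin ip L2.ip_lincomb_left)
    show "\<forall>u\<in>vecs ?H. \<forall>v\<in>vecs ?H. ip ?H v u = cnj (ip ?H u v)"
      unfolding V using L2.ip_commute by (auto simp: ip)
    show "\<forall>u\<in>vecs ?H. 0 \<le> Re (ip ?H u u) \<and> (ip ?H u u = 0 \<longrightarrow> u = (\<lambda>s\<in>?S. 0))"
    proof (intro ballI conjI impI)
      fix u assume "u \<in> vecs ?H"
      then obtain h where h: "h \<in> vecs ?L" "u = ?f h" by (auto simp: V)
      show "0 \<le> Re (ip ?H u u)" using h L2.ip_nonneg by (simp add: ip)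
      assume "ip ?H u u = 0"
      then have "hnorm ?L h = 0" using h by (simp add: ip hnorm_def)
      then have "ip ?L h w = 0" if "w \<in> vecs ?L" for w
        using L2.Cauchy_Schwarz[OF h(1) that] by simp
      then show "u = (\<lambda>s\<in>?S. 0)"
        unfolding h(2) set_function_def by (intro restrict_ext) (simp add: L2_funs_indicator)
    qed
    show "\<forall>u. (\<forall>n::nat. u n \<in> vecs ?H) \<and> (\<forall>\<epsilon>>0. \<exists>N. \<forall>m\<ge>N. \<forall>n\<ge>N. hdist ?H (u m) (u n) < \<epsilon>) \<longrightarrow>
        (\<exists>v\<in>vecs ?H. (\<lambda>n. hdist ?H (u n) v) \<longlonglongrightarrow> 0)"
    proof (intro allI impI, elim conjE)
      fix u :: "nat \<Rightarrow> _"
      assume u: "\<forall>n. u n \<in> vecs ?H" and C: "\<forall>\<epsilon>>0. \<exists>N. \<forall>m\<ge>N. \<forall>n\<ge>N. hdist ?H (u m) (u n) < \<epsilon>"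
      from u have "\<forall>n. \<exists>h. h \<in> vecs ?L \<and> u n = ?f h" by (auto simp: V)
      then obtain h where h: "\<And>n. h n \<in> vecs ?L" "\<And>n. u n = ?f (h n)" by metis
      have "\<exists>v\<in>vecs ?L. (\<lambda>n. hdist ?L (h n) v) \<longlonglongrightarrow> 0"
        using C h by (intro Riesz_Fischer) (auto simp: dist)
      then show "\<exists>v\<in>vecs ?H. (\<lambda>n. hdist ?H (u n) v) \<longlonglongrightarrow> 0"
        using h by (auto simp: V dist)
    qed
    show "\<forall>t\<in>?S. (\<lambda>s\<in>?S. complex_of_real (measure \<mu> (s \<inter> t))) \<in> vecs ?H \<and>
        (\<forall>u\<in>vecs ?H. u t = ip ?H u (\<lambda>s\<in>?S. complex_of_real (measure \<mu> (s \<inter> t))))"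
    proof (intro ballI conjI)
      fix t assume t: "t \<in> ?S"
      then show "(\<lambda>s\<in>?S. complex_of_real (measure \<mu> (s \<inter> t))) \<in> vecs ?H"
        by (simp add: V kernel)
      fix u assume "u \<in> vecs ?H"
      then obtain h where "h \<in> vecs ?L" "u = ?f h" by (auto simp: V)
      with t show "u t = ip ?H u (\<lambda>s\<in>?S. complex_of_real (measure \<mu> (s \<inter> t)))"
        by (simp add: kernel ip) (simp add: set_function_def)
    qed
  qed
qed

lemma measure_rkhs_eq: "measure_rkhs \<mu> = set_function \<mu> ` vecs (L2 \<mu>)"
  unfolding measure_rkhs_def rkhs_eqI[OF is_rkhs_measure_cips] by (simp add: measure_cips_def)

text \<open>\<open>set_function\<close> maps \<open>L2\<close> bijectively onto the reproducing
  kernel space, and \<open>krein_feller\<close> is its inverse.\<close>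

lemma krein_feller_set_function:
  assumes h: "h \<in> vecs (L2 \<mu>)"
  shows "krein_feller \<mu> (set_function \<mu> h) = h"
proof -
  have eq: "(\<forall>A\<in>fmeasurable \<mu>. set_function \<mu> h A = (LINT x:A|\<mu>. rep g x)) \<longleftrightarrow> g = h"
    if g: "g \<in> vecs (L2 \<mu>)" for g
  proof -
    have "(\<forall>A\<in>fmeasurable \<mu>. set_function \<mu> h A = (LINT x:A|\<mu>. rep g x))
        \<longleftrightarrow> (\<forall>A\<in>fmeasurable \<mu>. set_function \<mu> h A = set_function \<mu> g A)"
      using set_function_eq_integral[OF g] by simp
    also have "\<dots> \<longleftrightarrow> set_function \<mu> h = set_function \<mu> g"
      by (auto simp: set_function_def fun_eq_iff restrict_def)
    also have "\<dots> \<longleftrightarrow> g = h" using inj_on_eq_iff[OF inj_set_function h g] by auto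
    finally show ?thesis .
  qed
  have "(THE g. g \<in> vecs (L2 \<mu>) \<and> (\<forall>A\<in>fmeasurable \<mu>. set_function \<mu> h A = (LINT x:A|\<mu>. rep g x))) = h"
    using eq h by (intro the_equality) auto
  then show ?thesis using h by (simp add: krein_feller_def measure_rkhs_eq)
qed

section \<open>Ito isometries and their adjoints\<close>

lemma contraction_continuous_linear:
  assumes H: "semi_inner_space H" and K: "semi_inner_space K"
    and T: "T \<in> vecs H \<rightarrow>\<^sub>E vecs K"
    and lin: "\<And>u v a b. u \<in> vecs H \<Longrightarrow> v \<in> vecs H \<Longrightarrow>
      T (lincomb H a u b v) = lincomb K a (T u) b (T v)"
    and contr: "\<And>u. u \<in> vecs H \<Longrightarrow> hnorm K (T u) \<le> hnorm H u"
  shows "T \<in> continuous_linear_maps H K"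
proof -
  interpret H: semi_inner_space H by fact
  have "hdist K (T u) (T v) \<le> hdist H u v" if "u \<in> vecs H" "v \<in> vecs H" for u v
    using contr[of "lincomb H 1 u (-1) v"] lin[OF that, of 1 "-1"] that by (simp add: hdist_def)
  then have "\<forall>u\<in>vecs H. \<forall>\<epsilon>>0. \<exists>\<delta>>0. \<forall>v\<in>vecs H. hdist H u v < \<delta> \<longrightarrow> hdist K (T u) (T v) < \<epsilon>"
    by (meson le_less_trans)
  then show ?thesis unfolding continuous_linear_maps_def using T lin by simp
qed

text \<open>Agreement spreads from indicators through linear combinations and limits by
  \<open>L2_induct\<close>; off the carrier both maps are undefined by extensionality.\<close>

lemma is_L2_extension_unique:
  assumes K: "inner_space K" and T: "is_L2_extension M K \<Phi> T" and T': "is_L2_extension M K \<Phi> T'"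
  shows "T = T'"
proof -
  interpret K: inner_space K by fact
  have lin: "\<And>u v a b. u \<in> vecs (L2 M) \<Longrightarrow> v \<in> vecs (L2 M) \<Longrightarrow>
      S (lincomb (L2 M) a u b v) = lincomb K a (S u) b (S v)"
    and cont: "\<And>u \<epsilon>. u \<in> vecs (L2 M) \<Longrightarrow> \<epsilon> > 0 \<Longrightarrow>
      \<exists>\<delta>>0. \<forall>v\<in>vecs (L2 M). hdist (L2 M) u v < \<delta> \<longrightarrow> hdist K (S u) (S v) < \<epsilon>"
    and dom: "S \<in> vecs (L2 M) \<rightarrow>\<^sub>E vecs K"
    and ind: "\<And>A. A \<in> fmeasurable M \<Longrightarrow> S (L2_class M (indicator A)) = \<Phi> A"
    if "is_L2_extension M K \<Phi> S" for S
    using that by (simp_all add: is_L2_extension_def continuous_linear_maps_def)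
  have lim: "(\<lambda>n. hdist K (S (L2_class M (s n))) (S (L2_class M f))) \<longlonglongrightarrow> 0"
    if S: "is_L2_extension M K \<Phi> S" and f: "f \<in> L2_funs M" and s: "\<And>n::nat. s n \<in> L2_funs M"
      and sf: "(\<lambda>n. hdist (L2 M) (L2_class M (s n)) (L2_class M f)) \<longlonglongrightarrow> 0" for S f s
  proof (rule tendstoI)
    fix \<epsilon> :: real assume "\<epsilon> > 0"
    from cont[OF S L2_class_in[OF f] this] obtain \<delta> where "\<delta> > 0"
      and \<delta>: "\<And>v. v \<in> vecs (L2 M) \<Longrightarrow> hdist (L2 M) (L2_class M f) v < \<delta> \<Longrightarrow> hdist K (S (L2_class M f)) (S v) < \<epsilon>"
      by blast
    have SK: "S u \<in> vecs K" if "u \<in> vecs (L2 M)" for u using dom[OF S] that by (rule PiE_mem)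
    have "\<forall>\<^sub>F n in sequentially. dist (hdist (L2 M) (L2_class M (s n)) (L2_class M f)) 0 < \<delta>"
      using sf \<open>\<delta> > 0\<close> by (rule tendstoD)
    then show "\<forall>\<^sub>F n in sequentially. dist (hdist K (S (L2_class M (s n))) (S (L2_class M f))) 0 < \<epsilon>"
    proof eventually_elim
      case (elim n)
      have "hdist (L2 M) (L2_class M f) (L2_class M (s n)) < \<delta>"
        using elim L2.hdist_commute[OF L2_class_in[OF f] L2_class_in[OF s[of n]]] by simp
      from \<delta>[OF L2_class_in[OF s] this] show ?case
        using K.hdist_commute[OF SK[OF L2_class_in[OF f]] SK[OF L2_class_in[OF s[of n]]]]
          K.hdist_nonneg[OF SK[OF L2_class_in[OF s[of n]]] SK[OF L2_class_in[OF f]]] by simp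
    qed
  qed
  have eq: "T (L2_class M f) = T' (L2_class M f)" if "f \<in> L2_funs M" for f
    using that
  proof (induction rule: L2_induct)
    case (indicator A)
    then show ?case using ind[OF T] ind[OF T'] by simp
  next
    case (lincomb f g a b)
    then show ?case using lin[OF T] lin[OF T'] by (simp flip: L2_lincomb)
  next
    case (limit f s)
    have mem: "T (L2_class M (s n)) \<in> vecs K" "T (L2_class M f) \<in> vecs K" "T' (L2_class M f) \<in> vecs K" for n
      using PiE_mem[OF dom[OF T] L2_class_in] PiE_mem[OF dom[OF T'] L2_class_in] limit.hyps by blast+
    have "hdist K (T (L2_class M f)) (T' (L2_class M f)) = 0"
    proof (rule K.hdist_limits_eq[OF mem trivial_limit_sequentially])
      show "(\<lambda>n. hdist K (T (L2_class M (s n))) (T (L2_class M f))) \<longlonglongrightarrow> 0"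
        by (rule lim[OF T limit.hyps])
      show "(\<lambda>n. hdist K (T (L2_class M (s n))) (T' (L2_class M f))) \<longlonglongrightarrow> 0"
        unfolding limit.IH by (rule lim[OF T' limit.hyps])
    qed
    then show ?case by (rule K.hdist_zero_imp_eq[OF mem(2,3)])
  qed
  show ?thesis
  proof (rule PiE_ext[OF dom[OF T] dom[OF T']])
    fix u assume "u \<in> vecs (L2 M)"
    then show "T u = T' u" using eq by (auto elim: L2_class_cases)
  qed
qed

lemma L2_extension_eqI:
  assumes "inner_space K" "is_L2_extension M K \<Phi> T"
  shows "L2_extension M K \<Phi> = T"
  unfolding L2_extension_def using assms is_L2_extension_unique by (intro the_equality) blast+

section \<open>The isometric embedding of \<open>L2\<close> of a measure into the universal
  space\<close>

definition uni_embed :: "'a set \<Rightarrow> 'a set set \<Rightarrow> 'a measure \<Rightarrow> ('a \<Rightarrow> complex) set \<Rightarrow> 'a uni_vec" where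
  "uni_embed X F \<mu> u = uni_class X F (rep u) \<mu>"

lemma uni_embed_class:
  assumes \<mu>: "sigma_finite_on X F \<mu>" and f: "f \<in> L2_funs \<mu>"
  shows "uni_embed X F \<mu> (L2_class \<mu> f) = uni_class X F f \<mu>"
proof -
  have sf: "sf_dominates \<mu> \<mu>" using \<mu> by (intro sf_dominates_refl) (simp add: sigma_finite_on_def)
  have p: "(rep (L2_class \<mu> f), \<mu>) \<in> uni_pairs X F" "(f, \<mu>) \<in> uni_pairs X F"
    using \<mu> f rep_L2_class(1) by (auto simp: uni_pairs_iff)
  show ?thesis
    unfolding uni_embed_def uni_class_eq_iff[OF p] uni_rel_iff[OF p sf sf]
    using rep_L2_class(2)[OF f] by eventually_elim (simp add: half_density_def)
qed

lemma uni_embed_in: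
  assumes "sigma_finite_on X F \<mu>" "u \<in> vecs (L2 \<mu>)"
  shows "uni_embed X F \<mu> u \<in> vecs (universal_space X F)"
  unfolding uni_embed_def using assms L2_class_rep(1) by (intro uni_class_in) (simp add: uni_pairs_iff)

lemma uni_embed_lincomb:
  assumes \<mu>: "sigma_finite_on X F \<mu>" and u: "u \<in> vecs (L2 \<mu>)" and v: "v \<in> vecs (L2 \<mu>)"
  shows "uni_embed X F \<mu> (lincomb (L2 \<mu>) a u b v)
    = lincomb (universal_space X F) a (uni_embed X F \<mu> u) b (uni_embed X F \<mu> v)"
proof -
  obtain f g where f: "f \<in> L2_funs \<mu>" "u = L2_class \<mu> f" and g: "g \<in> L2_funs \<mu>" "v = L2_class \<mu> g"
    using u v by (metis L2_class_cases)
  show ?thesis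
    using f(1) g(1) \<mu> by (simp add: f(2) g(2) L2_lincomb uni_embed_class uni_lincomb uni_pairs_iff)
qed

lemma uni_embed_ip:
  assumes \<mu>: "sigma_finite_on X F \<mu>" and u: "u \<in> vecs (L2 \<mu>)" and v: "v \<in> vecs (L2 \<mu>)"
  shows "ip (universal_space X F) (uni_embed X F \<mu> u) (uni_embed X F \<mu> v) = ip (L2 \<mu>) u v"
proof -
  obtain f g where f: "f \<in> L2_funs \<mu>" "u = L2_class \<mu> f" and g: "g \<in> L2_funs \<mu>" "v = L2_class \<mu> g"
    using u v by (metis L2_class_cases)
  show ?thesis
    using f(1) g(1) \<mu> by (simp add: f(2) g(2) L2_ip uni_embed_class uni_ip_same uni_pairs_iff)
qed

text \<open>The witness is multiplication by \<open>sqrt (d\<rho>/d\<nu>) / sqrt (d\<mu>/d\<nu>)\<close>; where the denominator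
  vanishes, \<open>x / 0 = 0\<close> is harmless because \<open>\<mu>\<close> does not charge that set.\<close>

lemma uni_embed_adjoint:
  assumes \<mu>: "sigma_finite_on X F \<mu>" and \<rho>: "sigma_finite_on X F \<rho>" and u: "u \<in> vecs (L2 \<rho>)"
  shows "\<exists>w\<in>vecs (L2 \<mu>). \<forall>v\<in>vecs (L2 \<mu>).
    ip (L2 \<mu>) v w = ip (universal_space X F) (uni_embed X F \<mu> v) (uni_embed X F \<rho> u)"
proof -
  define \<nu> where "\<nu> = common_dom X F \<mu> \<rho>"
  have d: "sf_dominates \<nu> \<mu>" "sf_dominates \<nu> \<rho>"
    using common_dom[OF \<mu> \<rho>] by (auto simp: \<nu>_def)
  obtain f where f: "f \<in> L2_funs \<rho>" "u = L2_class \<rho> f" using u by (rule L2_class_cases)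
  define h where "h x = half_density \<nu> f \<rho> x / sqrt_deriv \<nu> \<mu> x" for x
  have hf: "half_density \<nu> f \<rho> \<in> L2_funs \<nu>" by (rule half_density_L2[OF d(2) f(1)])
  note [measurable] = L2_funs_measurable[OF hf]
  have h_meas[measurable]: "h \<in> borel_measurable \<nu>" unfolding h_def by measurable
  then have h_meas': "h \<in> borel_measurable \<mu>" using measurable_dominates[OF d(1)] by blast
  have hL: "h \<in> L2_funs \<mu>"
  proof (rule L2_funsI[OF h_meas'])
    have "integrable \<nu> (\<lambda>x. (cmod (sqrt_deriv \<nu> \<mu> x))\<^sup>2 *\<^sub>R (cmod (h x))\<^sup>2)"
    \<comment> \<open>Equality holds where \<open>sqrt_deriv \<nu> \<mu> x\<close> is nonzero.
      Elsewhere the left side is zero, while the right side may carry the part of \<rho> singular to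
      \<mu>.\<close>
    proof (rule Bochner_Integration.integrable_bound[OF L2_funs_integrable[OF hf]])
      show "AE x in \<nu>. norm ((cmod (sqrt_deriv \<nu> \<mu> x))\<^sup>2 *\<^sub>R (cmod (h x))\<^sup>2) \<le> norm ((cmod (half_density \<nu> f \<rho> x))\<^sup>2)"
        by (rule AE_I2) (simp add: h_def norm_divide power_divide)
    qed measurable
    then show "integrable \<mu> (\<lambda>x. (cmod (h x))\<^sup>2)"
      using integral_sqrt_deriv(2)[OF d(1), of "\<lambda>x. (cmod (h x))\<^sup>2"] h_meas' by simp
  qed
  show ?thesis
  proof (intro bexI[of _ "L2_class \<mu> h"] ballI)
    fix v assume "v \<in> vecs (L2 \<mu>)"
    then obtain g where g: "g \<in> L2_funs \<mu>" "v = L2_class \<mu> g" by (rule L2_class_cases)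
    have gh: "(\<lambda>x. g x * cnj (h x)) \<in> borel_measurable \<mu>"
      using L2_funs_mult_integrable[OF g(1) hL] by (rule borel_measurable_integrable)
    have "ip (L2 \<mu>) v (L2_class \<mu> h) = (\<integral>x. g x * cnj (h x) \<partial>\<mu>)"
      using L2_ip[OF g(1) hL] g(2) by simp
    also have "\<dots> = (\<integral>x. (cmod (sqrt_deriv \<nu> \<mu> x))\<^sup>2 *\<^sub>R (g x * cnj (h x)) \<partial>\<nu>)"
      by (rule integral_sqrt_deriv(1)[OF d(1) gh])
    also have "\<dots> = (\<integral>x. half_density \<nu> g \<mu> x * cnj (half_density \<nu> f \<rho> x) \<partial>\<nu>)"
    proof (rule Bochner_Integration.integral_cong[OF refl])
      fix x
      let ?s = "sqrt_deriv \<nu> \<mu> x"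
      have "(cmod ?s)\<^sup>2 *\<^sub>R (g x * cnj (h x)) = (?s * ?s) * (g x * cnj (h x))"
        by (simp only: sqrt_deriv_sq scaleR_conv_of_real)
      also have "\<dots> = half_density \<nu> g \<mu> x * (?s * cnj (h x))"
        by (simp add: half_density_def mult_ac)
      \<comment> \<open>Where \<open>?s\<close> vanishes,
        \<open>half_density \<nu> g \<mu> x\<close> is already zero; elsewhere \<open>?s\<close>
        cancels the denominator of \<open>h\<close>.\<close>
      also have "half_density \<nu> g \<mu> x * (?s * cnj (h x)) = half_density \<nu> g \<mu> x * cnj (half_density \<nu> f \<rho> x)"
        by (cases "?s = 0") (simp_all add: half_density_def[of \<nu> g] h_def)
      finally show "(cmod ?s)\<^sup>2 *\<^sub>R (g x * cnj (h x)) = half_density \<nu> g \<mu> x * cnj (half_density \<nu> f \<rho> x)" .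
    qed
    also have "\<dots> = ip (universal_space X F) (uni_embed X F \<mu> v) (uni_embed X F \<rho> u)"
      unfolding f(2) g(2) uni_embed_class[OF \<mu> g(1)] uni_embed_class[OF \<rho> f(1)]
      using \<mu> \<rho> f(1) g(1) d by (intro uni_ip[symmetric]) (simp_all add: uni_pairs_iff)
    finally show "ip (L2 \<mu>) v (L2_class \<mu> h) = ip (universal_space X F) (uni_embed X F \<mu> v) (uni_embed X F \<rho> u)" .
  qed (use hL in simp)
qed

section \<open>The composite of one Ito isometry with the adjoint of another\<close>

lemma L2_eq_ipI:
  assumes "u \<in> vecs (L2 M)" "v \<in> vecs (L2 M)" "\<And>w. w \<in> vecs (L2 M) \<Longrightarrow> ip (L2 M) w u = ip (L2 M) w v"
  shows "u = v"
proof (rule L2_eq_indicatorI[OF assms(1,2)])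
  fix A assume "A \<in> fmeasurable M"
  then have A: "L2_class M (indicator A) \<in> vecs (L2 M)" by simp
  show "ip (L2 M) u (L2_class M (indicator A)) = ip (L2 M) v (L2_class M (indicator A))"
    unfolding L2.ip_commute[OF A assms(1)] L2.ip_commute[OF A assms(2)] assms(3)[OF A] ..
qed

text \<open>The two halves of the theorem differ by an exchange of the measures, so one development
  in an ordered pair serves both.\<close>

locale brownian_pair =
  fixes X :: "'a set" and F :: "'a set set" and I :: "'i set" and e :: "'i \<Rightarrow> 'a uni_vec"
    and \<mu> \<rho> :: "'a measure"
  assumes onb: "real_orthonormal_basis X F I e"
    and \<mu>: "sigma_finite_on X F \<mu>" and \<rho>: "sigma_finite_on X F \<rho>"
begin

abbreviation U :: "'a uni_vec cips" where "U \<equiv> universal_space X F"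
abbreviation P :: "('i \<Rightarrow> real) measure" where "P \<equiv> gauss_space I"

text \<open>An explicit candidate for the Ito isometry; the restriction to the carrier is what
  membership in \<open>continuous_linear_maps\<close> demands.\<close>

definition ito_map :: "'a measure \<Rightarrow> ('a \<Rightarrow> complex) set \<Rightarrow> (('i \<Rightarrow> real) \<Rightarrow> complex) set" where
  "ito_map \<tau> = (\<lambda>u\<in>vecs (L2 \<tau>). isonormal X F I e (uni_embed X F \<tau> u))"

lemma semi_inner_U: "semi_inner_space U"
  by (rule semi_inner_space_universal[OF \<mu>])

lemma onb': "orthonormal_basis U I e"
  using onb by (simp add: real_orthonormal_basis_def)

lemma ito_map_in:
  assumes "sigma_finite_on X F \<tau>" "u \<in> vecs (L2 \<tau>)"
  shows "ito_map \<tau> u \<in> vecs (L2 P)"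
  using assms by (simp add: ito_map_def isonormal_in[OF semi_inner_U onb'] uni_embed_in)

lemma ito_map_ip:
  assumes "sigma_finite_on X F \<tau>" "u \<in> vecs (L2 \<tau>)" "sigma_finite_on X F \<sigma>" "v \<in> vecs (L2 \<sigma>)"
  shows "ip (L2 P) (ito_map \<tau> u) (ito_map \<sigma> v) = ip U (uni_embed X F \<tau> u) (uni_embed X F \<sigma> v)"
  using assms by (simp add: ito_map_def isonormal_ip[OF semi_inner_U onb'] uni_embed_in)

lemma ito_map_indicator:
  assumes "sigma_finite_on X F \<tau>" "A \<in> fmeasurable \<tau>"
  shows "ito_map \<tau> (L2_class \<tau> (indicator A)) = brownian X F I e \<tau> A"
  using assms by (simp add: ito_map_def brownian_def uni_embed_class)

lemma ito_map_extension:
  assumes \<tau>: "sigma_finite_on X F \<tau>"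
  shows "is_L2_extension \<tau> (L2 P) (brownian X F I e \<tau>) (ito_map \<tau>)"
  unfolding is_L2_extension_def
proof (intro conjI ballI)
  show "ito_map \<tau> \<in> continuous_linear_maps (L2 \<tau>) (L2 P)"
  proof (rule contraction_continuous_linear[OF L2.semi_inner_space_axioms L2.semi_inner_space_axioms])
    show "ito_map \<tau> \<in> vecs (L2 \<tau>) \<rightarrow>\<^sub>E vecs (L2 P)"
      using ito_map_in[OF \<tau>] by (auto simp: ito_map_def)
    show "ito_map \<tau> (lincomb (L2 \<tau>) a u b v) = lincomb (L2 P) a (ito_map \<tau> u) b (ito_map \<tau> v)"
      if "u \<in> vecs (L2 \<tau>)" "v \<in> vecs (L2 \<tau>)" for u v a b
      using that \<tau> by (simp add: ito_map_def uni_embed_lincomb isonormal_lincomb[OF semi_inner_U onb'] uni_embed_in)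
    show "hnorm (L2 P) (ito_map \<tau> u) \<le> hnorm (L2 \<tau>) u" if "u \<in> vecs (L2 \<tau>)" for u
      using that \<tau> by (simp add: hnorm_def ito_map_ip uni_embed_ip)
  qed
qed (rule ito_map_indicator[OF \<tau>])

lemma ito_eq: "sigma_finite_on X F \<tau> \<Longrightarrow> ito X F I e \<tau> = ito_map \<tau>"
  unfolding ito_def by (rule L2_extension_eqI[OF inner_space_L2 ito_map_extension])

text \<open>The image is selected by its inner products, which determine it, and not by the quotient
  formula, which involves representatives and a dominating measure. Linearity then follows by
  comparing inner products.\<close>

definition cross_op :: "('a \<Rightarrow> complex) set \<Rightarrow> ('a \<Rightarrow> complex) set" where
  "cross_op = (\<lambda>u\<in>vecs (L2 \<rho>). SOME w. w \<in> vecs (L2 \<mu>) \<and>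
     (\<forall>v\<in>vecs (L2 \<mu>). ip (L2 \<mu>) v w = ip U (uni_embed X F \<mu> v) (uni_embed X F \<rho> u)))"

lemma cross_op:
  assumes u: "u \<in> vecs (L2 \<rho>)"
  shows "cross_op u \<in> vecs (L2 \<mu>)"
    and "v \<in> vecs (L2 \<mu>) \<Longrightarrow> ip (L2 \<mu>) v (cross_op u) = ip U (uni_embed X F \<mu> v) (uni_embed X F \<rho> u)"
proof -
  have "\<exists>w. w \<in> vecs (L2 \<mu>) \<and>
      (\<forall>v\<in>vecs (L2 \<mu>). ip (L2 \<mu>) v w = ip U (uni_embed X F \<mu> v) (uni_embed X F \<rho> u))"
    using uni_embed_adjoint[OF \<mu> \<rho> u] by blast
  from someI_ex[OF this] show "cross_op u \<in> vecs (L2 \<mu>)"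
    and "v \<in> vecs (L2 \<mu>) \<Longrightarrow> ip (L2 \<mu>) v (cross_op u) = ip U (uni_embed X F \<mu> v) (uni_embed X F \<rho> u)"
    using u by (simp_all add: cross_op_def)
qed

lemma cross_op_continuous_linear: "cross_op \<in> continuous_linear_maps (L2 \<rho>) (L2 \<mu>)"
proof (rule contraction_continuous_linear[OF L2.semi_inner_space_axioms L2.semi_inner_space_axioms])
  interpret U: semi_inner_space U by (rule semi_inner_U)
  show "cross_op \<in> vecs (L2 \<rho>) \<rightarrow>\<^sub>E vecs (L2 \<mu>)"
    using cross_op(1) by (auto simp: cross_op_def)
  show "cross_op (lincomb (L2 \<rho>) a u b v) = lincomb (L2 \<mu>) a (cross_op u) b (cross_op v)"
    if uv: "u \<in> vecs (L2 \<rho>)" "v \<in> vecs (L2 \<rho>)" for u v a b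
  proof (rule L2_eq_ipI)
    show "ip (L2 \<mu>) w (cross_op (lincomb (L2 \<rho>) a u b v)) = ip (L2 \<mu>) w (lincomb (L2 \<mu>) a (cross_op u) b (cross_op v))"
      if "w \<in> vecs (L2 \<mu>)" for w
      using that uv \<mu> \<rho>
      by (simp add: cross_op L2.ip_lincomb_right uni_embed_lincomb U.ip_lincomb_right uni_embed_in)
  qed (use uv cross_op(1) in auto)
  show "hnorm (L2 \<mu>) (cross_op u) \<le> hnorm (L2 \<rho>) u" if u: "u \<in> vecs (L2 \<rho>)" for u
  proof -
    \<comment> \<open>Contractivity: the defining property, applied to \<open>cross_op u\<close>
      itself, and Cauchy-Schwarz bound the square of its norm by its norm times that of
      \<open>u\<close>.\<close>
    have "(hnorm (L2 \<mu>) (cross_op u))\<^sup>2 = Re (ip U (uni_embed X F \<mu> (cross_op u)) (uni_embed X F \<rho> u))"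
      using L2.Re_ip_self[OF cross_op(1)[OF u]] cross_op(2)[OF u cross_op(1)[OF u]] by simp
    also have "\<dots> \<le> hnorm U (uni_embed X F \<mu> (cross_op u)) * hnorm U (uni_embed X F \<rho> u)"
      using U.Cauchy_Schwarz[OF uni_embed_in[OF \<mu> cross_op(1)[OF u]] uni_embed_in[OF \<rho> u]]
        complex_Re_le_cmod order_trans by blast
    also have "\<dots> = hnorm (L2 \<mu>) (cross_op u) * hnorm (L2 \<rho>) u"
      using uni_embed_ip[OF \<mu> cross_op(1)[OF u] cross_op(1)[OF u]] uni_embed_ip[OF \<rho> u u] by (simp add: hnorm_def)
    finally have "hnorm (L2 \<mu>) (cross_op u) * hnorm (L2 \<mu>) (cross_op u) \<le> hnorm (L2 \<mu>) (cross_op u) * hnorm (L2 \<rho>) u"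
      by (simp add: power2_eq_square)
    then show ?thesis
      using L2.hnorm_nonneg[OF cross_op(1)[OF u]] L2.hnorm_nonneg[OF u]
      by (cases "hnorm (L2 \<mu>) (cross_op u) = 0") (auto simp: mult_le_cancel_left)
  qed
qed

text \<open>As \<open>W\<close> preserves inner products, \<open>cross_op u\<close> satisfies the
  condition that describes the adjoint, and at most one vector does.\<close>

lemma ito_adjoint_ito:
  assumes u: "u \<in> vecs (L2 \<rho>)"
  shows "ito_adjoint X F I e \<mu> (ito X F I e \<rho> u) = cross_op u"
proof -
  have Vu: "ito_map \<rho> u \<in> vecs (L2 P)" by (rule ito_map_in[OF \<rho> u])
  have eq: "ip (L2 P) (ito_map \<mu> v) (ito_map \<rho> u) = ip (L2 \<mu>) v (cross_op u)" if "v \<in> vecs (L2 \<mu>)" for v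
    using ito_map_ip[OF \<mu> that \<rho> u] cross_op(2)[OF u that] by simp
  have "(THE w. w \<in> vecs (L2 \<mu>) \<and> (\<forall>v\<in>vecs (L2 \<mu>). ip (L2 P) (ito_map \<mu> v) (ito_map \<rho> u) = ip (L2 \<mu>) v w)) = cross_op u"
  proof (rule the_equality)
    fix w assume "w \<in> vecs (L2 \<mu>) \<and> (\<forall>v\<in>vecs (L2 \<mu>). ip (L2 P) (ito_map \<mu> v) (ito_map \<rho> u) = ip (L2 \<mu>) v w)"
    then show "w = cross_op u" using eq cross_op(1)[OF u] by (intro L2_eq_ipI) auto
  qed (use eq cross_op(1)[OF u] in simp)
  then show ?thesis
    using Vu by (simp add: ito_adjoint_def ito_eq[OF \<mu>] ito_eq[OF \<rho>] hilbert_adjoint_def)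
qed

text \<open>The basis vectors have real representatives, so the coefficients of an indicator class
  are real.\<close>

lemma brownian_real:
  assumes "A \<in> fmeasurable \<mu>"
  shows "AE \<omega> in P. cnj (rep (brownian X F I e \<mu> A) \<omega>) = rep (brownian X F I e \<mu> A) \<omega>"
proof -
  have p: "(indicator A, \<mu>) \<in> uni_pairs X F" using \<mu> assms by (simp add: uni_pairs_iff)
  show ?thesis
    unfolding brownian_def
  proof (rule gauss_limit_real[OF isonormal_gauss_limit[OF semi_inner_U onb' uni_class_in[OF p]]])
    fix i assume "i \<in> I"
    then obtain f \<tau> where f: "(f, \<tau>) \<in> uni_pairs X F" "\<And>x. x \<in> X \<Longrightarrow> f x \<in> \<real>" "e i = uni_class X F f \<tau>"
      using onb unfolding real_orthonormal_basis_def by blast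
    show "ip U (uni_class X F (indicator A) \<mu>) (e i) \<in> \<real>"
      unfolding f(3) by (rule uni_ip_real[OF p _ f(1,2)]) (auto simp: indicator_def)
  qed
qed

text \<open>The expectation contains no conjugate whereas the inner product of \<open>L2\<close>
  does. Reality of the Brownian motion of \<mu> supplies the conjugate on the factor of
  \<open>D\<close>, which puts \<open>cross_op\<close> in the first argument, as
  \<open>set_function\<close> requires.\<close>

lemma cross_covariance_eq:
  assumes B: "B \<in> fmeasurable \<rho>"
  shows "cross_covariance X F I e \<mu> \<rho> B = set_function \<mu> (cross_op (L2_class \<rho> (indicator B)))"
  unfolding cross_covariance_def set_function_def
proof (rule restrict_ext)
  fix D assume D: "D \<in> fmeasurable \<mu>"
  let ?W = "brownian X F I e \<mu> D" and ?W' = "brownian X F I e \<rho> B"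
  let ?d = "L2_class \<mu> (indicator D)" and ?b = "L2_class \<rho> (indicator B)"
  have d: "?d \<in> vecs (L2 \<mu>)" and b: "?b \<in> vecs (L2 \<rho>)" using B D by auto
  have W: "?W = ito_map \<mu> ?d" "?W' = ito_map \<rho> ?b" using ito_map_indicator[OF \<mu> D] ito_map_indicator[OF \<rho> B] by simp_all
  have W_in: "?W \<in> vecs (L2 P)" "?W' \<in> vecs (L2 P)" unfolding W by (rule ito_map_in \<mu> d \<rho> b)+
  note L = L2_class_rep[OF W_in(1)] L2_class_rep[OF W_in(2)]
  have "(\<integral>\<omega>. rep ?W \<omega> * rep ?W' \<omega> \<partial>P) = (\<integral>\<omega>. rep ?W' \<omega> * cnj (rep ?W \<omega>) \<partial>P)"
  proof (rule integral_cong_AE)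
    show "AE \<omega> in P. rep ?W \<omega> * rep ?W' \<omega> = rep ?W' \<omega> * cnj (rep ?W \<omega>)"
      using brownian_real[OF D] by eventually_elim simp
  qed (use L2_funs_measurable[OF L(1)] L2_funs_measurable[OF L(3)] in measurable)
  also have "\<dots> = ip (L2 P) ?W' ?W"
    using L2_ip[OF L(3) L(1)] L(2,4) by simp
  also have "\<dots> = cnj (ip (L2 P) ?W ?W')" by (rule L2.ip_commute[OF W_in])
  also have "\<dots> = cnj (ip (L2 \<mu>) ?d (cross_op ?b))"
    using ito_map_ip[OF \<mu> d \<rho> b] cross_op(2)[OF b d] by (simp add: W)
  also have "\<dots> = ip (L2 \<mu>) (cross_op ?b) ?d" by (rule L2.ip_commute[OF d cross_op(1)[OF b], symmetric])
  finally show "(\<integral>\<omega>. rep ?W \<omega> * rep ?W' \<omega> \<partial>P) = ip (L2 \<mu>) (cross_op ?b) ?d" .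
qed

text \<open>Guarantees that \<open>krein_feller\<close> is applied inside its domain, so that
  \<open>cross_deriv\<close> is a genuine derivative and not the default value of a restricted
  function.\<close>

lemma cross_covariance_in_rkhs:
  assumes "B \<in> fmeasurable \<rho>"
  shows "cross_covariance X F I e \<mu> \<rho> B \<in> measure_rkhs \<mu>"
  unfolding cross_covariance_eq[OF assms] measure_rkhs_eq using cross_op(1) assms by simp

lemma cross_op_extension: "is_L2_extension \<rho> (L2 \<mu>) (cross_deriv X F I e \<mu> \<rho>) cross_op"
  unfolding is_L2_extension_def
proof (intro conjI ballI cross_op_continuous_linear)
  fix B assume B: "B \<in> fmeasurable \<rho>"
  show "cross_op (L2_class \<rho> (indicator B)) = cross_deriv X F I e \<mu> \<rho> B"
    unfolding cross_deriv_def cross_covariance_eq[OF B]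
    by (rule krein_feller_set_function[symmetric]) (use cross_op(1) B in simp)
qed

text \<open>Makes the description behind \<open>L2_extension\<close> meaningful: indicators together
  with their derivatives determine exactly one continuous linear map.\<close>

lemma cross_deriv_extension:
  "\<exists>!T. is_L2_extension \<rho> (L2 \<mu>) (cross_deriv X F I e \<mu> \<rho>) T"
  using cross_op_extension is_L2_extension_unique[OF inner_space_L2] by blast

lemma ito_adjoint_ito_eq_extension:
  assumes "u \<in> vecs (L2 \<rho>)"
  shows "ito_adjoint X F I e \<mu> (ito X F I e \<rho> u) = L2_extension \<rho> (L2 \<mu>) (cross_deriv X F I e \<mu> \<rho>) u"
  using ito_adjoint_ito[OF assms] L2_extension_eqI[OF inner_space_L2 cross_op_extension] by simp

end

theorem theorem5p6:
  fixes X :: "'a set" and F :: "'a set set"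
    and I :: "'i set" and e :: "'i \<Rightarrow> 'a uni_vec"
    and \<mu>\<^sub>1 \<mu>\<^sub>2 :: "'a measure"
  assumes "sigma_algebra X F"
    and "real_orthonormal_basis X F I e"
    and "sigma_finite_on X F \<mu>\<^sub>1" and "sigma_finite_on X F \<mu>\<^sub>2"
  shows "(\<forall>B\<in>fmeasurable \<mu>\<^sub>2. cross_covariance X F I e \<mu>\<^sub>1 \<mu>\<^sub>2 B \<in> measure_rkhs \<mu>\<^sub>1) \<and>
    (\<exists>!T. is_L2_extension \<mu>\<^sub>2 (L2 \<mu>\<^sub>1) (cross_deriv X F I e \<mu>\<^sub>1 \<mu>\<^sub>2) T) \<and>
    (\<forall>f\<^sub>2\<in>vecs (L2 \<mu>\<^sub>2).
      ito_adjoint X F I e \<mu>\<^sub>1 (ito X F I e \<mu>\<^sub>2 f\<^sub>2)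
        = L2_extension \<mu>\<^sub>2 (L2 \<mu>\<^sub>1) (cross_deriv X F I e \<mu>\<^sub>1 \<mu>\<^sub>2) f\<^sub>2) \<and>
    (\<forall>A\<in>fmeasurable \<mu>\<^sub>1. cross_covariance X F I e \<mu>\<^sub>2 \<mu>\<^sub>1 A \<in> measure_rkhs \<mu>\<^sub>2) \<and>
    (\<exists>!T. is_L2_extension \<mu>\<^sub>1 (L2 \<mu>\<^sub>2) (cross_deriv X F I e \<mu>\<^sub>2 \<mu>\<^sub>1) T) \<and>
    (\<forall>f\<^sub>1\<in>vecs (L2 \<mu>\<^sub>1).
      ito_adjoint X F I e \<mu>\<^sub>2 (ito X F I e \<mu>\<^sub>1 f\<^sub>1)
        = L2_extension \<mu>\<^sub>1 (L2 \<mu>\<^sub>2) (cross_deriv X F I e \<mu>\<^sub>2 \<mu>\<^sub>1) f\<^sub>1)"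
proof -
  interpret A: brownian_pair X F I e \<mu>\<^sub>1 \<mu>\<^sub>2 by standard fact+
  interpret B: brownian_pair X F I e \<mu>\<^sub>2 \<mu>\<^sub>1 by standard fact+
  show ?thesis
    by (intro conjI ballI A.cross_covariance_in_rkhs A.cross_deriv_extension A.ito_adjoint_ito_eq_extension
        B.cross_covariance_in_rkhs B.cross_deriv_extension B.ito_adjoint_ito_eq_extension)
qed

end
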